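(* Suppose $U$ is a two-qubit unitary operator with Schmidt coefficients $s_0,s_1,s_2,s_3$ arranged in nonincreasing order. Then $\mu(U)=5$ if $s_0>s_1=s_2=s_3>0$, and $\mu(U)=4$ otherwise; in addition, $U$ can be verified by an entanglement-free protocol unless $s_0>s_1=s_2=s_3>0$.
   Context: The Schmidt coefficients of a two-qubit unitary $U$ on $\mathcal{H}_A\otimes\mathcal{H}_B$ are the Schmidt coefficients of its Choi state $U|\Phi\rangle_{AA'}\otimes|\Phi\rangle_{BB'}$ (with $|\Phi\rangle=\frac{1}{\sqrt2}\sum_k|kk\rangle$) with respect to the partition $AA'|BB'$. A verification protocol for $U$ consists of pure product input test states and, for each output state $U|\psi_j\rangle$, a verification protocol based on nonadaptive local projective measurements; it is ordinary if each output-state verification operator has positive spectral gap. One experimental setting means the preparation of a pure product input state together with one nonadaptive local projective measurement on the output state; $\mu(U)$ is the minimum number of experimental settings required to verify $U$ by ordinary protocols. A verification protocol is entanglement free if all input test states and the corresponding output states are product states and all measurements are local projective measurements. *)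

theory Defs
  imports "HOL-Analysis.Analysis"
begin

text \<open>Vectors of a finite-dimensional Hilbert space with a fixed product basis are
  elements of complex^'n (with 'n a finite index type); operators are complex^'n^'n,
  multiplied with ** and applied to vectors with *v.  A qubit has index type 2,
  two qubits A,B have index type 2 times 2 (first component = A).\<close>

type_synonym qvec = "complex^2"
type_synonym qop  = "complex^2^2"
type_synonym tvec = "complex^(2 \<times> 2)"
type_synonym top  = "complex^(2 \<times> 2)^(2 \<times> 2)"

definition cinner :: "complex^'n \<Rightarrow> complex^'n \<Rightarrow> complex" where
  "cinner u v = (\<Sum>i\<in>UNIV. cnj (u$i) * v$i)"

definition adj :: "complex^'n^'m \<Rightarrow> complex^'m^'n" where
  "adj A = (\<chi> i j. cnj (A$j$i))"

definition trace :: "complex^'n^'n \<Rightarrow> complex" where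
  "trace A = (\<Sum>i\<in>UNIV. A$i$i)"

definition outer :: "complex^'n \<Rightarrow> complex^'n \<Rightarrow> complex^'n^'n" where
  "outer u v = (\<chi> i j. u$i * cnj (v$j))"

definition tensor :: "complex^'a \<Rightarrow> complex^'b \<Rightarrow> complex^('a \<times> 'b)" where
  "tensor u v = (\<chi> ij. u$(fst ij) * v$(snd ij))"

definition kron :: "complex^'a^'a \<Rightarrow> complex^'b^'b \<Rightarrow> complex^('a \<times> 'b)^('a \<times> 'b)" where
  "kron A B = (\<chi> ij kl. A$(fst ij)$(fst kl) * B$(snd ij)$(snd kl))"

definition unitary :: "complex^'n^'n \<Rightarrow> bool" where
  "unitary U \<longleftrightarrow> adj U ** U = mat 1 \<and> U ** adj U = mat 1"

definition is_proj :: "complex^'n^'n \<Rightarrow> bool" where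
  "is_proj P \<longleftrightarrow> adj P = P \<and> P ** P = P"

definition orthonormal_fam :: "(nat \<Rightarrow> complex^'n) \<Rightarrow> nat \<Rightarrow> bool" where
  "orthonormal_fam x n \<longleftrightarrow> (\<forall>i<n. \<forall>j<n. cinner (x i) (x j) = (if i = j then 1 else 0))"

definition Phi :: tvec where
  "Phi = (\<chi> kk'. if fst kk' = snd kk' then complex_of_real (1 / sqrt 2) else 0)"

text \<open>Choi state (U_AB \<otimes> I_A'B') |Phi>_AA' |Phi>_BB', written as a vector of the
  bipartite system (AA') | (BB'): the index ((a,a'),(b,b')).\<close>
definition choi :: "top \<Rightarrow> complex^((2 \<times> 2) \<times> (2 \<times> 2))" where
  "choi U = (\<chi> x. let aa' = fst x; bb' = snd x in
     (\<Sum>c\<in>UNIV. \<Sum>d\<in>UNIV. U$(fst aa', fst bb')$(c, d) * Phi$(c, snd aa') * Phi$(d, snd bb')))"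

definition schmidt_coeffs :: "complex^((2 \<times> 2) \<times> (2 \<times> 2)) \<Rightarrow> (nat \<Rightarrow> real) \<Rightarrow> bool" where
  "schmidt_coeffs Psi s \<longleftrightarrow>
     (\<forall>k<3. s (Suc k) \<le> s k) \<and> (\<forall>k<4. 0 \<le> s k) \<and>
     (\<exists>x y. orthonormal_fam x 4 \<and> orthonormal_fam y 4 \<and>
        Psi = (\<Sum>k<4. s k *\<^sub>R tensor (x k) (y k)))"

definition is_channel :: "top list \<Rightarrow> bool" where
  "is_channel Ks \<longleftrightarrow> sum_list (map (\<lambda>K. adj K ** K) Ks) = mat 1"

definition apply_ch :: "top list \<Rightarrow> top \<Rightarrow> top" where
  "apply_ch Ks \<rho> = sum_list (map (\<lambda>K. K ** \<rho> ** adj K) Ks)"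

text \<open>A projective measurement on a qubit: a list of projectors summing to the identity
  (the outcomes are the list indices).\<close>
definition qubit_pm :: "qop list \<Rightarrow> bool" where
  "qubit_pm Ps \<longleftrightarrow> (\<forall>P\<in>set Ps. is_proj P) \<and> sum_list Ps = mat 1"

text \<open>A test (one measurement setting on the output): probability p, a nonadaptive local
  projective measurement (Ps on A, Qs on B), and the set of accepted outcome pairs.\<close>
type_synonym setting = "real \<times> qop list \<times> qop list \<times> (nat \<times> nat) set"

definition test_op :: "setting \<Rightarrow> top" where
  "test_op t = (case t of (p, Ps, Qs, acc) \<Rightarrow>
     (\<Sum>ij\<in>acc \<inter> ({..<length Ps} \<times> {..<length Qs}). kron (Ps ! fst ij) (Qs ! snd ij)))"

definition setting_prob :: "setting \<Rightarrow> real" where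
  "setting_prob t = fst t"

text \<open>Verification strategy (protocol) for the pure state phi based on nonadaptive local
  projective measurements: a nonempty list of tests chosen with positive probabilities
  summing to 1, each accepting phi with certainty.\<close>
definition valid_strategy :: "tvec \<Rightarrow> setting list \<Rightarrow> bool" where
  "valid_strategy phi S \<longleftrightarrow> S \<noteq> [] \<and> sum_list (map setting_prob S) = 1 \<and>
     (\<forall>t\<in>set S. case t of (p, Ps, Qs, acc) \<Rightarrow>
        p > 0 \<and> qubit_pm Ps \<and> qubit_pm Qs \<and> test_op t *v phi = phi)"

definition strategy_op :: "setting list \<Rightarrow> top" where
  "strategy_op S = sum_list (map (\<lambda>t. setting_prob t *\<^sub>R test_op t) S)"

text \<open>Quadratic form and the second largest eigenvalue of a Hermitian operator via the
  Courant--Fischer min-max characterization.\<close>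
definition qform :: "top \<Rightarrow> tvec \<Rightarrow> real" where
  "qform A v = Re (cinner v (A *v v))"

definition second_eig :: "top \<Rightarrow> real" where
  "second_eig A = (INF v\<in>UNIV. SUP w\<in>{w. norm w = 1 \<and> cinner v w = 0}. qform A w)"

definition spectral_gap :: "top \<Rightarrow> real" where
  "spectral_gap A = 1 - second_eig A"

text \<open>A protocol: list of entries (mu_j, a_j, b_j, S_j): the pure product input test state
  a_j \<otimes> b_j is chosen with probability mu_j, and the output state U(a_j \<otimes> b_j)
  is verified by the strategy S_j.\<close>
type_synonym protocol = "(real \<times> qvec \<times> qvec \<times> setting list) list"

definition input_state :: "real \<times> qvec \<times> qvec \<times> setting list \<Rightarrow> tvec" where
  "input_state e = (case e of (m, a, b, S) \<Rightarrow> tensor a b)"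

definition valid_protocol :: "top \<Rightarrow> protocol \<Rightarrow> bool" where
  "valid_protocol U prot \<longleftrightarrow> prot \<noteq> [] \<and> sum_list (map fst prot) = 1 \<and>
     (\<forall>e\<in>set prot. case e of (m, a, b, S) \<Rightarrow>
        m > 0 \<and> norm a = 1 \<and> norm b = 1 \<and> valid_strategy (U *v tensor a b) S)"

definition pass_prob :: "top list \<Rightarrow> protocol \<Rightarrow> real" where
  "pass_prob Ks prot = sum_list (map (\<lambda>e. case e of (m, a, b, S) \<Rightarrow>
      m * sum_list (map (\<lambda>t. setting_prob t *
        Re (trace (test_op t ** apply_ch Ks (outer (tensor a b) (tensor a b))))) S)) prot)"

definition verifies :: "top \<Rightarrow> protocol \<Rightarrow> bool" where
  "verifies U prot \<longleftrightarrow> valid_protocol U prot \<and>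
     (\<forall>Ks. is_channel Ks \<and> pass_prob Ks prot = 1 \<longrightarrow> (\<forall>\<rho>. apply_ch Ks \<rho> = U ** \<rho> ** adj U))"

definition ordinary :: "protocol \<Rightarrow> bool" where
  "ordinary prot \<longleftrightarrow> (\<forall>e\<in>set prot. case e of (m, a, b, S) \<Rightarrow> spectral_gap (strategy_op S) > 0)"

definition num_settings :: "protocol \<Rightarrow> nat" where
  "num_settings prot = sum_list (map (\<lambda>e. case e of (m, a, b, S) \<Rightarrow> length S) prot)"

definition mu :: "top \<Rightarrow> nat" where
  "mu U = (LEAST n. \<exists>prot. verifies U prot \<and> ordinary prot \<and> num_settings prot = n)"

definition is_product :: "tvec \<Rightarrow> bool" where
  "is_product v \<longleftrightarrow> (\<exists>a b. v = tensor a b)"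

text \<open>Entanglement free: input test states (product by construction) and corresponding
  output states are product; measurements are local projective by construction.\<close>
definition entanglement_free :: "top \<Rightarrow> protocol \<Rightarrow> bool" where
  "entanglement_free U prot \<longleftrightarrow> (\<forall>e\<in>set prot. is_product (input_state e) \<and> is_product (U *v input_state e))"

end

theory Submission
  imports Defs
begin

text \<open>
Write \<open>U\<close> as local unitaries around an operator that is diagonal in the magic basis, with unimodular
eigenvalues \<open>\<kappa> k\<close>.  In magic coordinates \<open>z\<close> an input is a product vector iff \<open>\<Sum>k. (z k)\<^sup>2 = 0\<close>, and
its output is a product vector iff \<open>\<Sum>k. (\<kappa> k)\<^sup>2 (z k)\<^sup>2 = 0\<close>.  These are linear conditions on the
squares \<open>(z k)\<^sup>2\<close>, so solutions stay solutions under sign changes of coordinates.  Unless exactly three of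
the \<open>(\<kappa> k)\<^sup>2\<close> coincide, there is a solution without zero coordinates, and suitable sign changes of it give
four linearly independent inputs, all nonorthogonal to one of them; such inputs determine \<open>U\<close>, and one
setting suffices for each product output.  If exactly three coincide, one coordinate vanishes on all
solutions, so product outputs cannot determine \<open>U\<close>; an output verified by a single setting is a
product, hence a fifth setting is needed, and it suffices.  The Schmidt coefficients are the moduli of
the Pauli coefficients of the diagonal operator, a Hadamard transform of \<open>\<kappa>\<close>; three of the
\<open>(\<kappa> k)\<^sup>2\<close> coincide and the fourth differs iff the three smallest Schmidt coefficients coincide, are
positive, and differ from the largest.
\<close>

text \<open>Products are the zeros of a determinant, and the magic basis makes that quadratic form a
  sum of squares. A unitary operator preserving the form is local up to a swap of the qubits, so
  diagonalization by a real orthogonal matrix is what yields local factors. The swap is a mere sign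
  in this basis and disappears into the phases. Independence of the inputs alone does not exclude
  channels that give each input its own phase; a common nonorthogonal partner forces the phases to
  agree. This constrains the sign changes, since changing a sign can produce an orthogonal vector.
  The two lower bounds differ in kind. Four comes from dimension: the inputs have to span. Five uses
  the positive gap, since a single test that accepts a whole subspace may accept an entangled output
  as well. The sorted Schmidt coefficients and the unsorted complex Pauli coefficients belong to two
  decompositions of one vector, which are compared through eigenvectors of the reduced
  operator.\<close>

section \<open>Linear algebra of complex vectors, tensor products and product states\<close>

lemma sum_pair2: "(\<Sum>i\<in>(UNIV::(2\<times>2) set). f i) = f (1,1) + f (1,2) + f (2,1) + f (2,2)"
  for f :: "2 \<times> 2 \<Rightarrow> 'a::comm_monoid_add"
proof -
  have *: "(UNIV::(2\<times>2) set) = {(1,1),(1,2),(2,1),(2,2)}"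
    by (auto simp: UNIV_2[symmetric] intro!: set_eqI) (metis exhaust_2)+
  show ?thesis unfolding * by (simp add: add.assoc)
qed

lemma cinner_add_left: "cinner (u + u') v = cinner u v + cinner u' v"
  by (simp add: cinner_def algebra_simps sum.distrib)

lemma cinner_add_right: "cinner u (v + v') = cinner u v + cinner u v'"
  by (simp add: cinner_def algebra_simps sum.distrib)

lemma cinner_diff_left: "cinner (u - u') v = cinner u v - cinner u' v"
  by (simp add: cinner_def algebra_simps sum_subtractf)

lemma cinner_diff_right: "cinner u (v - v') = cinner u v - cinner u v'"
  by (simp add: cinner_def algebra_simps sum_subtractf)

lemma cinner_scale_left: "cinner (c *s u) v = cnj c * cinner u v"
  by (simp add: cinner_def algebra_simps sum_distrib_left)

lemma cinner_scale_right: "cinner u (c *s v) = c * cinner u v"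
  by (simp add: cinner_def algebra_simps sum_distrib_left)

lemma cinner_zero [simp]: "cinner 0 v = 0" "cinner v 0 = 0"
  by (simp_all add: cinner_def)

lemma cinner_commute: "cinner u v = cnj (cinner v u)"
  by (simp add: cinner_def mult.commute)

lemma cinner_eq_0_commute: "cinner u v = 0 \<longleftrightarrow> cinner v u = 0"
  by (metis cinner_commute complex_cnj_zero)

lemma cinner_self: "cinner v v = complex_of_real ((norm v)\<^sup>2)"
  unfolding cinner_def norm_vec_def L2_set_def
  by (simp add: sum_nonneg mult.commute flip: complex_norm_square)

lemma cinner_self_eq_0 [simp]: "cinner v v = 0 \<longleftrightarrow> v = 0"
  by (simp add: cinner_self)

lemma Re_cinner_self: "Re (cinner v v) = (norm v)\<^sup>2"
  by (simp add: cinner_self)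

lemma norm_1_iff_cinner: "norm v = 1 \<longleftrightarrow> cinner v v = 1"
  by (metis cinner_self norm_ge_zero of_real_1 of_real_eq_iff power2_eq_1_iff
      one_power2 not_one_le_zero le_minus_one_simps(3))

lemma norm_cscale: "norm (c *s v) = cmod c * norm v" for v :: "complex^'n"
proof -
  have "complex_of_real ((norm (c *s v))\<^sup>2) = complex_of_real ((cmod c * norm v)\<^sup>2)"
    unfolding cinner_self[symmetric] cinner_scale_left cinner_scale_right
    by (simp add: cinner_self power_mult_distrib complex_norm_square[symmetric] mult.commute flip: of_real_power)
  then have "(norm (c *s v))\<^sup>2 = (cmod c * norm v)\<^sup>2" by (simp only: of_real_eq_iff)
  then show ?thesis by (simp add: power2_eq_iff_nonneg)
qed

lemma scaleR_eq_cscale: "r *\<^sub>R v = complex_of_real r *s v" for v :: "complex^'n"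
  by (simp add: vec_eq_iff scaleR_conv_of_real[where 'a=complex])

lemma adj_mult: "adj (A ** B) = adj B ** adj A"
  by (simp add: adj_def matrix_matrix_mult_def vec_eq_iff mult.commute)

lemma adj_adj [simp]: "adj (adj A) = A"
  by (simp add: adj_def vec_eq_iff)

lemma adj_mat_1 [simp]: "adj (mat 1) = mat 1"
  by (simp add: adj_def mat_def vec_eq_iff)

lemma adj_diff: "adj (A - B) = adj A - adj B"
  by (simp add: adj_def vec_eq_iff)

lemma adj_outer: "adj (outer u v) = outer v u"
  by (simp add: adj_def outer_def vec_eq_iff mult.commute)

lemma cinner_mult_right: "cinner u (A *v w) = cinner (adj A *v u) w"
proof -
  have "cinner u (A *v w) = (\<Sum>i\<in>UNIV. \<Sum>j\<in>UNIV. cnj (u$i) * A$i$j * w$j)"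
    by (simp add: cinner_def matrix_vector_mult_def sum_distrib_left mult.assoc)
  also have "\<dots> = (\<Sum>j\<in>UNIV. \<Sum>i\<in>UNIV. cnj (u$i) * A$i$j * w$j)"
    by (rule sum.swap)
  also have "\<dots> = cinner (adj A *v u) w"
    by (simp add: cinner_def matrix_vector_mult_def sum_distrib_right sum_distrib_left adj_def mult.commute mult.left_commute)
  finally show ?thesis .
qed

lemma cinner_mult_left: "cinner (A *v u) w = cinner u (adj A *v w)"
  by (simp add: cinner_mult_right)

lemma matrix_vector_mult_cscale: "A *v (c *s v) = c *s (A *v v)" for A :: "complex^'n^'m"
  by (simp add: matrix_vector_mult_def vec_eq_iff sum_distrib_left mult.left_commute)

lemma outer_mult: "outer u v *v w = cinner v w *s u"
  by (simp add: outer_def matrix_vector_mult_def cinner_def vec_eq_iff sum_distrib_right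
      sum_distrib_left mult.assoc mult.commute mult.left_commute)

lemma mult_outer: "A ** outer u v = outer (A *v u) v"
  by (simp add: outer_def matrix_vector_mult_def matrix_matrix_mult_def vec_eq_iff sum_distrib_right mult.assoc)

lemma outer_mult_adj: "outer u v ** adj A = outer u (A *v v)"
  by (simp add: outer_def matrix_vector_mult_def matrix_matrix_mult_def vec_eq_iff sum_distrib_left
      adj_def mult.assoc mult.commute mult.left_commute)

lemma trace_outer: "trace (outer u v) = cinner v u"
  by (simp add: trace_def outer_def cinner_def mult.commute)

lemma unitary_cinner: "unitary U \<Longrightarrow> cinner (U *v u) (U *v v) = cinner u v"
  by (simp add: cinner_mult_left matrix_vector_mul_assoc unitary_def)

lemma unitary_norm: "unitary U \<Longrightarrow> norm (U *v u) = norm u"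
proof -
  assume "unitary U"
  then have "complex_of_real ((norm (U *v u))\<^sup>2) = complex_of_real ((norm u)\<^sup>2)"
    unfolding cinner_self[symmetric] by (rule unitary_cinner)
  then show ?thesis by (simp only: of_real_eq_iff) (simp add: power2_eq_iff_nonneg)
qed

lemma unitary_mult: "unitary U \<Longrightarrow> unitary V \<Longrightarrow> unitary (U ** V)"
  unfolding unitary_def adj_mult
  by (metis matrix_mul_assoc matrix_mul_lid)

lemma unitary_adj: "unitary U \<Longrightarrow> unitary (adj U)"
  by (auto simp: unitary_def)

lemma unitary_mult_adj:
  assumes "unitary U"
  shows "adj U ** U = mat 1" "U ** adj U = mat 1" "adj U *v (U *v v) = v" "U *v (adj U *v v) = v"
  using assms by (auto simp: unitary_def matrix_vector_mul_assoc)

lemma adj_kron: "adj (kron A B) = kron (adj A) (adj B)"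
  by (simp add: adj_def kron_def vec_eq_iff)

lemma kron_mult: "kron A B ** kron C D = kron (A ** C) (B ** D)"
  by (simp add: kron_def matrix_matrix_mult_def vec_eq_iff sum_product
      UNIV_Times_UNIV[symmetric] sum.cartesian_product split_beta mult.assoc mult.left_commute
      del: UNIV_Times_UNIV)

lemma kron_tensor: "kron A B *v tensor u v = tensor (A *v u) (B *v v)"
  by (simp add: kron_def tensor_def matrix_vector_mult_def vec_eq_iff sum_product
      UNIV_Times_UNIV[symmetric] sum.cartesian_product split_beta mult.assoc mult.left_commute
      del: UNIV_Times_UNIV)

lemma kron_mat_1 [simp]: "kron (mat 1) (mat 1) = mat 1"
  by (auto simp: kron_def mat_def vec_eq_iff)

lemma unitary_kron: "unitary A \<Longrightarrow> unitary B \<Longrightarrow> unitary (kron A B)"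
  by (simp add: unitary_def adj_kron kron_mult)

lemma cinner_tensor: "cinner (tensor a b) (tensor c d) = cinner a c * cinner b d"
  by (simp add: cinner_def tensor_def sum_product
      UNIV_Times_UNIV[symmetric] sum.cartesian_product split_beta mult.assoc mult.left_commute
      del: UNIV_Times_UNIV)

lemma norm_tensor: "norm (tensor a b) = norm a * norm b"
proof -
  have "complex_of_real ((norm (tensor a b))\<^sup>2) = complex_of_real ((norm a * norm b)\<^sup>2)"
    unfolding cinner_self[symmetric] cinner_tensor by (simp add: cinner_self power_mult_distrib)
  then have "(norm (tensor a b))\<^sup>2 = (norm a * norm b)\<^sup>2" by (simp only: of_real_eq_iff)
  then show ?thesis by (simp add: power2_eq_iff_nonneg)
qed

lemma tensor_cscale: "tensor (c *s a) (d *s b) = (c * d) *s tensor a b"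
  by (simp add: tensor_def vec_eq_iff)

lemma outer_tensor: "kron (outer a b) (outer c d) = outer (tensor a c) (tensor b d)"
  by (simp add: tensor_def kron_def outer_def vec_eq_iff)

lemma normalize_product:
  assumes "is_product v" "norm v = 1"
  obtains a b where "norm a = 1" "norm b = 1" "v = tensor a b"
proof -
  from assms(1) obtain a b where v: "v = tensor a b" by (auto simp: is_product_def)
  then have n: "norm a * norm b = 1" using assms(2) norm_tensor by metis
  then have "norm a \<noteq> 0" "norm b \<noteq> 0" by auto
  show ?thesis
  proof (rule that[of "complex_of_real (1 / norm a) *s a" "complex_of_real (1 / norm b) *s b"])
    show "norm (complex_of_real (1 / norm a) *s a) = 1"
      unfolding norm_cscale using \<open>norm a \<noteq> 0\<close> by (simp add: norm_divide)
    show "norm (complex_of_real (1 / norm b) *s b) = 1"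
      unfolding norm_cscale using \<open>norm b \<noteq> 0\<close> by (simp add: norm_divide)
    have "complex_of_real (1 / norm a) * complex_of_real (1 / norm b) = complex_of_real (1 / (norm a * norm b))"
      by simp
    then show "v = tensor (complex_of_real (1 / norm a) *s a) (complex_of_real (1 / norm b) *s b)"
      unfolding tensor_cscale using n v by simp
  qed
qed

lemma is_product_kron: "is_product v \<Longrightarrow> is_product (kron A B *v v)"
  unfolding is_product_def by (metis kron_tensor)

lemma is_product_kron_iff:
  assumes "unitary A" "unitary B"
  shows "is_product (kron A B *v v) \<longleftrightarrow> is_product v"
proof
  assume "is_product (kron A B *v v)"
  then have "is_product (kron (adj A) (adj B) *v (kron A B *v v))" by (rule is_product_kron)
  then show "is_product v" using assms
    by (simp add: matrix_vector_mul_assoc kron_mult unitary_mult_adj)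
qed (rule is_product_kron)

text \<open>The four coordinates form a 2 by 2 matrix, and products are the matrices of rank at most
  one. The converse factors out a nonzero entry of the first row, or uses the second row if the
  first vanishes.\<close>

lemma is_product_iff_det: "is_product v \<longleftrightarrow> v$(1,1) * v$(2,2) = v$(1,2) * v$(2,1)"
proof
  assume "is_product v" then show "v$(1,1) * v$(2,2) = v$(1,2) * v$(2,1)"
    by (auto simp: is_product_def tensor_def)
next
  assume e: "v$(1,1) * v$(2,2) = v$(1,2) * v$(2,1)"
  have eq: "w = tensor a b" if "w$(1,1) = a$1*b$1" "w$(1,2) = a$1*b$2" "w$(2,1) = a$2*b$1" "w$(2,2) = a$2*b$2"
    for w :: tvec and a b
    using that by (simp add: vec_eq_iff tensor_def forall_2)
  show "is_product v"
  proof (cases "v$(1,1) = 0")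
    case False
    have "v = tensor (vector [1, v$(2,1) / v$(1,1)]) (vector [v$(1,1), v$(1,2)])"
      by (rule eq) (use False e in \<open>simp_all add: field_simps\<close>)
    then show ?thesis by (auto simp: is_product_def)
  next
    case True
    show ?thesis
    proof (cases "v$(1,2) = 0")
      case t: True
      have "v = tensor (vector [0, 1]) (vector [v$(2,1), v$(2,2)])"
        by (rule eq) (use True t in simp_all)
      then show ?thesis by (auto simp: is_product_def)
    next
      case False
      then have "v$(2,1) = 0" using True e by simp
      then have "v = tensor (vector [1, v$(2,2) / v$(1,2)]) (vector [0, v$(1,2)])"
        by (intro eq) (use True False in simp_all)
      then show ?thesis by (auto simp: is_product_def)
    qed
  qed
qed

subsection \<open>Inputs that determine a unitary\<close>

text \<open>With one vector per dimension the conjugates fill the rows of a square matrix. A zero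
  row excludes a right inverse, hence a left inverse, hence a trivial kernel.\<close>

lemma exists_orthogonal:
  fixes f :: "'n::finite \<Rightarrow> complex^'n"
  assumes "f i0 = 0"
  obtains v where "v \<noteq> 0" "\<And>i. cinner (f i) v = 0"
proof -
  define A where "A = (\<chi> i j. cnj (f i $ j))"
  have av: "(A *v v) $ i = cinner (f i) v" for v i
    by (simp add: A_def matrix_vector_mult_def cinner_def)
  have "\<not> (\<exists>C. A ** C = mat 1)"
  proof
    assume "\<exists>C. A ** C = mat 1"
    then obtain C where C: "A ** C = mat 1" by blast
    have "(A ** C) $ i0 $ i0 = 0" using assms by (simp add: A_def matrix_matrix_mult_def)
    then show False using C by (simp add: mat_def)
  qed
  then have "\<not> (\<exists>C. C ** A = mat 1)" by (metis matrix_left_right_inverse)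
  then obtain v where "A *v v = 0" "v \<noteq> 0" using matrix_left_invertible_ker by blast
  then show ?thesis using that av by (metis zero_index)
qed

lemma exists_orthogonal_list:
  fixes xs :: "tvec list"
  assumes "length xs \<le> 3"
  obtains v where "v \<noteq> 0" "\<And>x. x \<in> set xs \<Longrightarrow> cinner x v = 0"
proof -
  have "\<exists>h. bij_betw h (UNIV::(2\<times>2) set) {0..<4::nat}"
    using ex_bij_betw_finite_nat[of "UNIV::(2\<times>2) set"] by simp
  then obtain h where h: "bij_betw h (UNIV::(2\<times>2) set) {0..<4::nat}" by blast
  \<comment> \<open>Slots beyond the list are padded with 0; slot 3 is always among them and
    provides the zero row.\<close>
  define f where "f i = (if h i < length xs then xs ! h i else 0)" for i
  have "3 \<in> h ` UNIV" using h by (auto simp: bij_betw_def)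
  then obtain i0 where "h i0 = 3" by auto
  then have "f i0 = 0" using assms by (simp add: f_def)
  then obtain v where v: "v \<noteq> 0" "\<And>i. cinner (f i) v = 0" by (metis exists_orthogonal)
  show ?thesis
  proof (rule that[OF v(1)])
    fix x assume "x \<in> set xs"
    then obtain n where n: "n < length xs" "x = xs ! n" by (auto simp: in_set_conv_nth)
    then have "n \<in> h ` UNIV" using h assms by (auto simp: bij_betw_def)
    then obtain i where "h i = n" by auto
    then show "cinner x v = 0" using v(2)[of i] n by (simp add: f_def)
  qed
qed

section \<open>Pass probabilities as quadratic forms, and criteria for verification\<close>

lemma qform_add: "qform (A + B) v = qform A v + qform B v"
  by (simp add: qform_def matrix_vector_mult_add_rdistrib cinner_add_right)

lemma qform_diff: "qform (A - B) v = qform A v - qform B v"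
  by (simp add: qform_def matrix_vector_mult_diff_rdistrib cinner_diff_right)

lemma qform_zero [simp]: "qform 0 v = 0"
  by (simp add: qform_def)

lemma qform_mat_1: "qform (mat 1) v = (norm v)\<^sup>2"
  by (simp add: qform_def Re_cinner_self)

lemma qform_scaleR: "qform (r *\<^sub>R A) v = r * qform A v"
proof -
  have "(r *\<^sub>R A) *v v = complex_of_real r *s (A *v v)"
    by (simp add: matrix_vector_mult_def vec_eq_iff sum_distrib_left mult.assoc
        scaleR_conv_of_real[where 'a=complex])
  then show ?thesis by (simp add: qform_def cinner_scale_right)
qed

lemma qform_outer: "qform (outer x x) v = (cmod (cinner x v))\<^sup>2"
proof -
  have "cinner v (outer x x *v v) = cinner x v * cnj (cinner x v)"
    by (simp add: outer_mult cinner_scale_right cinner_commute[of v x])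
  then show ?thesis by (simp add: qform_def complex_norm_square[symmetric] flip: of_real_power)
qed

lemma qform_strategy_op:
  "qform (strategy_op S) v = sum_list (map (\<lambda>t. setting_prob t * qform (test_op t) v) S)"
  unfolding strategy_op_def by (induction S) (auto simp: qform_add qform_scaleR)

lemma sum_list_map_swap:
  "sum_list (map (\<lambda>t. p t * sum_list (map (g t) Ks)) S) =
   sum_list (map (\<lambda>K. sum_list (map (\<lambda>t. p t * g t K) S)) Ks)" for p :: "'a \<Rightarrow> real"
  by (induction Ks) (auto simp: distrib_left sum_list_addf)

lemma Re_trace_apply_ch:
  "Re (trace (A ** apply_ch Ks (outer \<psi> \<psi>))) = sum_list (map (\<lambda>K. qform A (K *v \<psi>)) Ks)"
proof (induction Ks)
  case Nil
  then show ?case by (simp add: apply_ch_def trace_def)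
next
  case (Cons K Ks)
  have tr: "trace (X + Y) = trace X + trace Y" for X Y :: top
    by (simp add: trace_def sum.distrib)
  have "apply_ch (K # Ks) (outer \<psi> \<psi>) = outer (K *v \<psi>) (K *v \<psi>) + apply_ch Ks (outer \<psi> \<psi>)"
    by (simp add: apply_ch_def mult_outer outer_mult_adj)
  then show ?case using Cons
    by (simp add: matrix_add_ldistrib tr mult_outer trace_outer qform_def)
qed

text \<open>Exchanging the sums over tests and Kraus operators leaves one quadratic form per entry,
  evaluated at the unnormalized Kraus outputs. Arguments about passing then concern vectors instead
  of density operators.\<close>

lemma pass_prob_eq:
  "pass_prob Ks prot = sum_list (map (\<lambda>(m, a, b, S).
     m * sum_list (map (\<lambda>K. qform (strategy_op S) (K *v tensor a b)) Ks)) prot)"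
  unfolding pass_prob_def Re_trace_apply_ch
  by (intro arg_cong[where f=sum_list] map_cong refl)
     (auto simp: qform_strategy_op sum_list_map_swap)

lemma channel_cinner:
  assumes "is_channel Ks"
  shows "sum_list (map (\<lambda>K. cinner (K *v u) (K *v v)) Ks) = cinner u v"
proof -
  have "sum_list (map (\<lambda>K. cinner (K *v u) (K *v v)) Ks) =
        cinner u (sum_list (map (\<lambda>K. adj K ** K) Ks) *v v)"
    by (induction Ks)
       (auto simp: matrix_vector_mult_add_rdistrib cinner_add_right cinner_mult_left matrix_vector_mul_assoc)
  then show ?thesis using assms by (simp add: is_channel_def)
qed

lemma Re_sum_list: "Re (sum_list (map f xs)) = sum_list (map (\<lambda>x. Re (f x)) xs)"
  by (induction xs) auto

lemma channel_norm:
  assumes "is_channel Ks"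
  shows "sum_list (map (\<lambda>K. (norm (K *v v))\<^sup>2) Ks) = (norm v)\<^sup>2"
  using arg_cong[OF channel_cinner[OF assms, of v v], of Re] by (simp add: Re_sum_list Re_cinner_self)

text \<open>Saturation principle. It carries certain acceptance over to every entry and every Kraus
  operator, and a minimal total of settings over to every entry.\<close>

lemma sum_list_eq_pointwise:
  fixes f g :: "'a \<Rightarrow> real"
  assumes "sum_list (map f xs) = sum_list (map g xs)" "\<And>x. x \<in> set xs \<Longrightarrow> f x \<le> g x" "x \<in> set xs"
  shows "f x = g x"
  using assms
proof (induction xs)
  case (Cons y ys)
  have "sum_list (map f ys) \<le> sum_list (map g ys)"
    using Cons.prems(2) by (intro sum_list_mono) auto
  moreover have "f y \<le> g y" using Cons.prems(2) by simp
  moreover have "f y + sum_list (map f ys) = g y + sum_list (map g ys)" using Cons.prems(1) by simp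
  ultimately have "f y = g y" "sum_list (map f ys) = sum_list (map g ys)" by linarith+
  then show ?case using Cons by auto
qed auto

lemma input_state_simp [simp]: "input_state (m, a, b, S) = tensor a b"
  by (simp add: input_state_def)

lemma strategy_op_perfect:
  assumes "valid_strategy \<phi> S"
  shows "strategy_op S *v \<phi> = \<phi>"
proof -
  have "strategy_op S' *v \<phi> = complex_of_real (sum_list (map setting_prob S')) *s \<phi>"
    if "\<forall>t\<in>set S'. test_op t *v \<phi> = \<phi>" for S'
    using that
  proof (induction S')
    case (Cons t S')
    have "(setting_prob t *\<^sub>R test_op t) *v \<phi> = setting_prob t *\<^sub>R (test_op t *v \<phi>)"
      by (simp add: matrix_vector_mult_def vec_eq_iff scaleR_sum_right)
    then have "(setting_prob t *\<^sub>R test_op t) *v \<phi> = complex_of_real (setting_prob t) *s \<phi>"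
      using Cons.prems by (simp add: scaleR_eq_cscale)
    then show ?case using Cons
      by (simp add: strategy_op_def matrix_vector_mult_add_rdistrib vector_sadd_rdistrib)
  qed (simp add: strategy_op_def)
  moreover have "\<forall>t\<in>set S. test_op t *v \<phi> = \<phi>" "sum_list (map setting_prob S) = 1"
    using assms by (auto simp: valid_strategy_def)
  ultimately show ?thesis by simp
qed

text \<open>If the input states miss a direction \<open>v\<close>, flipping the sign of \<open>v\<close> before
  applying \<open>U\<close> passes every test.\<close>

lemma not_verifies_if_orthogonal:
  assumes U: "unitary U" and v0: "v \<noteq> 0"
    and orth: "\<And>e. e \<in> set prot \<Longrightarrow> cinner v (input_state e) = 0"
  shows "\<not> verifies U prot"
proof
  assume ver: "verifies U prot"
  then have vp: "valid_protocol U prot" by (simp add: verifies_def)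
  \<comment> \<open>Householder reflection along \<open>v\<close>; dividing by the squared norm
    allows \<open>v\<close> to be unnormalized.\<close>
  define R where "R = mat 1 - outer (complex_of_real (2 / (norm v)\<^sup>2) *s v) v"
  have Rx: "R *v x = x - (complex_of_real (2 / (norm v)\<^sup>2) * cinner v x) *s v" for x
    by (simp add: R_def matrix_vector_mult_diff_rdistrib outer_mult vec_eq_iff)
  have aR: "adj R = R"
    by (simp add: R_def adj_diff adj_outer) (simp add: outer_def vec_eq_iff)
  have Rv: "R *v v = - v"
    using v0 unfolding Rx cinner_self by (simp add: vec_eq_iff flip: of_real_mult)
  have "R *v (R *v x) = x" for x
  proof -
    have "R *v (R *v x) = R *v x - (complex_of_real (2 / (norm v)\<^sup>2) * cinner v x) *s (R *v v)"
      by (subst (2) Rx) (simp add: matrix_vector_mult_diff_distrib matrix_vector_mult_cscale)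
    then show ?thesis unfolding Rv by (simp add: Rx vec_eq_iff)
  qed
  then have RR: "R ** R = mat 1"
    by (simp add: matrix_eq matrix_vector_mul_assoc[symmetric])
  define K where "K = U ** R"
  have "adj K ** K = R ** (adj U ** U) ** R"
    by (simp add: K_def adj_mult aR matrix_mul_assoc)
  then have ch: "is_channel [K]"
    using U RR by (simp add: is_channel_def unitary_mult_adj)
  have K: "K *v input_state e = U *v input_state e" if "e \<in> set prot" for e
    by (simp add: K_def matrix_vector_mul_assoc[symmetric] Rx orth[OF that])
  have "pass_prob [K] prot = sum_list (map fst prot)"
    unfolding pass_prob_eq
  proof (intro arg_cong[where f=sum_list] map_cong refl)
    fix e assume e: "e \<in> set prot"
    obtain m a b S where E: "e = (m, a, b, S)" by (cases e) auto
    have vs: "valid_strategy (U *v tensor a b) S" "norm a = 1" "norm b = 1"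
      using vp e E by (auto simp: valid_protocol_def)
    have "norm (U *v tensor a b) = 1"
      using vs U by (simp add: unitary_norm norm_tensor)
    then have "qform (strategy_op S) (K *v tensor a b) = 1"
      using K[OF e] E vs(1) by (simp add: qform_def strategy_op_perfect Re_cinner_self)
    then show "(case e of (m, a, b, S) \<Rightarrow> m * (\<Sum>K\<leftarrow>[K]. qform (strategy_op S) (K *v tensor a b))) = fst e"
      by (simp add: E)
  qed
  then have "pass_prob [K] prot = 1" using vp by (simp add: valid_protocol_def)
  then have eq: "K ** \<rho> ** adj K = U ** \<rho> ** adj U" for \<rho>
    using ver ch by (auto simp: verifies_def apply_ch_def)
  obtain e where e: "e \<in> set prot" using vp by (cases prot) (auto simp: valid_protocol_def)
  define x where "x = input_state e"
  have "norm x = 1" using vp e by (auto simp: valid_protocol_def x_def norm_tensor)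
  have Kx: "K *v x = U *v x" using K[OF e] by (simp add: x_def)
  have Kv: "K *v v = - (U *v v)"
    by (simp add: K_def matrix_vector_mul_assoc[symmetric] Rv)
       (metis diff_0 matrix_vector_mult_0_right matrix_vector_mult_diff_distrib)
  \<comment> \<open>Diagonal inputs cannot see the relative sign of two vectors. The off-diagonal
    operator \<open>outer v x\<close> can: \<open>K\<close> and \<open>U\<close> agree on
    \<open>x\<close> and differ by a sign on \<open>v\<close>.\<close>
  have "outer (- (U *v v)) (U *v x) = outer (U *v v) (U *v x)"
    using eq[of "outer v x"] by (simp add: mult_outer outer_mult_adj Kx Kv)
  then have "outer (- (U *v v)) (U *v x) *v (U *v x) = outer (U *v v) (U *v x) *v (U *v x)" by simp
  then have "- (U *v v) = U *v v"
    using \<open>norm x = 1\<close> U by (simp add: outer_mult cinner_self unitary_norm)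
  then have "U *v v = 0" by (simp add: vec_eq_iff complex_eq_iff)
  then show False using v0 unitary_norm[OF U, of v] by simp
qed

lemma verifies_length:
  assumes "unitary U" "verifies U prot"
  shows "4 \<le> length prot"
proof (rule ccontr)
  assume "\<not> 4 \<le> length prot"
  then have "length (map input_state prot) \<le> 3" by simp
  then obtain v where "v \<noteq> 0" and v: "\<And>x. x \<in> set (map input_state prot) \<Longrightarrow> cinner x v = 0"
    by (metis exists_orthogonal_list)
  have "cinner v (input_state e) = 0" if "e \<in> set prot" for e
    using v[of "input_state e"] that by (simp add: cinner_eq_0_commute)
  then show False
    using not_verifies_if_orthogonal[OF assms(1) \<open>v \<noteq> 0\<close>] assms(2) by blast
qed

text \<open>Working form of a strategy with positive gap: an operator bounded by the identity that
  reaches this bound only along \<phi>. Quadratic forms make it applicable to unnormalized Kraus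
  outputs.\<close>

definition accepts_only :: "top \<Rightarrow> tvec \<Rightarrow> bool" where
  "accepts_only A \<phi> \<longleftrightarrow> (\<forall>v. qform A v \<le> (norm v)\<^sup>2) \<and>
     (\<forall>v. qform A v = (norm v)\<^sup>2 \<longrightarrow> (\<exists>c. v = c *s \<phi>))"

text \<open>Every Kraus operator multiplies each input state by a scalar; nonorthogonality with a
  common input state forces these scalars to agree.\<close>

lemma verifies_if_connected:
  assumes U: "unitary U" and vp: "valid_protocol U prot"
    and ao: "\<And>m a b S. (m, a, b, S) \<in> set prot \<Longrightarrow> accepts_only (strategy_op S) (U *v tensor a b)"
    and e0: "e0 \<in> set prot"
    and conn: "\<And>e. e \<in> set prot \<Longrightarrow> cinner (input_state e0) (input_state e) \<noteq> 0"
    and span: "\<And>v. (\<And>e. e \<in> set prot \<Longrightarrow> cinner (input_state e) v = 0) \<Longrightarrow> v = 0"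
  shows "verifies U prot"
  unfolding verifies_def
proof (intro conjI allI impI vp)
  fix Ks \<rho>
  assume "is_channel Ks \<and> pass_prob Ks prot = 1"
  then have ch: "is_channel Ks" and pp: "pass_prob Ks prot = 1" by auto
  have n1: "norm (input_state e) = 1" if "e \<in> set prot" for e
    using vp that by (auto simp: valid_protocol_def norm_tensor)
  have "\<exists>c. K *v input_state e = c *s (U *v input_state e)" if e: "e \<in> set prot" and K: "K \<in> set Ks" for e K
  proof -
    obtain m a b S where E: "e = (m, a, b, S)" by (cases e) auto
    have acc: "qform (strategy_op S') v \<le> (norm v)\<^sup>2" if "(m', a', b', S') \<in> set prot" for m' a' b' S' v
      using ao[OF that] by (simp add: accepts_only_def)
    \<comment> \<open>Passing with probability one saturates two bounds in turn: that of each entry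
      by its weight, and within an entry that of each Kraus operator by the squared norm of its
      output.\<close>
    have "(case e of (m, a, b, S) \<Rightarrow> m * (\<Sum>K\<leftarrow>Ks. qform (strategy_op S) (K *v tensor a b))) = fst e"
    proof (rule sum_list_eq_pointwise[where xs=prot and f = "\<lambda>e. (case e of (m, a, b, S) \<Rightarrow> m * (\<Sum>K\<leftarrow>Ks. qform (strategy_op S) (K *v tensor a b)))" and g = fst])
      show "(\<Sum>(m, a, b, S)\<leftarrow>prot. m * (\<Sum>K\<leftarrow>Ks. qform (strategy_op S) (K *v tensor a b))) = sum_list (map fst prot)"
        using pp vp by (simp add: pass_prob_eq valid_protocol_def)
    next
      fix e' assume e': "e' \<in> set prot"
      obtain m' a' b' S' where E': "e' = (m', a', b', S')" by (cases e') auto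
      have "m' > 0" using vp e' E' by (auto simp: valid_protocol_def)
      have "(\<Sum>K\<leftarrow>Ks. qform (strategy_op S') (K *v tensor a' b')) \<le> (\<Sum>K\<leftarrow>Ks. (norm (K *v tensor a' b'))\<^sup>2)"
        using acc e' E' by (intro sum_list_mono) auto
      also have "\<dots> = 1" using channel_norm[OF ch] n1[OF e'] E' by simp
      finally show "(case e' of (m, a, b, S) \<Rightarrow> m * (\<Sum>K\<leftarrow>Ks. qform (strategy_op S) (K *v tensor a b))) \<le> fst e'"
        using \<open>m' > 0\<close> by (simp add: E' mult_left_le)
    qed (rule e)
    moreover have "m > 0" using vp e E by (auto simp: valid_protocol_def)
    ultimately have "(\<Sum>K\<leftarrow>Ks. qform (strategy_op S) (K *v tensor a b)) = 1" by (simp add: E)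
    also have "1 = (\<Sum>K\<leftarrow>Ks. (norm (K *v tensor a b))\<^sup>2)"
      using channel_norm[OF ch, of "tensor a b"] n1[OF e] E by simp
    finally have "qform (strategy_op S) (K *v tensor a b) = (norm (K *v tensor a b))\<^sup>2"
      by (rule sum_list_eq_pointwise[where f="\<lambda>K. qform (strategy_op S) (K *v tensor a b)"])
         (use acc e E K in auto)
    then show ?thesis using ao[of m a b S] e E by (auto simp: accepts_only_def)
  qed
  then have "\<forall>K e. \<exists>c. e \<in> set prot \<longrightarrow> K \<in> set Ks \<longrightarrow> K *v input_state e = c *s (U *v input_state e)"
    by blast
  then obtain c where "\<forall>K e. e \<in> set prot \<longrightarrow> K \<in> set Ks \<longrightarrow> K *v input_state e = c K e *s (U *v input_state e)"
    by metis
  then have c: "K *v input_state e = c K e *s (U *v input_state e)"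
    if "e \<in> set prot" "K \<in> set Ks" for K e using that by blast
  \<comment> \<open>Channels preserve inner products on summing over Kraus operators. For
    nonorthogonal inputs the factor \<open>cinner\<close> cancels, so the two families of scalars
    have overlap one.\<close>
  have ip: "(\<Sum>K\<leftarrow>Ks. cnj (c K e) * c K e') * cinner (input_state e) (input_state e') =
      cinner (input_state e) (input_state e')" if "e \<in> set prot" "e' \<in> set prot" for e e'
  proof -
    have "(\<Sum>K\<leftarrow>Ks. cnj (c K e) * c K e') * cinner (input_state e) (input_state e')
       = (\<Sum>K\<leftarrow>Ks. (cnj (c K e) * c K e') * cinner (input_state e) (input_state e'))"
      by (simp add: sum_list_mult_const)
    also have "\<dots> = (\<Sum>K\<leftarrow>Ks. cinner (K *v input_state e) (K *v input_state e'))"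
      by (intro arg_cong[where f=sum_list] map_cong refl)
         (simp add: c that cinner_scale_left cinner_scale_right unitary_cinner[OF U])
    finally show ?thesis by (simp add: channel_cinner[OF ch])
  qed
  have one: "(\<Sum>K\<leftarrow>Ks. cnj (c K e) * c K e) = 1" if "e \<in> set prot" for e
    using ip[OF that that] n1[OF that] by (simp add: cinner_self)
  have ceq: "c K e = c K e0" if e: "e \<in> set prot" and K: "K \<in> set Ks" for K e
  proof -
    have x: "(\<Sum>K\<leftarrow>Ks. cnj (c K e0) * c K e) = 1" using ip[OF e0 e] conn[OF e] by simp
    have "cnj (\<Sum>K\<leftarrow>Ks. cnj (c K e0) * c K e) = (\<Sum>K\<leftarrow>Ks. cnj (c K e) * c K e0)"
      by (induction Ks) (auto simp: mult.commute)
    then have y: "(\<Sum>K\<leftarrow>Ks. cnj (c K e) * c K e0) = 1" using x by simp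
    \<comment> \<open>Equality case of Cauchy-Schwarz: two unit families with overlap one have
      squared distance 1 + 1 - 1 - 1 = 0.\<close>
    have "(\<Sum>K\<leftarrow>Ks. cnj (c K e - c K e0) * (c K e - c K e0)) =
       (\<Sum>K\<leftarrow>Ks. cnj (c K e) * c K e) + (\<Sum>K\<leftarrow>Ks. cnj (c K e0) * c K e0)
       - (\<Sum>K\<leftarrow>Ks. cnj (c K e0) * c K e) - (\<Sum>K\<leftarrow>Ks. cnj (c K e) * c K e0)"
      by (induction Ks) (auto simp: algebra_simps)
    also have "\<dots> = 0" using one[OF e] one[OF e0] x y by simp
    finally have "Re (\<Sum>K\<leftarrow>Ks. cnj (c K e - c K e0) * (c K e - c K e0)) = 0" by simp
    moreover have "Re (cnj z * z) = (cmod z)\<^sup>2" for z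
      by (metis Re_complex_of_real complex_norm_square mult.commute)
    ultimately have "(\<Sum>K\<leftarrow>Ks. (cmod (c K e - c K e0))\<^sup>2) = 0"
      by (simp only: Re_sum_list)
    then have "(cmod (c K e - c K e0))\<^sup>2 = 0" using K
      by (subst (asm) sum_list_nonneg_eq_0_iff) auto
    then show ?thesis by simp
  qed
  have KU: "K = (\<chi> i j. c K e0 * U$i$j)" if K: "K \<in> set Ks" for K
  proof -
    define D where "D = K - (\<chi> i j. c K e0 * U$i$j)"
    have D0: "D *v input_state e = 0" if e: "e \<in> set prot" for e
    proof -
      have "D *v input_state e = K *v input_state e - c K e0 *s (U *v input_state e)"
        by (simp add: D_def matrix_vector_mult_def vec_eq_iff sum_distrib_left algebra_simps sum_subtractf)
      then show ?thesis using c[OF e K] ceq[OF e K] by simp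
    qed
    \<comment> \<open>A row of \<open>D\<close> that annihilates the inputs has a conjugate
      orthogonal to them, so spanning applies row by row.\<close>
    then have "cinner (input_state e) (\<chi> j. cnj (D$i$j)) = 0" if "e \<in> set prot" for e i
    proof -
      have "(D *v input_state e) $ i = cinner (\<chi> j. cnj (D$i$j)) (input_state e)"
        by (simp add: cinner_def matrix_vector_mult_def)
      then show ?thesis
        using D0[OF that] by (simp add: cinner_eq_0_commute)
    qed
    then have "(\<chi> j. cnj (D$i$j)) = 0" for i using span by blast
    then have "D = 0" by (simp add: vec_eq_iff)
    then show ?thesis by (simp add: D_def)
  qed
  \<comment> \<open>All Kraus operators are multiples of \<open>U\<close>, so the channel is a
    weighted sum of copies of conjugation by \<open>U\<close>; the weights add up to one.\<close>
  have "apply_ch Ks \<rho> = (\<chi> i j. (\<Sum>K\<leftarrow>Ks. cnj (c K e0) * c K e0) * (U ** \<rho> ** adj U)$i$j)"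
    if "\<forall>K\<in>set Ks. K = (\<chi> i j. c K e0 * U$i$j)" for Ks
    using that
  proof (induction Ks)
    case Nil
    then show ?case by (simp add: apply_ch_def vec_eq_iff)
  next
    case (Cons K Ks)
    have "K ** \<rho> ** adj K = (\<chi> i j. cnj (c K e0) * c K e0 * (U ** \<rho> ** adj U)$i$j)"
    proof -
      have "K = (\<chi> i j. c K e0 * U$i$j)" using Cons.prems by simp
      moreover have "(\<chi> i j. d * U$i$j) ** \<rho> ** adj (\<chi> i j. d * U$i$j)
         = (\<chi> i j. cnj d * d * (U ** \<rho> ** adj U)$i$j)" for d
        by (simp add: matrix_matrix_mult_def adj_def vec_eq_iff sum_distrib_left sum_distrib_right
            mult.assoc mult.left_commute)
      ultimately show ?thesis by metis
    qed
    then show ?case using Cons by (simp add: apply_ch_def vec_eq_iff distrib_right)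
  qed
  then have "apply_ch Ks \<rho> = (\<chi> i j. (\<Sum>K\<leftarrow>Ks. cnj (c K e0) * c K e0) * (U ** \<rho> ** adj U)$i$j)"
    using KU by blast
  then show "apply_ch Ks \<rho> = U ** \<rho> ** adj U"
    using one[OF e0] by (simp add: vec_eq_iff)
qed

subsection \<open>Spectral gaps and local tests\<close>

lemma continuous_on_qform: "continuous_on S (qform A)"
  unfolding qform_def cinner_def matrix_vector_mult_def by (auto intro!: continuous_intros)

lemma qform_sphere_bound:
  obtains C where "\<And>w. norm w = 1 \<Longrightarrow> \<bar>qform A w\<bar> \<le> C"
proof -
  have "compact (qform A ` sphere 0 1)"
    by (intro compact_continuous_image continuous_on_qform compact_sphere)
  then have "bounded (qform A ` sphere 0 1)" by (rule compact_imp_bounded)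
  then obtain C where "\<forall>x\<in>sphere 0 1. \<bar>qform A x\<bar> \<le> C" by (auto simp: bounded_iff)
  then show ?thesis by (intro that[of C]) simp
qed

abbreviation orth_sphere :: "tvec \<Rightarrow> tvec set" where
  "orth_sphere v \<equiv> {w. norm w = 1 \<and> cinner v w = 0}"

lemma exists_normalizing_factor:
  fixes w :: "complex^'n"
  assumes "w \<noteq> 0"
  obtains c where "norm (c *s w) = 1"
proof
  show "norm (complex_of_real (1 / norm w) *s w) = 1"
    unfolding norm_cscale using assms by (simp add: norm_divide)
qed

lemma orth_sphere_nonempty: "orth_sphere v \<noteq> {}"
proof -
  obtain w where "w \<noteq> 0" and w: "\<And>x. x \<in> set [v] \<Longrightarrow> cinner x w = 0"
    by (rule exists_orthogonal_list[of "[v]"]) auto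
  obtain c where "norm (c *s w) = 1" using \<open>w \<noteq> 0\<close> by (rule exists_normalizing_factor)
  then have "c *s w \<in> orth_sphere v" using w[of v] by (simp add: cinner_scale_right)
  then show ?thesis by blast
qed

lemma bdd_above_qform: "bdd_above (qform A ` orth_sphere v)"
proof -
  obtain C where "\<And>w. norm w = 1 \<Longrightarrow> \<bar>qform A w\<bar> \<le> C" by (rule qform_sphere_bound[of A]) blast
  then show ?thesis by (intro bdd_aboveI2[where M=C]) (auto simp: abs_le_iff)
qed

text \<open>The choice of \<phi> as the excluded vector in the min-max already suffices: on the
  compact unit sphere orthogonal to \<phi> the form attains its maximum, and the value 1 there would
  put a unit vector orthogonal to \<phi> on its line.\<close>

lemma spectral_gap_pos:
  assumes ao: "accepts_only A \<phi>" and n: "norm \<phi> = 1"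
  shows "spectral_gap A > 0"
proof -
  have "closed (orth_sphere \<phi>)"
    unfolding cinner_def by (intro closed_Collect_conj closed_Collect_eq continuous_intros)
  moreover have "bounded (orth_sphere \<phi>)" by (auto intro!: boundedI[where B=1])
  ultimately have "compact (orth_sphere \<phi>)" by (simp add: compact_eq_bounded_closed)
  then obtain w where w: "w \<in> orth_sphere \<phi>" and mx: "\<And>x. x \<in> orth_sphere \<phi> \<Longrightarrow> qform A x \<le> qform A w"
    using continuous_attains_sup[of "orth_sphere \<phi>" "qform A"] continuous_on_qform orth_sphere_nonempty
    by blast
  have "qform A w \<noteq> (norm w)\<^sup>2"
  proof
    assume "qform A w = (norm w)\<^sup>2"
    then obtain c where "w = c *s \<phi>" using ao by (auto simp: accepts_only_def)
    then show False using w n by (auto simp: cinner_scale_right cinner_self)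
  qed
  moreover have "qform A w \<le> (norm w)\<^sup>2" using ao by (simp add: accepts_only_def)
  ultimately have lt: "qform A w < 1" using w by auto
  \<comment> \<open>The infimum is bounded by one of its members only if the suprema are bounded
    below; a bound of the form on the whole sphere serves for all \<open>v\<close>.\<close>
  obtain C where C: "\<And>w. norm w = 1 \<Longrightarrow> \<bar>qform A w\<bar> \<le> C" by (rule qform_sphere_bound[of A]) blast
  have "- C \<le> (SUP w\<in>orth_sphere v. qform A w)" for v
  proof -
    obtain x where x: "x \<in> orth_sphere v" using orth_sphere_nonempty by blast
    have "- C \<le> qform A x" using C[of x] x by auto
    also have "\<dots> \<le> (SUP w\<in>orth_sphere v. qform A w)" by (rule cSUP_upper[OF x bdd_above_qform])
    finally show ?thesis .
  qed
  then have "bdd_below (range (\<lambda>v. SUP w\<in>orth_sphere v. qform A w))" by (auto intro!: bdd_belowI2)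
  then have "second_eig A \<le> (SUP w\<in>orth_sphere \<phi>. qform A w)"
    unfolding second_eig_def by (rule cINF_lower) simp
  also have "\<dots> \<le> qform A w" using mx orth_sphere_nonempty by (intro cSUP_least) auto
  finally show ?thesis using lt by (simp add: spectral_gap_def)
qed

text \<open>Two independent fixed vectors span a plane of fixed vectors, which meets the orthogonal
  complement of every \<open>v\<close>. Each supremum in the min-max is then at least 1.\<close>

lemma spectral_gap_pos_unique:
  assumes gap: "spectral_gap A > 0" and \<phi>: "A *v \<phi> = \<phi>" "\<phi> \<noteq> 0" and \<psi>: "A *v \<psi> = \<psi>"
  shows "\<exists>c. \<psi> = c *s \<phi>"
proof (rule ccontr)
  assume np: "\<nexists>c. \<psi> = c *s \<phi>"
  have "1 \<le> (SUP w\<in>orth_sphere v. qform A w)" for v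
  proof -
    define w where "w = (if cinner v \<phi> = 0 then \<phi> else \<psi> - (cinner v \<psi> / cinner v \<phi>) *s \<phi>)"
    have "w \<noteq> 0" using np \<phi> by (auto simp: w_def)
    have "A *v w = w" using \<phi> \<psi> by (simp add: w_def matrix_vector_mult_diff_distrib matrix_vector_mult_cscale)
    have "cinner v w = 0" by (simp add: w_def cinner_diff_right cinner_scale_right)
    obtain c where c: "norm (c *s w) = 1" using \<open>w \<noteq> 0\<close> by (rule exists_normalizing_factor)
    have "A *v (c *s w) = c *s w" using \<open>A *v w = w\<close> by (simp add: matrix_vector_mult_cscale)
    then have "qform A (c *s w) = 1" using c by (simp add: qform_def Re_cinner_self)
    moreover have "c *s w \<in> orth_sphere v" using \<open>cinner v w = 0\<close> c by (simp add: cinner_scale_right)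
    ultimately show ?thesis using cSUP_upper[OF _ bdd_above_qform, of "c *s w" v A] by simp
  qed
  then have "1 \<le> second_eig A" unfolding second_eig_def by (intro cINF_greatest) auto
  then show False using gap by (simp add: spectral_gap_def)
qed

section \<open>Local projective tests and strategies for single output states\<close>

text \<open>Since the projectors add up to the identity, the squared norms of the images of
  \<open>a\<close> add up to that of \<open>a\<close>, and the image under projector
  \<open>i\<close> already takes all of it. This is where orthogonality of different outcomes comes
  from.\<close>

lemma projector_others_zero:
  assumes pm: "qubit_pm Ps" and i: "i < length Ps" and a: "Ps ! i *v a = a"
    and k: "k < length Ps" "k \<noteq> i"
  shows "Ps ! k *v a = 0"
proof -
  have sq: "cinner a (Ps ! j *v a) = complex_of_real ((norm (Ps ! j *v a))\<^sup>2)" if "j < length Ps" for j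
  proof -
    have "is_proj (Ps ! j)" using pm that by (simp add: qubit_pm_def)
    then show ?thesis unfolding cinner_self[symmetric] cinner_mult_left
      by (simp add: is_proj_def matrix_vector_mul_assoc)
  qed
  have "(\<Sum>P\<leftarrow>Ps. cinner a (P *v a)) = cinner a (sum_list Ps *v a)" for Ps
    by (induction Ps) (auto simp: matrix_vector_mult_add_rdistrib cinner_add_right)
  then have "(\<Sum>j<length Ps. cinner a (Ps ! j *v a)) = cinner a a"
    using pm by (simp add: qubit_pm_def sum_list_sum_nth lessThan_atLeast0)
  then have "(\<Sum>j<length Ps. complex_of_real ((norm (Ps ! j *v a))\<^sup>2)) = complex_of_real ((norm a)\<^sup>2)"
    using sq by (simp add: cinner_self)
  then have "(\<Sum>j<length Ps. (norm (Ps ! j *v a))\<^sup>2) = (norm a)\<^sup>2"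
    by (simp only: of_real_sum[symmetric] of_real_eq_iff)
  moreover have "(\<Sum>j<length Ps. (norm (Ps ! j *v a))\<^sup>2) =
      (norm a)\<^sup>2 + (\<Sum>j\<in>{..<length Ps} - {i}. (norm (Ps ! j *v a))\<^sup>2)"
    using i a by (subst sum.remove[of _ i]) auto
  ultimately have "(\<Sum>j\<in>{..<length Ps} - {i}. (norm (Ps ! j *v a))\<^sup>2) = 0" by simp
  then have "(norm (Ps ! k *v a))\<^sup>2 = 0" using k by (subst (asm) sum_nonneg_eq_0_iff) auto
  then show ?thesis by simp
qed

lemma matrix_sum_vector: "sum f I *v v = (\<Sum>i\<in>I. f i *v v)"
  by (induction I rule: infinite_finite_induct) (auto simp: matrix_vector_mult_add_rdistrib)

text \<open>The image of a single test contains a product vector, since it is spanned by the images of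
  products of projectors; a positive gap makes that image one-dimensional.\<close>

lemma single_test_product:
  assumes pm: "qubit_pm Ps" "qubit_pm Qs" and \<phi>: "test_op (p, Ps, Qs, acc) *v \<phi> = \<phi>" "\<phi> \<noteq> 0"
    and gap: "spectral_gap (test_op (p, Ps, Qs, acc)) > 0"
  shows "is_product \<phi>"
proof -
  define I where "I = acc \<inter> ({..<length Ps} \<times> {..<length Qs})"
  define T where "T = test_op (p, Ps, Qs, acc)"
  have Tv: "T *v v = (\<Sum>ij\<in>I. kron (Ps ! fst ij) (Qs ! snd ij) *v v)" for v
    by (simp add: T_def test_op_def I_def matrix_sum_vector)
  have finI: "finite I" by (simp add: I_def)
  have "\<exists>ij\<in>I. kron (Ps ! fst ij) (Qs ! snd ij) *v \<phi> \<noteq> 0"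
  proof (rule ccontr)
    assume "\<not> ?thesis"
    then have "T *v \<phi> = 0" unfolding Tv by (intro sum.neutral) blast
    then show False using \<phi> by (simp add: T_def)
  qed
  then obtain i j where ij: "(i, j) \<in> I" and nz: "kron (Ps ! i) (Qs ! j) *v \<phi> \<noteq> 0" by auto
  then have ilt: "i < length Ps" "j < length Qs" by (auto simp: I_def)
  have "Ps ! i \<noteq> 0" "Qs ! j \<noteq> 0" using nz
    by (intro notI; simp add: kron_def matrix_vector_mult_def vec_eq_iff)+
  \<comment> \<open>Any nonzero vectors in the ranges of the two projectors will do: their tensor
    product is fixed by the test, and the gap forces \<phi> onto its line.\<close>
  then obtain a' b' where ab': "Ps ! i *v a' \<noteq> 0" "Qs ! j *v b' \<noteq> 0"
    by (metis matrix_eq matrix_vector_mult_0)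
  define a b where "a = Ps ! i *v a'" and "b = Qs ! j *v b'"
  have "is_proj (Ps ! i)" "is_proj (Qs ! j)" using pm ilt by (auto simp: qubit_pm_def)
  then have ab: "Ps ! i *v a = a" "Qs ! j *v b = b"
    by (simp_all add: a_def b_def matrix_vector_mul_assoc is_proj_def)
  have "kron (Ps ! fst x) (Qs ! snd x) *v tensor a b = (if x = (i, j) then tensor a b else 0)"
    if "x \<in> I" for x
  proof -
    have "fst x < length Ps" "snd x < length Qs" using that by (auto simp: I_def)
    then show ?thesis
      using projector_others_zero[OF pm(1) ilt(1) ab(1), of "fst x"]
        projector_others_zero[OF pm(2) ilt(2) ab(2), of "snd x"] ab
      unfolding kron_tensor by (cases x) (auto simp: tensor_def vec_eq_iff)
  qed
  then have "T *v tensor a b = (\<Sum>x\<in>I. if x = (i, j) then tensor a b else 0)"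
    unfolding Tv by (intro sum.cong) auto
  also have "\<dots> = tensor a b" using ij finI by simp
  finally have "T *v tensor a b = tensor a b" .
  moreover have "tensor a b \<noteq> 0"
    using ab' by (metis a_def b_def mult_eq_0_iff norm_eq_zero norm_tensor)
  ultimately obtain c where "\<phi> = c *s tensor a b"
    using spectral_gap_pos_unique[of T "tensor a b" \<phi>] gap \<phi> by (auto simp: T_def)
  then have "\<phi> = tensor (c *s a) (1 *s b)" unfolding tensor_cscale by simp
  then show ?thesis by (auto simp: is_product_def)
qed

lemma is_proj_outer: "norm e = 1 \<Longrightarrow> is_proj (outer e e)"
  by (simp add: is_proj_def adj_outer mult_outer outer_mult cinner_self)

lemma is_proj_compl: "is_proj P \<Longrightarrow> is_proj (mat 1 - P)"
  by (auto simp: is_proj_def adj_diff matrix_eq matrix_vector_mul_assoc[symmetric]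
      matrix_vector_mult_diff_rdistrib matrix_vector_mult_diff_distrib)

lemma qubit_pm_outer: "norm e = 1 \<Longrightarrow> qubit_pm [outer e e, mat 1 - outer e e]"
  by (simp add: qubit_pm_def is_proj_outer is_proj_compl)

lemma norm_sq_decomp:
  assumes "norm x = 1"
  shows "(norm v)\<^sup>2 = (cmod (cinner x v))\<^sup>2 + (norm (v - cinner x v *s x))\<^sup>2"
proof -
  define d where "d = v - cinner x v *s x"
  have x1: "cinner x x = 1" using assms by (simp add: cinner_self)
  have d0: "cinner x d = 0" by (simp add: d_def cinner_diff_right cinner_scale_right x1)
  have v: "v = cinner x v *s x + d" by (simp add: d_def)
  have d0': "cinner d x = 0" using d0 by (simp add: cinner_eq_0_commute)
  have "cinner (\<alpha> *s x + d) (\<alpha> *s x + d) = cnj \<alpha> * \<alpha> + cinner d d" for \<alpha>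
    by (simp add: cinner_add_left cinner_add_right cinner_scale_left cinner_scale_right x1 d0 d0')
  then have "cinner v v = cnj (cinner x v) * cinner x v + cinner d d" using v by metis
  then have "complex_of_real ((norm v)\<^sup>2) = complex_of_real ((cmod (cinner x v))\<^sup>2 + (norm d)\<^sup>2)"
    by (simp only: cinner_self of_real_add complex_norm_square mult.commute)
  then show ?thesis by (simp only: of_real_eq_iff d_def)
qed

text \<open>Each factor is measured against its own complement and only the outcome pair
  \<open>(0,0)\<close> is accepted, which makes the test operator the projector onto \<phi>.\<close>

lemma product_strategy:
  assumes "is_product \<phi>" "norm \<phi> = 1"
  obtains S where "valid_strategy \<phi> S" "length S = 1" "accepts_only (strategy_op S) \<phi>"
proof -
  obtain a b where ab: "norm a = 1" "norm b = 1" and \<phi>: "\<phi> = tensor a b"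
    using assms by (rule normalize_product)
  define t :: setting where
    "t = (1, [outer a a, mat 1 - outer a a], [outer b b, mat 1 - outer b b], {(0,0)})"
  have "{(0::nat, 0::nat)} \<inter> {..<Suc (Suc 0)} \<times> {..<Suc (Suc 0)} = {(0,0)}" by auto
  then have T: "test_op t = outer \<phi> \<phi>" by (simp add: t_def test_op_def \<phi> outer_tensor)
  show ?thesis
  proof (rule that[of "[t]"])
    show "valid_strategy \<phi> [t]"
      using T ab assms(2) unfolding valid_strategy_def
      by (auto simp: t_def setting_prob_def qubit_pm_outer outer_mult cinner_self)
    have so: "strategy_op [t] = outer \<phi> \<phi>" using T by (simp add: strategy_op_def t_def setting_prob_def)
    show "accepts_only (strategy_op [t]) \<phi>"
      unfolding accepts_only_def
    proof (intro conjI allI impI)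
      fix v
      show "qform (strategy_op [t]) v \<le> (norm v)\<^sup>2"
        using norm_sq_decomp[OF assms(2), of v] so by (simp add: qform_outer)
      assume "qform (strategy_op [t]) v = (norm v)\<^sup>2"
      then have "norm (v - cinner \<phi> v *s \<phi>) = 0"
        using norm_sq_decomp[OF assms(2), of v] so by (simp add: qform_outer)
      then have "v = cinner \<phi> v *s \<phi>" by simp
      then show "\<exists>c. v = c *s \<phi>" ..
    qed
  qed simp
qed

lemma kron_diff: "kron (A - B) C = kron A C - kron B C" "kron A (C - D) = kron A C - kron A D"
  by (simp_all add: kron_def vec_eq_iff algebra_simps)

lemma unitary_columns: "outer (A *v axis 1 1) (A *v axis 1 1) + outer (A *v axis 2 1) (A *v axis 2 1) = mat 1"
  if "unitary A" for A :: qop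
proof -
  have "outer (A *v axis 1 1) (A *v axis 1 1) + outer (A *v axis 2 1) (A *v axis 2 1) = A ** adj A"
    by (simp add: vec_eq_iff outer_def matrix_matrix_mult_def matrix_vector_mult_def adj_def sum_2 axis_def forall_2)
  then show ?thesis using that by (simp add: unitary_mult_adj)
qed

text \<open>A state in Schmidt form is verified by testing the Schmidt basis and by excluding one product
  vector orthogonal to it that is unbiased on one side.\<close>

lemma schmidt_strategy:
  assumes A: "unitary A" and B: "unitary B"
    and \<phi>: "\<phi> = c1 *s tensor (A *v axis 1 1) (B *v axis 1 1) + c2 *s tensor (A *v axis 2 1) (B *v axis 2 1)"
    and n: "norm \<phi> = 1"
  obtains S where "valid_strategy \<phi> S" "length S = 2" "accepts_only (strategy_op S) \<phi>"
proof -
  define a1 a2 b1 b2 where "a1 = A *v axis 1 1" and "a2 = A *v axis 2 1"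
    and "b1 = B *v axis 1 1" and "b2 = B *v axis 2 1"
  have ax: "cinner (axis i (1::complex)) (axis j 1) = (if i = j then 1 else 0)" for i j :: 2
    using exhaust_2[of i] exhaust_2[of j] by (auto simp: cinner_def axis_def sum_2)
  have on: "cinner a1 a1 = 1" "cinner a2 a2 = 1" "cinner a1 a2 = 0" "cinner a2 a1 = 0"
    "cinner b1 b1 = 1" "cinner b2 b2 = 1" "cinner b1 b2 = 0" "cinner b2 b1 = 0"
    by (simp_all add: a1_def a2_def b1_def b2_def unitary_cinner[OF A] unitary_cinner[OF B] ax)
  define g1 g2 where "g1 = tensor a1 b1" and "g2 = tensor a2 b2"
  have g: "cinner g1 g1 = 1" "cinner g2 g2 = 1" "cinner g1 g2 = 0" "cinner g2 g1 = 0"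
    by (simp_all add: g1_def g2_def cinner_tensor on)
  have \<phi>g: "\<phi> = c1 *s g1 + c2 *s g2" by (simp add: \<phi> g1_def g2_def a1_def a2_def b1_def b2_def)
  have cc: "cnj c1 * c1 + cnj c2 * c2 = 1"
    using n unfolding norm_1_iff_cinner \<phi>g
    by (simp add: cinner_add_left cinner_add_right cinner_scale_left cinner_scale_right g algebra_simps)
  define r where "r = complex_of_real (1 / sqrt 2)"
  have r: "r * r = 1 / 2" "cnj r = r" "r \<noteq> 0" by (simp_all add: r_def flip: of_real_mult)
  \<comment> \<open>With \<open>x\<close> unbiased in the Schmidt basis of A, \<open>y\<close> is
    determined by orthogonality: the overlap of \<open>tensor x y\<close> with \<phi> is
    \<open>r * (c1 * c2 - c2 * c1)\<close>. The conjugates cancel against the antilinear argument of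
    \<open>cinner\<close>.\<close>
  define x y where "x = r *s a1 + r *s a2" and "y = cnj c2 *s b1 - cnj c1 *s b2"
  have "cinner x x = 1"
    by (simp add: x_def cinner_add_left cinner_add_right cinner_scale_left cinner_scale_right on r)
  then have nx: "norm x = 1" by (simp add: norm_1_iff_cinner)
  have "cinner y y = 1" using cc
    by (simp add: y_def cinner_diff_left cinner_diff_right cinner_scale_left cinner_scale_right on algebra_simps)
  then have ny: "norm y = 1" by (simp add: norm_1_iff_cinner)
  define h where "h = tensor x y"
  have hg: "cinner h g1 = r * c2" "cinner h g2 = - (r * c1)"
    by (simp_all add: h_def g1_def g2_def cinner_tensor x_def y_def cinner_add_left cinner_diff_left cinner_scale_left on r)
  have nh: "norm h = 1" by (simp add: h_def norm_tensor nx ny)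
  define t1 :: setting where "t1 = (1/2, [outer a1 a1, outer a2 a2], [outer b1 b1, outer b2 b2], {(0,0),(1,1)})"
  \<comment> \<open>Accepting every pair except \<open>(0,0)\<close> rejects exactly the direction
    \<open>h\<close>.\<close>
  define t2 :: setting where
    "t2 = (1/2, [outer x x, mat 1 - outer x x], [outer y y, mat 1 - outer y y], {(0,1),(1,0),(1,1)})"
  have "{(0::nat, 0::nat), (1,1)} \<inter> {..<Suc (Suc 0)} \<times> {..<Suc (Suc 0)} = {(0,0),(1,1)}" by auto
  then have T1: "test_op t1 = outer g1 g1 + outer g2 g2"
    by (simp add: t1_def test_op_def g1_def g2_def outer_tensor)
  have "{(0::nat, 1::nat), (1,0), (1,1)} \<inter> {..<Suc (Suc 0)} \<times> {..<Suc (Suc 0)} = {(0,1),(1,0),(1,1)}" by auto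
  then have T2: "test_op t2 = mat 1 - outer h h"
    by (simp add: t2_def test_op_def h_def outer_tensor[symmetric] kron_diff algebra_simps)
  have pa: "qubit_pm [outer a1 a1, outer a2 a2]" "qubit_pm [outer b1 b1, outer b2 b2]"
    using unitary_columns[OF A] unitary_columns[OF B] on
    by (simp_all add: qubit_pm_def a1_def a2_def b1_def b2_def is_proj_outer norm_1_iff_cinner)
  have q: "qform (strategy_op [t1, t2]) v =
     1/2 * ((cmod (cinner g1 v))\<^sup>2 + (cmod (cinner g2 v))\<^sup>2) + 1/2 * ((norm v)\<^sup>2 - (cmod (cinner h v))\<^sup>2)" for v
    unfolding qform_strategy_op by (simp add: T1 T2 qform_add qform_diff qform_outer qform_mat_1)
      (simp add: t1_def t2_def setting_prob_def)
  have dec: "(norm v)\<^sup>2 = (cmod (cinner g1 v))\<^sup>2 + (cmod (cinner g2 v))\<^sup>2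
     + (norm (v - cinner g1 v *s g1 - cinner g2 v *s g2))\<^sup>2" for v
  proof -
    have ng: "norm g1 = 1" "norm g2 = 1" by (simp_all add: norm_1_iff_cinner g)
    have "cinner g2 (v - cinner g1 v *s g1) = cinner g2 v"
      by (simp add: cinner_diff_right cinner_scale_right g)
    then show ?thesis
      using norm_sq_decomp[OF ng(1), of v] norm_sq_decomp[OF ng(2), of "v - cinner g1 v *s g1"] by simp
  qed
  have le: "1/2 * (X + Y) + 1/2 * (N - H) \<le> N" if "N = X + Y + Z" "0 \<le> H" "0 \<le> Z" for N X Y Z H :: real
    using that by (simp add: field_simps)
  have eq: "H = 0" "Z = 0" if "N = X + Y + Z" "0 \<le> H" "0 \<le> Z" "1/2 * (X + Y) + 1/2 * (N - H) = N"
    for N X Y Z H :: real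
    using that by (simp_all add: field_simps)
  show ?thesis
  proof (rule that[of "[t1, t2]"])
    show "valid_strategy \<phi> [t1, t2]"
    proof -
      have "test_op t1 *v \<phi> = \<phi>"
        by (simp add: T1 \<phi>g matrix_vector_mult_add_rdistrib outer_mult cinner_add_right cinner_scale_right g)
      moreover have "cinner h \<phi> = 0" by (simp add: \<phi>g cinner_add_right cinner_scale_right hg)
      then have "test_op t2 *v \<phi> = \<phi>" by (simp add: T2 matrix_vector_mult_diff_rdistrib outer_mult)
      ultimately show ?thesis
        unfolding valid_strategy_def using pa qubit_pm_outer[OF nx] qubit_pm_outer[OF ny]
        by (simp add: t1_def t2_def setting_prob_def)
    qed
    show "accepts_only (strategy_op [t1, t2]) \<phi>"
      unfolding accepts_only_def
    proof (intro conjI allI impI)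
      fix v
      show "qform (strategy_op [t1, t2]) v \<le> (norm v)\<^sup>2"
        unfolding q by (rule le[OF dec]) auto
    next
      fix v assume "qform (strategy_op [t1, t2]) v = (norm v)\<^sup>2"
      note e = this[unfolded q]
      have "(cmod (cinner h v))\<^sup>2 = 0" "(norm (v - cinner g1 v *s g1 - cinner g2 v *s g2))\<^sup>2 = 0"
        using eq[OF dec _ _ e] by simp_all
      then have h0: "cinner h v = 0" and v: "v = cinner g1 v *s g1 + cinner g2 v *s g2"
        by (simp_all add: algebra_simps)
      define \<alpha> \<beta> where "\<alpha> = cinner g1 v" and "\<beta> = cinner g2 v"
      have "\<alpha> * (r * c2) - \<beta> * (r * c1) = 0"
        using h0 by (subst (asm) v) (simp add: cinner_add_right cinner_scale_right hg \<alpha>_def \<beta>_def)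
      then have ab: "\<alpha> * c2 = \<beta> * c1" using r(3) by (simp add: algebra_simps)
      \<comment> \<open>One of \<open>c1\<close>, \<open>c2\<close> may vanish, so the factor is not
        a quotient but the inner product with the normalized pair of coefficients.\<close>
      define c where "c = cnj c1 * \<alpha> + cnj c2 * \<beta>"
      have "c * c1 = (cnj c1 * c1 + cnj c2 * c2) * \<alpha>"
        using ab by (simp add: c_def algebra_simps)
      moreover have "c * c2 = (cnj c1 * c1 + cnj c2 * c2) * \<beta>"
        using ab by (simp add: c_def algebra_simps)
      ultimately have "v = c *s \<phi>"
        using v unfolding \<phi>g by (simp add: cc \<alpha>_def \<beta>_def vector_add_ldistrib)
      then show "\<exists>c. v = c *s \<phi>" ..
    qed
  qed simp
qed

subsection \<open>Diagonalization of symmetric unitary matrices\<close>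

text \<open>For small \<open>t\<close> a linear term beats a quadratic one. This replaces
  differentiation at a maximum; \<open>t = b / L\<close> with \<open>L\<close> above
  \<open>K\<close> is small enough.\<close>

lemma linear_le_quadratic:
  fixes b K :: real
  assumes "\<And>t. 2 * t * b \<le> t\<^sup>2 * K"
  shows "b = 0"
proof (rule ccontr)
  assume "b \<noteq> 0"
  define L where "L = \<bar>K\<bar> + 1"
  have L: "L > 0" "K < L" by (auto simp: L_def)
  have "2 * (b / L) * b \<le> (b / L)\<^sup>2 * K" by (rule assms)
  then have "2 * b\<^sup>2 * L \<le> b\<^sup>2 * K" using L by (simp add: field_simps power2_eq_square)
  then have "2 * L \<le> K" using \<open>b \<noteq> 0\<close> by (simp add: mult.assoc[symmetric] mult.commute[of 2])
  then show False using L by linarith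
qed

text \<open>The Rayleigh quotient attains its maximum on the unit sphere of \<open>S\<close>.
  Perturbing a maximizer \<open>v\<close> in a direction orthogonal to it shows that
  \<open>f v\<close> has no component in that direction, in particular none along
  \<open>f v - c v\<close>.\<close>

lemma selfadjoint_eigenvector:
  fixes f :: "'a::euclidean_space \<Rightarrow> 'a"
  assumes S: "subspace S" "S \<noteq> {0}" and f: "linear f" "\<And>x. x \<in> S \<Longrightarrow> f x \<in> S"
    and sa: "\<And>x y. f x \<bullet> y = x \<bullet> f y"
  obtains v c where "v \<in> S" "norm v = 1" "f v = c *\<^sub>R v"
proof -
  obtain w where w: "w \<in> S" "w \<noteq> 0" using S subspace_0 by fastforce
  have "(1 / norm w) *\<^sub>R w \<in> S \<inter> sphere 0 1" using w S by (simp add: subspace_scale)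
  moreover have "compact (S \<inter> sphere 0 1)"
    using closed_subspace[OF S(1)] by (simp add: closed_Int_compact)
  moreover have "continuous_on (S \<inter> sphere 0 1) (\<lambda>x. x \<bullet> f x)"
    by (intro continuous_intros linear_continuous_on linear_conv_bounded_linear[THEN iffD1] f)
  ultimately have "\<exists>v\<in>S \<inter> sphere 0 1. \<forall>x\<in>S \<inter> sphere 0 1. x \<bullet> f x \<le> v \<bullet> f v"
    by (intro continuous_attains_sup) blast+
  then obtain v where v: "v \<in> S" "norm v = 1"
    and mx: "\<And>x. x \<in> S \<Longrightarrow> norm x = 1 \<Longrightarrow> x \<bullet> f x \<le> v \<bullet> f v"
    by auto
  define c where "c = v \<bullet> f v"
  have le: "x \<bullet> f x \<le> c * (x \<bullet> x)" if "x \<in> S" for x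
  proof (cases "x = 0")
    case False
    have "((1 / norm x) *\<^sub>R x) \<bullet> f ((1 / norm x) *\<^sub>R x) \<le> c"
      unfolding c_def using that False S by (intro mx) (auto simp: subspace_scale)
    then have "(x \<bullet> f x) / (norm x)\<^sup>2 \<le> c"
      using f(1) by (simp add: linear_scale power2_eq_square)
    then show ?thesis using False by (simp add: pos_divide_le_eq power2_norm_eq_inner)
  qed (simp add: linear_0[OF f(1)])
  have orth: "u \<bullet> f v = 0" if u: "u \<in> S" "u \<bullet> v = 0" for u
  proof (rule linear_le_quadratic)
    fix t :: real
    have "(v + t *\<^sub>R u) \<bullet> f (v + t *\<^sub>R u) \<le> c * ((v + t *\<^sub>R u) \<bullet> (v + t *\<^sub>R u))"
      using v u S by (intro le) (auto intro: subspace_add subspace_scale)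
    moreover have "(v + t *\<^sub>R u) \<bullet> f (v + t *\<^sub>R u) = c + 2 * t * (u \<bullet> f v) + t\<^sup>2 * (u \<bullet> f u)"
      using f(1) sa[of v u] by (simp add: linear_add linear_scale inner_add_left inner_add_right c_def
          power2_eq_square inner_commute algebra_simps)
    moreover have "(v + t *\<^sub>R u) \<bullet> (v + t *\<^sub>R u) = 1 + t\<^sup>2 * (u \<bullet> u)"
      using v u by (simp add: inner_add_left inner_add_right inner_commute power2_eq_square norm_eq_1)
    ultimately have "c + 2 * t * (u \<bullet> f v) + t\<^sup>2 * (u \<bullet> f u) \<le> c * (1 + t\<^sup>2 * (u \<bullet> u))"
      by (simp only:)
    then show "2 * t * (u \<bullet> f v) \<le> t\<^sup>2 * (c * (u \<bullet> u) - u \<bullet> f u)"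
      by (simp add: algebra_simps)
  qed
  define d where "d = f v - c *\<^sub>R v"
  have vv: "v \<bullet> v = 1" using v by (simp add: norm_eq_1)
  have "d \<in> S" using v f S by (simp add: d_def subspace_diff subspace_scale)
  moreover have dv: "d \<bullet> v = 0" by (simp add: d_def inner_diff_left vv c_def sa)
  ultimately have "d \<bullet> f v = 0" by (rule orth)
  moreover have "d \<bullet> d = d \<bullet> f v - c * (d \<bullet> v)"
    by (subst (2) d_def) (simp add: inner_diff_right)
  ultimately have "d \<bullet> d = 0" using dv by simp
  then have "f v = c *\<^sub>R v" by (simp add: d_def)
  then show ?thesis using v that by blast
qed

text \<open>An eigenspace of \<open>f\<close> inside \<open>S\<close> is invariant under
  \<open>g\<close> by commutation, so it contains a common eigenvector. Its orthogonal complement in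
  \<open>S\<close> is invariant under both maps by self-adjointness and has smaller
  dimension.\<close>

lemma simultaneous_eigenbasis:
  fixes f g :: "'a::euclidean_space \<Rightarrow> 'a"
  assumes f: "linear f" "\<And>x y. f x \<bullet> y = x \<bullet> f y"
    and g: "linear g" "\<And>x y. g x \<bullet> y = x \<bullet> g y"
    and comm: "\<And>x. f (g x) = g (f x)"
    and S: "subspace S" "\<And>x. x \<in> S \<Longrightarrow> f x \<in> S" "\<And>x. x \<in> S \<Longrightarrow> g x \<in> S"
  shows "\<exists>B. B \<subseteq> S \<and> pairwise orthogonal B \<and> span B = S \<and>
    (\<forall>b\<in>B. norm b = 1 \<and> (\<exists>c d. f b = c *\<^sub>R b \<and> g b = d *\<^sub>R b))"
  using S
proof (induction "dim S" arbitrary: S rule: less_induct)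
  case less
  show ?case
  proof (cases "S = {0}")
    case True
    then show ?thesis by (intro exI[of _ "{}"]) simp
  next
    case False
    obtain v0 c where v0: "v0 \<in> S" "norm v0 = 1" "f v0 = c *\<^sub>R v0"
      using selfadjoint_eigenvector[OF less.prems(1) False f(1) less.prems(2) f(2)] by metis
    define S' where "S' = {x \<in> S. f x = c *\<^sub>R x}"
    have "subspace S'" using less.prems(1) f(1)
      by (auto simp: S'_def subspace_def linear_0 linear_add linear_scale scaleR_add_right)
    moreover have "v0 \<in> S'" "v0 \<noteq> 0" using v0 by (auto simp: S'_def simp del: scaleR_cancel_left)
    then have "S' \<noteq> {0}" by blast
    moreover have "g x \<in> S'" if "x \<in> S'" for x
      using that less.prems(3) comm g(1) by (simp add: S'_def linear_scale)
    ultimately obtain v d where "v \<in> S'" and v: "norm v = 1" "g v = d *\<^sub>R v"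
      using selfadjoint_eigenvector[of S' g] g by metis
    then have fv: "v \<in> S" "f v = c *\<^sub>R v" by (auto simp: S'_def)
    have vv: "v \<bullet> v = 1" using v by (simp add: norm_eq_1)
    define T where "T = {x \<in> S. x \<bullet> v = 0}"
    have T: "subspace T" using less.prems(1) by (auto simp: T_def subspace_def inner_add_left)
    have "v \<notin> T" using vv by (simp add: T_def)
    moreover have "T \<subseteq> S" by (auto simp: T_def)
    ultimately have "T \<subset> S" using fv(1) by blast
    then have "dim T < dim S" using T less.prems(1) by (metis dim_psubset span_eq_iff)
    moreover have "f x \<in> T" if "x \<in> T" for x using that less.prems(2) fv f(2) by (simp add: T_def)
    moreover have "g x \<in> T" if "x \<in> T" for x using that less.prems(3) v g(2) by (simp add: T_def)
    ultimately obtain B where B: "B \<subseteq> T" "pairwise orthogonal B" "span B = T"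
      "\<forall>b\<in>B. norm b = 1 \<and> (\<exists>c d. f b = c *\<^sub>R b \<and> g b = d *\<^sub>R b)"
      using less.hyps[of T] T by blast
    have "span (insert v B) = S"
    proof
      show "span (insert v B) \<subseteq> S"
        using B(1) fv less.prems(1) \<open>T \<subset> S\<close> by (intro span_minimal) auto
      show "S \<subseteq> span (insert v B)"
      proof
        fix x assume "x \<in> S"
        then have "x - (x \<bullet> v) *\<^sub>R v \<in> T"
          using fv less.prems(1) vv by (simp add: T_def subspace_diff subspace_scale inner_diff_left)
        then show "x \<in> span (insert v B)" using B(3) by (auto simp: span_insert)
      qed
    qed
    moreover have "pairwise orthogonal (insert v B)"
      using B(1,2) by (auto simp: pairwise_insert T_def orthogonal_def inner_commute)
    moreover have "insert v B \<subseteq> S" using B(1) \<open>T \<subset> S\<close> fv by auto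
    ultimately show ?thesis using B(4) v fv by (intro exI[of _ "insert v B"]) auto
  qed
qed

text \<open>Real and imaginary parts of \<open>M\<close> are commuting real symmetric matrices and
  share a real orthonormal eigenbasis. That \<open>P\<close> is real, expressed by
  \<open>transpose P = adj P\<close>, is the point: only then does it preserve sums of
  squares.\<close>

lemma symmetric_unitary_diagonalization:
  fixes M :: "complex^'n^'n"
  assumes sym: "transpose M = M" and uni: "unitary M"
  obtains P :: "complex^'n^'n" and \<mu> where "unitary P" "transpose P = adj P" "M ** P = P ** (\<chi> i j. if i = j then \<mu> i else 0)"
proof -
  define X Y :: "real^'n^'n" where "X = (\<chi> i j. Re (M$i$j))" and "Y = (\<chi> i j. Im (M$i$j))"
  have s: "M$i$j = M$j$i" for i j using sym by (metis transpose_def vec_lambda_beta)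
  have tr: "transpose X = X" "transpose Y = Y"
    by (simp_all add: X_def Y_def transpose_def vec_eq_iff s[symmetric])
  have comm: "X ** Y = Y ** X"
  proof -
    \<comment> \<open>For symmetric \<open>M\<close> the imaginary part of \<open>M ** adj M\<close>
      is the commutator of \<open>Y\<close> and \<open>X\<close>.\<close>
    have "Im ((M ** adj M)$i$j) = 0" for i j using uni by (simp add: unitary_def mat_def)
    then have "(\<Sum>k\<in>UNIV. Im (M$i$k) * Re (M$j$k)) - (\<Sum>k\<in>UNIV. Re (M$i$k) * Im (M$j$k)) = 0" for i j
      by (simp add: matrix_matrix_mult_def adj_def sum_subtractf[symmetric] algebra_simps)
    then show ?thesis
      by (simp add: X_def Y_def matrix_matrix_mult_def vec_eq_iff s[of _ j for j])
  qed
  have sa: "(X *v x) \<bullet> y = x \<bullet> (X *v y)" "(Y *v x) \<bullet> y = x \<bullet> (Y *v y)" for x y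
    by (metis dot_lmul_matrix tr transpose_matrix_vector)+
  have "\<exists>B. B \<subseteq> UNIV \<and> pairwise orthogonal B \<and> span B = UNIV \<and>
    (\<forall>b\<in>B. norm b = 1 \<and> (\<exists>c d. X *v b = c *\<^sub>R b \<and> Y *v b = d *\<^sub>R b))"
    by (rule simultaneous_eigenbasis) (auto simp: sa matrix_vector_mul_assoc comm)
  then obtain B where B: "pairwise orthogonal B" "span B = UNIV"
    "\<And>b. b \<in> B \<Longrightarrow> norm b = 1" "\<And>b. b \<in> B \<Longrightarrow> \<exists>c d. X *v b = c *\<^sub>R b \<and> Y *v b = d *\<^sub>R b" by blast
  have "0 \<notin> B" using B(3) by fastforce
  then have ind: "independent B" using pairwise_orthogonal_independent[OF B(1)] by blast
  have "card B = CARD('n)" using basis_card_eq_dim[of B UNIV] B(2) ind by (simp add: dim_UNIV)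
  moreover have "finite B" using ind by (rule independent_imp_finite)
  ultimately obtain h where h: "bij_betw h (UNIV::'n set) B"
    using finite_same_card_bij[of "UNIV::'n set" B] by auto
  then have hB: "h k \<in> B" for k by (auto simp: bij_betw_def)
  have "\<forall>k. \<exists>c d. X *v h k = c *\<^sub>R h k \<and> Y *v h k = d *\<^sub>R h k" using B(4) hB by blast
  then obtain c d where cd: "\<And>k. X *v h k = c k *\<^sub>R h k" "\<And>k. Y *v h k = d k *\<^sub>R h k" by metis
  have on: "h k \<bullet> h l = (if k = l then 1 else 0)" for k l
  proof (cases "k = l")
    case False
    then have "h k \<noteq> h l" using h by (auto simp: bij_betw_def inj_eq)
    then show ?thesis using False B(1) hB[of k] hB[of l] by (auto simp: pairwise_def orthogonal_def)
  qed (use B(3)[OF hB] in \<open>simp add: norm_eq_1\<close>)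
  define P :: "complex^'n^'n" where "P = (\<chi> i k. complex_of_real (h k $ i))"
  define \<mu> where "\<mu> k = Complex (c k) (d k)" for k
  have "adj P ** P = mat 1"
    using on by (simp add: vec_eq_iff adj_def P_def matrix_matrix_mult_def mat_def inner_vec_def
        flip: of_real_mult of_real_sum)
  moreover from this have "P ** adj P = mat 1" by (simp add: matrix_left_right_inverse)
  ultimately have "unitary P" by (simp add: unitary_def)
  moreover have "transpose P = adj P" by (simp add: P_def transpose_def adj_def vec_eq_iff)
  moreover have "M ** P = P ** (\<chi> i j. if i = j then \<mu> i else 0)"
  proof -
    have "(M ** P)$i$k = \<mu> k * complex_of_real (h k $ i)" for i k
    proof (rule complex_eqI)
      have "(X *v h k) $ i = c k * h k $ i" "(Y *v h k) $ i = d k * h k $ i" by (simp_all add: cd)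
      then show "Re ((M ** P)$i$k) = Re (\<mu> k * complex_of_real (h k $ i))"
        "Im ((M ** P)$i$k) = Im (\<mu> k * complex_of_real (h k $ i))"
        by (simp_all add: P_def \<mu>_def X_def Y_def matrix_matrix_mult_def matrix_vector_mult_def)
    qed
    then show ?thesis
      by (simp add: vec_eq_iff matrix_matrix_mult_def[of P] if_distrib[of "\<lambda>x. _ * x"] cong: if_cong)
         (simp add: P_def)
  qed
  ultimately show ?thesis using that by blast
qed

subsection \<open>Canonical form of two-qubit unitaries\<close>

lemma cnj_mult_self_1_iff: "cnj c * c = 1 \<longleftrightarrow> cmod c = 1"
proof -
  have "cnj c * c = complex_of_real ((cmod c)\<^sup>2)" by (metis complex_norm_square mult.commute)
  then show ?thesis by (smt (verit) norm_ge_zero of_real_1 of_real_eq_iff one_power2 power2_eq_iff_nonneg)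
qed

definition dg :: "('n \<Rightarrow> complex) \<Rightarrow> complex^'n^'n" where
  "dg \<mu> = (\<chi> i j. if i = j then \<mu> i else 0)"

lemma dg_mult: "dg \<mu> ** dg \<nu> = dg (\<lambda>i. \<mu> i * \<nu> i)"
  by (simp add: dg_def matrix_matrix_mult_def vec_eq_iff if_distrib[of "\<lambda>x. x * _"] cong: if_cong)

lemma dg_one: "dg (\<lambda>i. 1) = mat 1"
  by (simp add: dg_def mat_def)

lemma adj_dg: "adj (dg \<mu>) = dg (\<lambda>i. cnj (\<mu> i))"
  by (simp add: dg_def adj_def vec_eq_iff)

lemma transpose_dg: "transpose (dg \<mu>) = dg \<mu>"
  by (simp add: dg_def transpose_def vec_eq_iff)

lemma dg_vector: "dg \<mu> *v z = (\<chi> i. \<mu> i * z$i)"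
  by (simp add: dg_def matrix_vector_mult_def vec_eq_iff if_distrib[of "\<lambda>x. x * _"] cong: if_cong)

lemma unitary_dg: "(\<And>i. cmod (\<mu> i) = 1) \<Longrightarrow> unitary (dg \<mu>)"
proof -
  assume "\<And>i. cmod (\<mu> i) = 1"
  then have "cnj (\<mu> i) * \<mu> i = 1" "\<mu> i * cnj (\<mu> i) = 1" for i
    by (simp_all add: complex_norm_square[symmetric] mult.commute)
  then show ?thesis by (simp add: unitary_def adj_dg dg_mult dg_one)
qed

text \<open>Columns \<open>(1,1)\<close>, \<open>(2,2)\<close>, \<open>(1,2)\<close>, \<open>(2,1)\<close> are the Bell vectors with phases chosen such that
  twice the determinant of a two-qubit vector is the sum of squares of its coordinates.\<close>

definition magic :: top where
  "magic = (\<chi> i k. complex_of_real (1 / sqrt 2) *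
     (if k = (1,1) then (if i = (1,1) \<or> i = (2,2) then 1 else 0)
      else if k = (2,2) then (if i = (1,1) then \<i> else if i = (2,2) then - \<i> else 0)
      else if k = (1,2) then (if i = (1,2) \<or> i = (2,1) then \<i> else 0)
      else (if i = (1,2) then 1 else if i = (2,1) then - 1 else 0)))"

text \<open>Gram matrix of the symmetric bilinear form whose value at \<open>(v, v)\<close> is twice
  the determinant of the coordinates of \<open>v\<close>.\<close>

definition detform :: top where
  "detform = (\<chi> i j. if (i = (1,1) \<and> j = (2,2)) \<or> (i = (2,2) \<and> j = (1,1)) then 1
     else if (i = (1,2) \<and> j = (2,1)) \<or> (i = (2,1) \<and> j = (1,2)) then - 1 else 0)"

definition swap :: top where
  "swap = (\<chi> i j. if fst i = snd j \<and> snd i = fst j then 1 else 0)"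

lemma half_sqrt: "complex_of_real (sqrt 2) * complex_of_real (sqrt 2) = 2"
  by (simp flip: of_real_mult)

lemma unitary_magic: "unitary magic"
  by (simp add: unitary_def magic_def adj_def matrix_matrix_mult_def mat_def vec_eq_iff forall_2 sum_pair2 half_sqrt)

lemma magic_detform: "transpose magic ** detform ** magic = mat 1"
  by (simp add: magic_def detform_def transpose_def matrix_matrix_mult_def mat_def vec_eq_iff forall_2 sum_pair2 half_sqrt)

lemma magic_detform': "transpose (adj magic) ** adj magic = detform"
  by (simp add: magic_def detform_def transpose_def adj_def matrix_matrix_mult_def mat_def vec_eq_iff forall_2 sum_pair2 half_sqrt)

text \<open>Column \<open>(2,1)\<close> is the antisymmetric Bell vector and the other three are
  symmetric, so swapping the qubits is a single sign change in magic coordinates.\<close>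

lemma swap_magic: "swap = magic ** dg (\<lambda>k. if k = (2,1) then - 1 else 1) ** adj magic"
  by (simp add: swap_def dg_def magic_def adj_def matrix_matrix_mult_def mat_def vec_eq_iff forall_2 sum_pair2 half_sqrt)

lemma swap_kron: "swap ** kron A B = kron B A ** swap"
  by (simp add: swap_def kron_def matrix_matrix_mult_def vec_eq_iff forall_2 sum_pair2)

lemma swap_swap: "swap ** swap = mat 1"
  by (simp add: swap_def mat_def matrix_matrix_mult_def vec_eq_iff forall_2 sum_pair2)

lemma kron_detform:
  "transpose (kron A B) ** detform ** kron A B = (\<chi> i j. det A * det B * detform$i$j)"
  by (simp add: detform_def kron_def transpose_def matrix_matrix_mult_def vec_eq_iff forall_2 sum_pair2 det_2 algebra_simps)

text \<open>Preserving the determinant means mapping products to products. The first column of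
  \<open>W\<close> is thus a product, and a local unitary takes it back to the first basis vector.
  Unitarity and the form then reduce the remainder \<open>V\<close> to two entries, placed either
  diagonally or crosswise.\<close>

lemma local_or_swap:
  assumes U: "unitary W" and E: "transpose W ** detform ** W = detform"
  obtains A B where "unitary A" "unitary B" "W = kron A B \<or> W = kron A B ** swap"
proof -
  define w where "w = W *v axis (1,1) 1"
  have wi: "w$i = W$i$(1,1)" for i
    by (simp add: w_def matrix_vector_mult_def axis_def if_distrib[of "\<lambda>x. _ * x"] cong: if_cong)
  have "(transpose W ** detform ** W)$(1,1)$(1,1) = 0" unfolding E by (simp add: detform_def)
  then have "w$(1,1) * w$(2,2) = w$(1,2) * w$(2,1)"
    by (simp add: detform_def transpose_def matrix_matrix_mult_def sum_pair2 wi[symmetric])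
  then have "is_product w" by (simp add: is_product_iff_det)
  moreover have "norm w = 1"
    unfolding w_def unitary_norm[OF U] norm_1_iff_cinner by (simp add: cinner_def axis_def sum_pair2)
  ultimately obtain x y where x: "norm x = 1" and y: "norm y = 1" and wxy: "w = tensor x y"
    by (rule normalize_product)
  \<comment> \<open>Completes a unit vector to a unitary of determinant one; the determinant
    matters, as it makes \<open>kron (A x) (A y)\<close> preserve \<open>detform\<close> without a
    factor.\<close>
  define A :: "qvec \<Rightarrow> qop" where "A x = (\<chi> i j. if j = 1 then x$i else if i = 1 then - cnj (x$2) else cnj (x$1))" for x :: qvec
  have cx: "cnj (x$1) * x$1 + cnj (x$2) * x$2 = 1" if "norm x = 1" for x :: qvec
    using that unfolding norm_1_iff_cinner by (simp add: cinner_def sum_2)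
  have detA: "det (A x) = 1" and uA: "unitary (A x)" if "norm x = 1" for x
  proof -
    show "det (A x) = 1" using cx[OF that] by (simp add: A_def det_2 algebra_simps)
    have "adj (A x) ** A x = mat 1" using cx[OF that]
      by (simp add: A_def adj_def matrix_matrix_mult_def mat_def vec_eq_iff forall_2 sum_2 algebra_simps)
    then show "unitary (A x)" by (simp add: unitary_def matrix_left_right_inverse)
  qed
  have Ax: "A x *v axis 1 1 = x" for x
    by (simp add: A_def matrix_vector_mult_def axis_def vec_eq_iff sum_2)
  define L where "L = kron (A x) (A y)"
  define V where "V = adj L ** W"
  have uL: "unitary L" unfolding L_def by (intro unitary_kron uA x y)
  have W: "W = L ** V" by (simp add: V_def matrix_mul_assoc unitary_mult_adj[OF uL])
  have uV: "unitary V" unfolding V_def by (intro unitary_mult unitary_adj uL U)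
  have EL: "transpose L ** detform ** L = detform"
    by (simp add: L_def kron_detform detA x y vec_eq_iff)
  have "transpose W ** detform ** W = transpose V ** (transpose L ** detform ** L) ** V"
    by (simp add: W matrix_transpose_mul matrix_mul_assoc)
  then have EV: "transpose V ** detform ** V = detform" by (simp add: EL E)
  have "tensor (axis 1 1) (axis 1 1) = (axis (1,1) 1 :: tvec)"
    by (simp add: tensor_def axis_def vec_eq_iff)
  then have "L *v axis (1,1) 1 = w" by (metis L_def kron_tensor Ax wxy)
  then have "V *v axis (1,1) 1 = axis (1,1) 1"
    by (metis V_def w_def matrix_vector_mul_assoc unitary_mult_adj(3)[OF uL])
  moreover have "(V *v axis (1,1) 1)$i = V$i$(1,1)" for i
    by (simp add: matrix_vector_mult_def axis_def if_distrib[of "\<lambda>x. _ * x"] cong: if_cong)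
  ultimately have "V$i$(1,1) = (axis (1,1) 1 :: tvec)$i" for i by metis
  then have V1: "V$i$(1,1) = (if i = (1,1) then 1 else 0)" for i by (simp add: axis_def)
  have uc: "(\<Sum>i\<in>UNIV. cnj (V$i$j) * V$i$k) = (if j = k then 1 else 0)" for j k
  proof -
    have "(adj V ** V)$j$k = (if j = k then 1 else 0)" using uV by (simp add: unitary_def mat_def)
    then show ?thesis by (simp add: matrix_matrix_mult_def adj_def)
  qed
  have ec: "V$(1,1)$j * V$(2,2)$k + V$(2,2)$j * V$(1,1)$k - V$(1,2)$j * V$(2,1)$k - V$(2,1)$j * V$(1,2)$k
     = detform$j$k" for j k
  proof -
    have "(transpose V ** detform ** V)$j$k = detform$j$k" by (simp add: EV)
    moreover have "(transpose V ** detform ** V)$j$k =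
      V$(1,1)$j * V$(2,2)$k + V$(2,2)$j * V$(1,1)$k - V$(1,2)$j * V$(2,1)$k - V$(2,1)$j * V$(1,2)$k"
      by (simp add: matrix_matrix_mult_def transpose_def detform_def sum_pair2 algebra_simps)
    ultimately show ?thesis by simp
  qed
  have r1: "V$(1,1)$(1,2) = 0" "V$(1,1)$(2,1) = 0" "V$(1,1)$(2,2) = 0"
    using uc[of "(1,1)" "(1,2)"] uc[of "(1,1)" "(2,1)"] uc[of "(1,1)" "(2,2)"] by (simp_all add: sum_pair2 V1)
  have r2: "V$(2,2)$(1,2) = 0" "V$(2,2)$(2,1) = 0" "V$(2,2)$(2,2) = 1"
    using ec[of "(1,1)" "(1,2)"] ec[of "(1,1)" "(2,1)"] ec[of "(1,1)" "(2,2)"]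
    by (simp_all add: V1 r1) (simp_all add: detform_def)
  have "cnj (V$(1,2)$(2,2)) * V$(1,2)$(2,2) + cnj (V$(2,1)$(2,2)) * V$(2,1)$(2,2) = 0"
    using uc[of "(2,2)" "(2,2)"] by (simp add: sum_pair2 r1 r2)
  then have "complex_of_real ((cmod (V$(1,2)$(2,2)))\<^sup>2 + (cmod (V$(2,1)$(2,2)))\<^sup>2) = 0"
    by (simp only: of_real_add complex_norm_square mult.commute)
  then have "(cmod (V$(1,2)$(2,2)))\<^sup>2 + (cmod (V$(2,1)$(2,2)))\<^sup>2 = 0" by (simp only: of_real_eq_0_iff)
  then have c4: "V$(1,2)$(2,2) = 0" "V$(2,1)$(2,2) = 0" by (simp_all add: sum_power2_eq_zero_iff)
  define p q t s where "p = V$(1,2)$(1,2)" and "q = V$(2,1)$(1,2)" and "t = V$(1,2)$(2,1)" and "s = V$(2,1)$(2,1)"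
  \<comment> \<open>Column \<open>(1,2)\<close> of \<open>V\<close> is isotropic for the form as
    well; its outer entries vanish, so the product of the two middle ones does. This is the choice
    between local and swapped.\<close>
  have pq: "p = 0 \<or> q = 0" using ec[of "(1,2)" "(1,2)"]
    by (simp add: r1 r2 detform_def p_def q_def)
  have ps: "p * s + q * t = 1" using ec[of "(1,2)" "(2,1)"]
    by (simp add: r1 r2 p_def q_def s_def t_def) (simp add: detform_def algebra_simps minus_equation_iff)
  have st: "cnj p * t + cnj q * s = 0" using uc[of "(1,2)" "(2,1)"]
    by (simp add: r1 r2 sum_pair2 p_def q_def s_def t_def)
  have n1: "cnj p * p + cnj q * q = 1" using uc[of "(1,2)" "(1,2)"]
    by (simp add: r1 r2 sum_pair2 p_def q_def)
  define D :: "complex \<Rightarrow> qop" where "D c = dg (\<lambda>i::2. if i = 1 then 1 else c)" for c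
  have uD: "unitary (D c)" if "cnj c * c = 1" for c
    using that unfolding D_def cnj_mult_self_1_iff by (intro unitary_dg) simp
  have Vcomp: "V$(1,1)$(1,1) = 1" "V$(1,2)$(1,1) = 0" "V$(2,1)$(1,1) = 0" "V$(2,2)$(1,1) = 0" by (simp_all add: V1)
  show ?thesis
  proof (cases "q = 0")
    case True
    then have p1: "cnj p * p = 1" "p * s = 1" "p \<noteq> 0" using n1 ps by auto
    then have "s = cnj p" by (metis mult.commute mult_left_cancel)
    have "t = 0" using st True p1 by simp
    have "V = kron (D (cnj p)) (D p)"
      using r1 r2 c4 p1 \<open>s = cnj p\<close> \<open>t = 0\<close> \<open>q = 0\<close> Vcomp p_def q_def s_def t_def
      by (simp add: kron_def D_def dg_def vec_eq_iff forall_2)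
    then have "W = kron (A x ** D (cnj p)) (A y ** D p)"
      by (simp add: W L_def kron_mult)
    moreover have "unitary (A x ** D (cnj p))" "unitary (A y ** D p)"
      using uA x y uD p1 by (simp_all add: unitary_mult mult.commute)
    ultimately show ?thesis using that by blast
  next
    case False
    then have "p = 0" using pq by simp
    then have q1: "cnj q * q = 1" "q * t = 1" "q \<noteq> 0" using n1 ps by auto
    then have "t = cnj q" by (metis mult.commute mult_left_cancel)
    have "s = 0" using st \<open>p = 0\<close> q1 by simp
    have "V = kron (D q) (D (cnj q)) ** swap"
      using r1 r2 c4 q1 \<open>t = cnj q\<close> \<open>s = 0\<close> \<open>p = 0\<close> Vcomp p_def q_def s_def t_def
      by (simp add: kron_def D_def dg_def swap_def matrix_matrix_mult_def sum_pair2 vec_eq_iff forall_2)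
    then have "W = kron (A x ** D q) (A y ** D (cnj q)) ** swap"
      by (simp add: W L_def kron_mult[symmetric] matrix_mul_assoc)
    moreover have "unitary (A x ** D q)" "unitary (A y ** D (cnj q))"
      using uA x y uD q1 by (simp_all add: unitary_mult mult.commute)
    ultimately show ?thesis using that by blast
  qed
qed

text \<open>Orthogonality with respect to \<open>transpose\<close> preserves the sum of squares,
  which \<open>magic\<close> translates into the determinant form. It is the classical
  correspondence of SO(4) with pairs from SU(2), the swap accounting for determinant minus
  one.\<close>

lemma magic_orthogonal_local:
  assumes "unitary Q" "transpose Q ** Q = mat 1"
  obtains A B where "unitary A" "unitary B"
    "magic ** Q ** adj magic = kron A B \<or> magic ** Q ** adj magic = kron A B ** swap"
proof (rule local_or_swap)
  show "unitary (magic ** Q ** adj magic)"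
    by (intro unitary_mult unitary_adj unitary_magic assms)
  have "transpose (magic ** Q ** adj magic) ** detform ** (magic ** Q ** adj magic)
     = transpose (adj magic) ** (transpose Q ** (transpose magic ** detform ** magic) ** Q) ** adj magic"
    by (simp add: matrix_transpose_mul matrix_mul_assoc)
  then show "transpose (magic ** Q ** adj magic) ** detform ** (magic ** Q ** adj magic) = detform"
    by (simp add: magic_detform magic_detform' assms)
qed (use that in blast)

text \<open>The unknown left factor is eliminated by passing from \<open>V\<close> to
  \<open>transpose V ** V\<close>, which is symmetric and unitary. With square roots \<kappa> of its
  eigenvalues, \<open>Q = V P\<close> divided by \<open>dg \<kappa>\<close> is orthogonal, so
  \<open>V\<close> is \<open>dg \<kappa>\<close> between two orthogonal matrices, each local up to a
  swap.\<close>

lemma canonical_decomposition: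
  assumes U: "unitary U"
  obtains A1 A2 C1 C2 \<kappa> where "unitary A1" "unitary A2" "unitary C1" "unitary C2"
    "\<And>k. cmod (\<kappa> k) = 1" "U = kron A1 A2 ** (magic ** dg \<kappa> ** adj magic) ** kron C1 C2"
proof -
  define V where "V = adj magic ** U ** magic"
  have uV: "unitary V" unfolding V_def by (intro unitary_mult unitary_adj unitary_magic U)
  have uT: "unitary (transpose V)"
  proof -
    have "transpose V ** adj (transpose V) = transpose (adj V ** V)"
      by (simp add: adj_def transpose_def matrix_matrix_mult_def vec_eq_iff mult.commute)
    then have "transpose V ** adj (transpose V) = mat 1" using uV by (simp add: unitary_def)
    then show ?thesis by (simp add: unitary_def matrix_left_right_inverse)
  qed
  have "transpose (transpose V ** V) = transpose V ** V" by (simp add: matrix_transpose_mul)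
  moreover have "unitary (transpose V ** V)" by (intro unitary_mult uT uV)
  ultimately obtain P \<mu> where uP: "unitary P" and rP: "transpose P = adj P"
    and MP: "transpose V ** V ** P = P ** dg \<mu>"
    unfolding dg_def by (rule symmetric_unitary_diagonalization)
  define \<kappa> where "\<kappa> k = csqrt (\<mu> k)" for k
  have "dg \<mu> = adj P ** (transpose V ** V) ** P"
    by (simp add: matrix_mul_assoc[symmetric] MP[simplified matrix_mul_assoc[symmetric]])
       (simp add: matrix_mul_assoc unitary_mult_adj uP)
  then have "unitary (dg \<mu>)" by (simp add: unitary_mult unitary_adj uP uT uV)
  then have "dg (\<lambda>k. cnj (\<mu> k) * \<mu> k) = mat 1" by (simp add: unitary_def adj_dg dg_mult)
  then have "cnj (\<mu> k) * \<mu> k = 1" for k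
  proof -
    have "dg (\<lambda>k. cnj (\<mu> k) * \<mu> k)$k$k = (mat 1 :: top)$k$k"
      using \<open>dg (\<lambda>k. cnj (\<mu> k) * \<mu> k) = mat 1\<close> by simp
    then show ?thesis by (simp add: dg_def mat_def)
  qed
  then have \<mu>1: "cmod (\<mu> k) = 1" for k by (simp add: cnj_mult_self_1_iff[symmetric])
  have \<kappa>1: "cmod (\<kappa> k) = 1" for k by (simp add: \<kappa>_def \<mu>1)
  have \<kappa>\<kappa>: "\<kappa> k * \<kappa> k = \<mu> k" for k by (metis \<kappa>_def power2_csqrt power2_eq_square)
  have cl: "cnj (\<kappa> k) * \<kappa> k = 1" "\<kappa> k * cnj (\<kappa> k) = 1" for k
    using \<kappa>1[of k] by (simp_all add: complex_norm_square[symmetric] mult.commute)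
  define Q where "Q = V ** P ** dg (\<lambda>k. cnj (\<kappa> k))"
  have uQ: "unitary Q" unfolding Q_def
    by (intro unitary_mult uV uP unitary_dg) (simp add: \<kappa>1)
  have "transpose Q ** Q = dg (\<lambda>k. cnj (\<kappa> k)) ** (adj P ** (transpose V ** V ** P)) ** dg (\<lambda>k. cnj (\<kappa> k))"
    by (simp add: Q_def matrix_transpose_mul transpose_dg rP matrix_mul_assoc)
  also have "adj P ** (transpose V ** V ** P) = dg \<mu>"
    unfolding MP by (simp add: matrix_mul_assoc unitary_mult_adj uP)
  also have "dg (\<lambda>k. cnj (\<kappa> k)) ** dg \<mu> ** dg (\<lambda>k. cnj (\<kappa> k)) = dg (\<lambda>k. (cnj (\<kappa> k) * \<kappa> k) * (\<kappa> k * cnj (\<kappa> k)))"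
    by (simp add: dg_mult \<kappa>\<kappa>[symmetric] mult.assoc)
  finally have oQ: "transpose Q ** Q = mat 1" by (simp add: cl dg_one)
  have oP: "transpose (adj P) ** adj P = mat 1"
    using uP rP by (metis transpose_transpose unitary_def)
  have VQ: "V = Q ** dg \<kappa> ** adj P"
  proof -
    have "Q ** dg \<kappa> ** adj P = V ** P ** (dg (\<lambda>k. cnj (\<kappa> k)) ** dg \<kappa>) ** adj P"
      by (simp add: Q_def matrix_mul_assoc)
    also have "dg (\<lambda>k. cnj (\<kappa> k)) ** dg \<kappa> = mat 1" by (simp add: dg_mult cl dg_one)
    also have "V ** P ** mat 1 ** adj P = V ** (P ** adj P)" by (simp add: matrix_mul_assoc)
    finally show ?thesis by (simp add: unitary_mult_adj uP)
  qed
  \<comment> \<open>\<open>F\<close> records a possible swap as a sign in magic coordinates. The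
    right-hand swap is first moved across its local factor, so that both stand next to
    \<open>dg \<kappa>\<close> and merge with it into \<open>dg \<nu>\<close>.\<close>
  define F where "F \<epsilon> = magic ** dg (\<lambda>k::2\<times>2. if \<epsilon> \<and> k = (2,1) then - 1 else 1) ** adj magic" for \<epsilon> :: bool
  have F: "F True = swap" "F False = mat 1"
    using swap_magic unitary_magic by (simp_all add: F_def dg_one unitary_def)
  obtain A1 A2 e where A: "unitary A1" "unitary A2" "magic ** Q ** adj magic = kron A1 A2 ** F e"
    using magic_orthogonal_local[OF uQ oQ] F matrix_mul_rid by metis
  obtain C1 C2 d where C: "unitary C1" "unitary C2" "magic ** adj P ** adj magic = F d ** kron C1 C2"
    using magic_orthogonal_local[OF unitary_adj[OF uP] oP] F swap_kron matrix_mul_lid by metis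
  define \<nu> where "\<nu> k = (if e \<and> k = (2,1) then - 1 else 1) * \<kappa> k * (if d \<and> k = (2,1) then - 1 else 1)" for k :: "2\<times>2"
  have mm: "X ** adj magic ** magic = X" for X :: top
    by (metis matrix_mul_assoc matrix_mul_rid unitary_magic unitary_def)
  have "U = magic ** V ** adj magic"
    unfolding V_def by (metis matrix_mul_assoc matrix_mul_lid matrix_mul_rid unitary_def unitary_magic)
  also have "\<dots> = (magic ** Q ** adj magic) ** (magic ** dg \<kappa> ** adj magic) ** (magic ** adj P ** adj magic)"
    by (simp add: VQ matrix_mul_assoc mm)
  also have "\<dots> = kron A1 A2 ** (F e ** (magic ** dg \<kappa> ** adj magic) ** F d) ** kron C1 C2"
    unfolding A C by (simp add: matrix_mul_assoc)
  also have "F e ** (magic ** dg \<kappa> ** adj magic) ** F d = magic ** dg \<nu> ** adj magic"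
    unfolding F_def by (simp add: matrix_mul_assoc mm)
      (simp add: matrix_mul_assoc[symmetric, of magic "dg _" "dg _"] dg_mult \<nu>_def[abs_def])
  finally have "U = kron A1 A2 ** (magic ** dg \<nu> ** adj magic) ** kron C1 C2" .
  moreover have "cmod (\<nu> k) = 1" for k by (simp add: \<nu>_def \<kappa>1 norm_mult)
  ultimately show ?thesis using that A C by blast
qed

subsection \<open>Schmidt coefficients of the canonical form\<close>

text \<open>Schmidt form with complex weights in any order, since this is how the Pauli expansion
  delivers it.\<close>

definition sv_decomp :: "complex^((2 \<times> 2) \<times> (2 \<times> 2)) \<Rightarrow> (nat \<Rightarrow> complex) \<Rightarrow> (nat \<Rightarrow> tvec) \<Rightarrow> (nat \<Rightarrow> tvec) \<Rightarrow> bool" where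
  "sv_decomp Psi u x y \<longleftrightarrow> orthonormal_fam x 4 \<and> orthonormal_fam y 4 \<and>
     Psi = (\<Sum>k<4. u k *s tensor (x k) (y k))"

lemma orthonormal_fam_total:
  fixes x :: "nat \<Rightarrow> tvec"
  assumes on: "orthonormal_fam x 4" and v: "\<And>k. k < 4 \<Longrightarrow> cinner (x k) v = 0"
  shows "v = 0"
proof -
  have "\<exists>h. bij_betw h (UNIV::(2\<times>2) set) {0..<4::nat}"
    using ex_bij_betw_finite_nat[of "UNIV::(2\<times>2) set"] by simp
  then obtain h where h: "bij_betw h (UNIV::(2\<times>2) set) {0..<4::nat}" by blast
  have h4: "h i < 4" for i using h by (auto simp: bij_betw_def)
  have inj: "h i = h j \<longleftrightarrow> i = j" for i j using h by (auto simp: bij_betw_def inj_eq)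
  define X :: top where "X = (\<chi> i j. cnj (x (h i) $ j))"
  have "(X ** adj X)$i$j = cinner (x (h i)) (x (h j))" for i j
    by (simp add: X_def adj_def matrix_matrix_mult_def cinner_def)
  then have "(X ** adj X)$i$j = (mat 1 :: top)$i$j" for i j
    using on h4 by (simp add: orthonormal_fam_def inj mat_def)
  then have "X ** adj X = mat 1" by (simp only: vec_eq_iff) blast
  then have *: "adj X ** X = mat 1" by (simp add: matrix_left_right_inverse)
  have "(X *v v)$i = cinner (x (h i)) v" for i
    by (simp add: X_def matrix_vector_mult_def cinner_def)
  then have "X *v v = 0" using v h4 by (simp add: vec_eq_iff)
  then have "adj X *v (X *v v) = 0" by simp
  then show ?thesis by (simp add: matrix_vector_mul_assoc *)
qed

text \<open>Read as a matrix, \<open>Psi\<close> gives the reduced operator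
  \<open>R ** adj R\<close>. It depends on \<open>Psi\<close> alone, so its eigenvectors allow two
  different decompositions to be compared.\<close>

lemma sv_decomp_eigen:
  assumes "sv_decomp Psi u x y" "k < 4"
  defines "R \<equiv> (\<chi> i j. Psi$(i,j))"
  shows "(R ** adj R) *v x k = complex_of_real ((cmod (u k))\<^sup>2) *s x k"
proof -
  have xy: "cinner (x i) (x j) = (if i = j then 1 else 0)" "cinner (y i) (y j) = (if i = j then 1 else 0)"
    if "i < 4" "j < 4" for i j
    using assms(1) that by (auto simp: sv_decomp_def orthonormal_fam_def)
  have R: "R$i$j = (\<Sum>l<4. u l * (x l$i * y l$j))" for i j
    using assms(1) by (simp add: R_def sv_decomp_def tensor_def)
  define w :: tvec where "w = (\<chi> j. cnj (y k$j))"
  have "(adj R *v x k)$j = (cnj (u k) *s w)$j" for j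
  proof -
    have "(adj R *v x k)$j = (\<Sum>i\<in>UNIV. \<Sum>l<4. cnj (u l) * cnj (y l$j) * (cnj (x l$i) * x k$i))"
      by (simp add: matrix_vector_mult_def adj_def R sum_distrib_right sum_distrib_left mult_ac)
    also have "\<dots> = (\<Sum>l<4. \<Sum>i\<in>UNIV. cnj (u l) * cnj (y l$j) * (cnj (x l$i) * x k$i))"
      by (rule sum.swap)
    also have "\<dots> = (\<Sum>l<4. cnj (u l) * cnj (y l$j) * cinner (x l) (x k))"
      by (simp add: sum_distrib_left cinner_def)
    also have "\<dots> = (\<Sum>l<4. if l = k then cnj (u k) * cnj (y k$j) else 0)"
      by (rule sum.cong) (use assms(2) xy in auto)
    also have "\<dots> = (cnj (u k) *s w)$j" using assms(2) by (simp add: w_def)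
    finally show ?thesis .
  qed
  then have 1: "adj R *v x k = cnj (u k) *s w" by (simp add: vec_eq_iff)
  have "(R *v w)$i = (u k *s x k)$i" for i
  proof -
    have "(R *v w)$i = (\<Sum>j\<in>UNIV. \<Sum>l<4. u l * x l$i * (cnj (y k$j) * y l$j))"
      by (simp add: matrix_vector_mult_def R w_def sum_distrib_right sum_distrib_left mult_ac)
    also have "\<dots> = (\<Sum>l<4. \<Sum>j\<in>UNIV. u l * x l$i * (cnj (y k$j) * y l$j))"
      by (rule sum.swap)
    also have "\<dots> = (\<Sum>l<4. u l * x l$i * cinner (y k) (y l))"
      by (simp add: sum_distrib_left cinner_def)
    also have "\<dots> = (\<Sum>l<4. if l = k then u k * x k$i else 0)"
      by (rule sum.cong) (use assms(2) xy in auto)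
    also have "\<dots> = (u k *s x k)$i" using assms(2) by simp
    finally show ?thesis .
  qed
  then have 2: "R *v w = u k *s x k" by (simp add: vec_eq_iff)
  have "(R ** adj R) *v x k = (cnj (u k) * u k) *s x k"
    by (simp add: matrix_vector_mul_assoc[symmetric] 1 2 matrix_vector_mult_cscale)
  also have "cnj (u k) * u k = complex_of_real ((cmod (u k))\<^sup>2)"
    by (metis complex_norm_square mult.commute)
  finally show ?thesis .
qed

lemma sv_decomp_overlap:
  assumes "sv_decomp Psi u x y" "sv_decomp Psi v x' y'" "k < 4" "j < 4" "cmod (u k) \<noteq> cmod (v j)"
  shows "cinner (x k) (x' j) = 0"
proof -
  define R where "R = (\<chi> i j. Psi$(i,j))"
  have "cinner ((R ** adj R) *v x k) (x' j) = cinner (x k) ((R ** adj R) *v x' j)"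
    by (simp add: cinner_mult_left adj_mult)
  then have "complex_of_real ((cmod (u k))\<^sup>2) * cinner (x k) (x' j) = complex_of_real ((cmod (v j))\<^sup>2) * cinner (x k) (x' j)"
    unfolding R_def sv_decomp_eigen[OF assms(1,3)] sv_decomp_eigen[OF assms(2,4)]
    by (simp add: cinner_scale_left cinner_scale_right)
  moreover have "(cmod (u k))\<^sup>2 \<noteq> (cmod (v j))\<^sup>2" using assms(5) by (simp add: power2_eq_iff_nonneg)
  ultimately show ?thesis by (simp flip: of_real_power)
qed

text \<open>The condition \<open>s 0 > s 1 = s 2 = s 3 > 0\<close> freed of order and
  phases.\<close>

definition one_plus_three :: "(nat \<Rightarrow> complex) \<Rightarrow> bool" where
  "one_plus_three u \<longleftrightarrow> (\<exists>j<4. \<exists>p q. p > q \<and> q > 0 \<and> cmod (u j) = p \<and> (\<forall>l<4. l \<noteq> j \<longrightarrow> cmod (u l) = q))"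

text \<open>Every vector of one decomposition overlaps some vector of the other, necessarily of the
  same modulus, so only \<open>p\<close> and \<open>q\<close> occur and \<open>p\<close> does occur.
  It occurs once because vectors of modulus \<open>p\<close> all lie on the line of
  \<open>x j\<close>, where no two can be orthogonal.\<close>

lemma one_plus_three_transfer:
  assumes d: "sv_decomp Psi u x y" "sv_decomp Psi v x' y'" and u: "one_plus_three u"
  shows "one_plus_three v"
proof -
  obtain j p q where j: "j < 4" and pq: "p > q" "q > 0" and uj: "cmod (u j) = p"
    and ul: "\<And>l. l < 4 \<Longrightarrow> l \<noteq> j \<Longrightarrow> cmod (u l) = q"
    using u unfolding one_plus_three_def by metis
  have on: "orthonormal_fam x 4" "orthonormal_fam x' 4" using d by (auto simp: sv_decomp_def)
  have n0: "x k \<noteq> 0" "x' k \<noteq> 0" if "k < 4" for k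
    using on that unfolding orthonormal_fam_def by (metis cinner_zero(1) zero_neq_one)+
  have vals: "cmod (v l) = p \<or> cmod (v l) = q" if l: "l < 4" for l
  proof -
    obtain k where "k < 4" "cinner (x k) (x' l) \<noteq> 0"
      using orthonormal_fam_total[OF on(1), of "x' l"] n0(2)[OF l] by blast
    then have "cmod (u k) = cmod (v l)" using sv_decomp_overlap[OF d _ l] by blast
    then show ?thesis using uj ul[OF \<open>k < 4\<close>] by (cases "k = j") auto
  qed
  obtain i where i: "i < 4" "cinner (x' i) (x j) \<noteq> 0"
    using orthonormal_fam_total[OF on(2), of "x j"] n0 j by blast
  then have vi: "cmod (v i) = p" using sv_decomp_overlap[OF d j i(1)] uj
    by (metis cinner_eq_0_commute)
  have "cmod (v l) = q" if l: "l < 4" "l \<noteq> i" for l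
  proof (rule ccontr)
    assume "cmod (v l) \<noteq> q"
    then have vl: "cmod (v l) = p" using vals l by blast
    have "x' m = cinner (x j) (x' m) *s x j" if m: "m < 4" "cmod (v m) = p" for m
    proof -
      have "cinner (x k) (x' m - cinner (x j) (x' m) *s x j) = 0" if k: "k < 4" for k
      proof (cases "k = j")
        case True
        then show ?thesis using on(1) j by (simp add: cinner_diff_right cinner_scale_right orthonormal_fam_def)
      next
        case False
        then have "cinner (x k) (x' m) = 0"
          using ul[OF k] m pq by (intro sv_decomp_overlap[OF d k m(1)]) auto
        then show ?thesis using on(1) j k False by (simp add: cinner_diff_right cinner_scale_right orthonormal_fam_def)
      qed
      then show ?thesis using orthonormal_fam_total[OF on(1)] by fastforce
    qed
    then obtain \<alpha> \<beta> where ab: "x' i = \<alpha> *s x j" "x' l = \<beta> *s x j" using i vi l vl by blast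
    have "cinner (x' i) (x' l) = 0" using on(2) i l by (auto simp: orthonormal_fam_def)
    moreover have "cinner (x j) (x j) = 1" using on(1) j by (simp add: orthonormal_fam_def)
    ultimately have "\<alpha> = 0 \<or> \<beta> = 0" unfolding ab by (auto simp: cinner_scale_left cinner_scale_right)
    then show False using ab n0(2)[OF i(1)] n0(2)[OF l(1)] by auto
  qed
  then show ?thesis using i vi pq unfolding one_plus_three_def by blast
qed

lemma schmidt_one_plus_three:
  assumes s: "schmidt_coeffs Psi s" and d: "sv_decomp Psi u x y"
  shows "(s 0 > s 1 \<and> s 1 = s 2 \<and> s 2 = s 3 \<and> s 3 > 0) \<longleftrightarrow> one_plus_three u"
proof -
  have mono: "s 1 \<le> s 0" "s 2 \<le> s 1" "s 3 \<le> s 2"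
    using s by (auto simp: schmidt_coeffs_def numeral_eq_Suc)
  have pos: "0 \<le> s k" if "k < 4" for k using s that by (auto simp: schmidt_coeffs_def)
  obtain x' y' where d': "sv_decomp Psi (\<lambda>k. complex_of_real (s k)) x' y'"
    using s unfolding schmidt_coeffs_def sv_decomp_def scaleR_eq_cscale by blast
  have lt4: "l < 4 \<longleftrightarrow> l = 0 \<or> l = 1 \<or> l = 2 \<or> l = 3" for l :: nat by auto
  have "one_plus_three (\<lambda>k. complex_of_real (s k)) \<longleftrightarrow> s 0 > s 1 \<and> s 1 = s 2 \<and> s 2 = s 3 \<and> s 3 > 0"
  proof
    assume "one_plus_three (\<lambda>k. complex_of_real (s k))"
    then obtain j p q where j: "j < 4" "p > q" "q > 0" "\<bar>s j\<bar> = p" "\<forall>l<4. l \<noteq> j \<longrightarrow> \<bar>s l\<bar> = q"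
      unfolding one_plus_three_def by auto
    then have sj: "s j = p" and sl: "\<And>l. l < 4 \<Longrightarrow> l \<noteq> j \<Longrightarrow> s l = q" using pos by auto
    \<comment> \<open>The distinguished value is the largest, so sortedness places it at index
      0.\<close>
    have "s j \<le> s 0" using mono j(1) unfolding lt4 by (elim disjE) simp_all
    then have "j = 0" using sj sl[of 0] j(2) by fastforce
    then show "s 0 > s 1 \<and> s 1 = s 2 \<and> s 2 = s 3 \<and> s 3 > 0"
      using sj sl[of 1] sl[of 2] sl[of 3] j(2,3) by simp
  next
    assume "s 0 > s 1 \<and> s 1 = s 2 \<and> s 2 = s 3 \<and> s 3 > 0"
    then show "one_plus_three (\<lambda>k. complex_of_real (s k))"
      unfolding one_plus_three_def by (intro exI[of _ 0] conjI exI[of _ "s 0"] exI[of _ "s 1"]) (auto simp: lt4)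
  qed
  then show ?thesis using one_plus_three_transfer[OF d d'] one_plus_three_transfer[OF d' d] by blast
qed

section \<open>Pauli expansion of the diagonal operator and Schmidt form of the Choi state\<close>

text \<open>Index 2 is \<i> times the Pauli matrix Y, which makes all four real;
  \<open>pauli_coeff\<close> absorbs the sign of its tensor square.\<close>

definition pauli :: "nat \<Rightarrow> qop" where
  "pauli j = (if j = 0 then mat 1 else if j = 1 then (\<chi> i k. if i = k then 0 else 1)
     else if j = 2 then (\<chi> i k. if i = k then 0 else if i = 1 then 1 else - 1)
     else (\<chi> i k. if i \<noteq> k then 0 else if i = 1 then 1 else - 1))"

text \<open>The signs are the eigenvalues of \<open>kron (pauli j) (pauli j)\<close> on the columns
  of \<open>magic\<close>.\<close>

definition pauli_coeff :: "(2 \<times> 2 \<Rightarrow> complex) \<Rightarrow> nat \<Rightarrow> complex" where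
  "pauli_coeff \<kappa> j = (if j = 0 then \<kappa> (1,1) + \<kappa> (2,2) + \<kappa> (1,2) + \<kappa> (2,1)
     else if j = 1 then \<kappa> (1,1) - \<kappa> (2,2) + \<kappa> (1,2) - \<kappa> (2,1)
     else if j = 2 then \<kappa> (1,1) - \<kappa> (2,2) - \<kappa> (1,2) + \<kappa> (2,1)
     else \<kappa> (1,1) + \<kappa> (2,2) - \<kappa> (1,2) - \<kappa> (2,1)) / 4"

lemma sum_lessThan_4: "(\<Sum>j<4. f j) = f 0 + f 1 + f 2 + f (3::nat)"
  by (simp add: numeral_eq_Suc add.assoc)

lemma magic_dg_pauli:
  "(magic ** dg \<kappa> ** adj magic)$i$k = (\<Sum>j<4. pauli_coeff \<kappa> j * kron (pauli j) (pauli j)$i$k)"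
proof -
  have "\<forall>i k. (magic ** dg \<kappa> ** adj magic)$i$k = (\<Sum>j<4. pauli_coeff \<kappa> j * kron (pauli j) (pauli j)$i$k)"
    by (simp add: sum_lessThan_4 pauli_def kron_def pauli_coeff_def dg_def magic_def adj_def mat_def
        matrix_matrix_mult_def forall_2 sum_pair2 half_sqrt field_simps)
  then show ?thesis by blast
qed

text \<open>The factor normalizes unitaries on a qubit to unit vectors; two such factors give the
  1/2 in the components of the Choi state.\<close>

definition vectorize :: "qop \<Rightarrow> tvec" where
  "vectorize M = (\<chi> p. M$(fst p)$(snd p) / complex_of_real (sqrt 2))"

lemma cinner_vectorize: "cinner (vectorize M) (vectorize N) = trace (adj M ** N) / 2"
  by (simp add: vectorize_def cinner_def trace_def adj_def matrix_matrix_mult_def sum_pair2 sum_2 half_sqrt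
      add_divide_distrib)

lemma trace_mult_commute: "trace (M ** N) = trace (N ** M)" for M N :: "complex^'n^'n"
  unfolding trace_def matrix_matrix_mult_def
  by simp (subst sum.swap, simp add: mult.commute)

lemma orthonormal_vectorize_pauli:
  assumes "unitary A" "unitary C"
  shows "orthonormal_fam (\<lambda>j. vectorize (A ** pauli j ** C)) 4"
  unfolding orthonormal_fam_def
proof (intro allI impI)
  fix i j :: nat assume ij: "i < 4" "j < 4"
  have "adj (A ** pauli i ** C) ** (A ** pauli j ** C) = adj C ** (adj (pauli i) ** (adj A ** A) ** pauli j ** C)"
    by (simp add: adj_mult matrix_mul_assoc)
  then have "trace (adj (A ** pauli i ** C) ** (A ** pauli j ** C)) = trace (adj C ** (adj (pauli i) ** pauli j ** C))"
    using assms by (simp add: unitary_mult_adj)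
  also have "\<dots> = trace (adj (pauli i) ** pauli j)"
    using assms by (subst trace_mult_commute) (simp add: matrix_mul_assoc[symmetric] unitary_mult_adj)
  finally have "cinner (vectorize (A ** pauli i ** C)) (vectorize (A ** pauli j ** C)) = trace (adj (pauli i) ** pauli j) / 2"
    by (simp add: cinner_vectorize)
  also have "\<dots> = (if i = j then 1 else 0)"
  proof -
    have "i \<in> {0,1,2,3}" "j \<in> {0,1,2,3}" using ij by auto
    then show ?thesis
      by (auto simp: trace_def adj_def pauli_def mat_def matrix_matrix_mult_def sum_2)
  qed
  finally show "cinner (vectorize (A ** pauli i ** C)) (vectorize (A ** pauli j ** C)) = (if i = j then 1 else 0)" .
qed

lemma choi_component: "choi U $ ((a, a'), (b, b')) = U$(a,b)$(a',b') / 2"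
proof -
  have "choi U $ ((a, a'), (b, b')) = (\<Sum>c\<in>UNIV. \<Sum>d\<in>UNIV. U$(a,b)$(c,d) *
     (if c = a' then complex_of_real (1 / sqrt 2) else 0) * (if d = b' then complex_of_real (1 / sqrt 2) else 0))"
    by (simp add: choi_def Phi_def)
  also have "\<dots> = U$(a,b)$(a',b') / 2"
    using exhaust_2[of a'] exhaust_2[of b'] by (auto simp: sum_2 half_sqrt mult.assoc)
  finally show ?thesis .
qed

text \<open>The Choi state turns an operator expansion into a state expansion with factors regrouped
  by party. Unitaries around the Pauli matrices keep each family orthonormal, so the weights are
  untouched by the local parts of \<open>U\<close>.\<close>

lemma choi_sv_decomp:
  assumes un: "unitary A1" "unitary A2" "unitary C1" "unitary C2"
    and U: "U = kron A1 A2 ** (magic ** dg \<kappa> ** adj magic) ** kron C1 C2"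
  shows "sv_decomp (choi U) (pauli_coeff \<kappa>)
    (\<lambda>j. vectorize (A1 ** pauli j ** C1)) (\<lambda>j. vectorize (A2 ** pauli j ** C2))"
  unfolding sv_decomp_def
proof (intro conjI orthonormal_vectorize_pauli un)
  have sum_mult: "(A ** (\<chi> i k. \<Sum>j<4. c j * M j$i$k) ** B) = (\<chi> i k. \<Sum>j<(4::nat). c j * (A ** M j ** B)$i$k)"
    for A B :: top and c M
    by (simp add: sum_lessThan_4 matrix_matrix_mult_def vec_eq_iff sum_pair2 algebra_simps)
  have "U = kron A1 A2 ** (\<chi> i k. \<Sum>j<4. pauli_coeff \<kappa> j * kron (pauli j) (pauli j)$i$k) ** kron C1 C2"
    unfolding U magic_dg_pauli[symmetric] by simp
  then have "U = (\<chi> i k. \<Sum>j<4. pauli_coeff \<kappa> j * kron (A1 ** pauli j ** C1) (A2 ** pauli j ** C2)$i$k)"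
    by (simp add: sum_mult kron_mult)
  then have "choi U $ ((a, a'), (b, b')) =
     (\<Sum>j<4. pauli_coeff \<kappa> j * kron (A1 ** pauli j ** C1) (A2 ** pauli j ** C2)$(a,b)$(a',b')) / 2" for a a' b b'
    by (simp add: choi_component)
  then have "choi U $ ((a, a'), (b, b')) =
     (\<Sum>j<4. pauli_coeff \<kappa> j *s tensor (vectorize (A1 ** pauli j ** C1)) (vectorize (A2 ** pauli j ** C2))) $ ((a,a'),(b,b'))"
    for a a' b b'
    by (simp add: kron_def tensor_def vectorize_def sum_divide_distrib half_sqrt)
  then show "choi U = (\<Sum>j<4. pauli_coeff \<kappa> j *s tensor (vectorize (A1 ** pauli j ** C1)) (vectorize (A2 ** pauli j ** C2)))"
    by (simp only: vec_eq_iff) auto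
qed

text \<open>The spectrum of \<open>U\<^sup>T E U\<close> in the magic basis, with \<open>E\<close> the determinant form, consists of the
  squares \<open>(\<kappa> k)\<^sup>2\<close>.\<close>

definition odd_one_out :: "(2 \<times> 2 \<Rightarrow> complex) \<Rightarrow> bool" where
  "odd_one_out \<kappa> \<longleftrightarrow> (\<exists>k m. (\<forall>i. i \<noteq> k \<longrightarrow> (\<kappa> i)\<^sup>2 = m) \<and> (\<kappa> k)\<^sup>2 \<noteq> m)"

section \<open>Moduli of the Pauli coefficients and coincidences among the squared phases\<close>

text \<open>For unit numbers these are the cosines of the angles within the two pairs of a pairing.
  The three pairings of four numbers give all mixed terms of the squared modulus of their
  sum.\<close>

definition cross :: "complex \<Rightarrow> complex \<Rightarrow> complex \<Rightarrow> complex \<Rightarrow> real" where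
  "cross a b c d = Re (a * cnj b) + Re (c * cnj d)"

lemma unimodular_Re_Im: "cmod a = 1 \<Longrightarrow> (Re a)\<^sup>2 + (Im a)\<^sup>2 = 1"
  by (metis cmod_power2 one_power2)

lemma cmod_sum4:
  assumes "cmod a = 1" "cmod b = 1" "cmod c = 1" "cmod d = 1"
  shows "(cmod (a + b + c + d))\<^sup>2 = 4 + 2 * (cross a b c d + cross a c b d + cross a d b c)"
  using assms[THEN unimodular_Re_Im]
  unfolding cmod_power2 cross_def by (simp add: power2_eq_square algebra_simps)

text \<open>Each further coefficient negates two of the four phases; this keeps the pairing that has
  the two in one pair and reverses the other two pairings.\<close>

lemma cmod_pauli_coeff:
  assumes "\<And>k. cmod (\<kappa> k) = 1"
  defines "\<alpha> \<equiv> cross (\<kappa> (1,1)) (\<kappa> (2,2)) (\<kappa> (1,2)) (\<kappa> (2,1))"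
    and "\<beta> \<equiv> cross (\<kappa> (1,1)) (\<kappa> (1,2)) (\<kappa> (2,2)) (\<kappa> (2,1))"
    and "\<gamma> \<equiv> cross (\<kappa> (1,1)) (\<kappa> (2,1)) (\<kappa> (2,2)) (\<kappa> (1,2))"
  shows "(cmod (pauli_coeff \<kappa> 0))\<^sup>2 = (2 + \<alpha> + \<beta> + \<gamma>) / 8"
    "(cmod (pauli_coeff \<kappa> 1))\<^sup>2 = (2 - \<alpha> + \<beta> - \<gamma>) / 8"
    "(cmod (pauli_coeff \<kappa> 2))\<^sup>2 = (2 - \<alpha> - \<beta> + \<gamma>) / 8"
    "(cmod (pauli_coeff \<kappa> 3))\<^sup>2 = (2 + \<alpha> - \<beta> - \<gamma>) / 8"
proof -
  define a b c d where "a = \<kappa> (1,1)" and "b = \<kappa> (2,2)" and "c = \<kappa> (1,2)" and "d = \<kappa> (2,1)"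
  have n: "cmod a = 1" "cmod b = 1" "cmod c = 1" "cmod d = 1" by (simp_all add: a_def b_def c_def d_def assms)
  have q: "(cmod (z / 4))\<^sup>2 = (cmod z)\<^sup>2 / 16" for z by (simp add: norm_divide power_divide)
  have g: "\<alpha> = cross a b c d" "\<beta> = cross a c b d" "\<gamma> = cross a d b c"
    by (simp_all add: \<alpha>_def \<beta>_def \<gamma>_def a_def b_def c_def d_def)
  have "pauli_coeff \<kappa> 0 = (a + b + c + d) / 4" by (simp add: pauli_coeff_def a_def b_def c_def d_def)
  then show "(cmod (pauli_coeff \<kappa> 0))\<^sup>2 = (2 + \<alpha> + \<beta> + \<gamma>) / 8"
    using cmod_sum4[of a b c d] n unfolding g cross_def by (simp only: q norm_minus_cancel) (simp add: field_simps)
  have "pauli_coeff \<kappa> 1 = (a + - b + c + - d) / 4" by (simp add: pauli_coeff_def a_def b_def c_def d_def)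
  then show "(cmod (pauli_coeff \<kappa> 1))\<^sup>2 = (2 - \<alpha> + \<beta> - \<gamma>) / 8"
    using cmod_sum4[of a "-b" c "-d"] n unfolding g cross_def by (simp only: q norm_minus_cancel) (simp add: field_simps)
  have "pauli_coeff \<kappa> 2 = (a + - b + - c + d) / 4" by (simp add: pauli_coeff_def a_def b_def c_def d_def)
  then show "(cmod (pauli_coeff \<kappa> 2))\<^sup>2 = (2 - \<alpha> - \<beta> + \<gamma>) / 8"
    using cmod_sum4[of a "-b" "-c" d] n unfolding g cross_def by (simp only: q norm_minus_cancel) (simp add: field_simps)
  have "pauli_coeff \<kappa> 3 = (a + b + - c + - d) / 4" by (simp add: pauli_coeff_def a_def b_def c_def d_def)
  then show "(cmod (pauli_coeff \<kappa> 3))\<^sup>2 = (2 + \<alpha> - \<beta> - \<gamma>) / 8"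
    using cmod_sum4[of a b "-c" "-d"] n unfolding g cross_def by (simp only: q norm_minus_cancel) (simp add: field_simps)
qed

text \<open>For unit \<open>x\<close>, \<open>y\<close> one has \<open>cnj (x - y) = - (x - y) / (x y)\<close>.\<close>

lemma orthogonal_chords:
  assumes n: "cmod x = 1" "cmod y = 1" "cmod z = 1" "cmod w = 1"
    and o: "Re ((x - y) * cnj (z - w)) = 0"
  shows "x = y \<or> z = w \<or> x * y + z * w = 0"
proof -
  have inv: "cnj u * u = 1" if "cmod u = 1" for u using that by (simp add: cnj_mult_self_1_iff)
  have "(x - y) * cnj (z - w) + cnj (x - y) * (z - w) = 0"
    using o by (simp add: complex_eq_iff algebra_simps)
  then have "x * y * z * w * ((x - y) * cnj (z - w) + cnj (x - y) * (z - w)) = 0" by simp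
  moreover have "x * y * z * w * ((x - y) * cnj (z - w) + cnj (x - y) * (z - w))
     = x * y * (x - y) * ((cnj z * z) * w - (cnj w * w) * z) + z * w * (z - w) * ((cnj x * x) * y - (cnj y * y) * x)"
    by (simp add: algebra_simps)
  ultimately have "x * y * (x - y) * (w - z) + z * w * (z - w) * (y - x) = 0"
    using n by (simp only: inv mult_1)
  then have "(x - y) * (z - w) * (x * y + z * w) = 0" by (simp add: algebra_simps)
  then show ?thesis by auto
qed

text \<open>The hypothesis says that \<open>x / z\<close> and \<open>w / y\<close> are opposite, so
  the two cosines cancel. It serves to exclude the third alternative of
  \<open>orthogonal_chords\<close>.\<close>

lemma cross_zero:
  assumes n: "cmod x = 1" "cmod y = 1" "cmod z = 1" "cmod w = 1" and s: "x * y + z * w = 0"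
  shows "cross x z y w = 0"
proof -
  have inv: "cnj u * u = 1" if "cmod u = 1" for u using that by (simp add: cnj_mult_self_1_iff)
  have "(x * y + z * w) * (cnj z * cnj y) = x * cnj z * (cnj y * y) + (cnj z * z) * (w * cnj y)"
    by (simp add: algebra_simps)
  then have "x * cnj z + w * cnj y = 0" using s inv n by simp
  then have "Re (x * cnj z) + Re (w * cnj y) = 0" by (metis plus_complex.sel(1) zero_complex.sel(1))
  moreover have "Re (y * cnj w) = Re (w * cnj y)" by simp
  ultimately show ?thesis unfolding cross_def by linarith
qed

text \<open>A difference of two pairing sums is the scalar product of two chords, so equal sums make
  chords orthogonal. As the common value is nonzero, each pairing contains an equal pair; three
  edges from different pairings form a star or a triangle, and either joins three of the
  numbers.\<close>

lemma three_equal_if_cross_equal: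
  assumes n: "cmod a = 1" "cmod b = 1" "cmod c = 1" "cmod d = 1"
    and e: "cross a b c d = cross a c b d" "cross a b c d = cross a d b c" "cross a b c d \<noteq> 0"
  shows "(b = c \<and> c = d) \<or> (a = c \<and> c = d) \<or> (a = b \<and> b = d) \<or> (a = b \<and> b = c)"
proof -
  have "Re ((a - d) * cnj (b - c)) = cross a b c d - cross a c b d" by (simp add: cross_def algebra_simps)
  then have 1: "a = d \<or> b = c \<or> a * d + b * c = 0" using e n by (intro orthogonal_chords) auto
  have "Re ((a - c) * cnj (b - d)) = cross a b c d - cross a d b c" by (simp add: cross_def algebra_simps)
  then have 2: "a = c \<or> b = d \<or> a * c + b * d = 0" using e n by (intro orthogonal_chords) auto
  have "Re ((a - b) * cnj (c - d)) = cross a c b d - cross a d b c" by (simp add: cross_def algebra_simps)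
  then have 3: "a = b \<or> c = d \<or> a * b + c * d = 0" using e n by (intro orthogonal_chords) auto
  have "a * d + b * c \<noteq> 0" using cross_zero[of a d b c] n e by (auto simp: cross_def mult.commute)
  moreover have "a * c + b * d \<noteq> 0" using cross_zero[of a c b d] n e by (auto simp: cross_def mult.commute)
  moreover have "a * b + c * d \<noteq> 0" using cross_zero[of a b c d] n e by (auto simp: cross_def mult.commute)
  ultimately show ?thesis using 1 2 3 by blast
qed

text \<open>If \<open>y\<close> is the triple value and \<open>x\<close> the fourth number, the
  common sum is \<open>Re (x * cnj y) + 1\<close>. It would be 2 for \<open>x = y\<close> and 0 for
  \<open>x = - y\<close>.\<close>

lemma one_odd_square:
  assumes n: "cmod a = 1" "cmod b = 1" "cmod c = 1" "cmod d = 1"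
    and t: "\<bar>cross a b c d\<bar> < 2" "cross a b c d = cross a c b d" "cross a b c d = cross a d b c" "cross a b c d > 0"
  shows "(b\<^sup>2 = c\<^sup>2 \<and> c\<^sup>2 = d\<^sup>2 \<and> a\<^sup>2 \<noteq> d\<^sup>2) \<or> (a\<^sup>2 = c\<^sup>2 \<and> c\<^sup>2 = d\<^sup>2 \<and> b\<^sup>2 \<noteq> d\<^sup>2)
     \<or> (a\<^sup>2 = b\<^sup>2 \<and> b\<^sup>2 = d\<^sup>2 \<and> c\<^sup>2 \<noteq> d\<^sup>2) \<or> (a\<^sup>2 = b\<^sup>2 \<and> b\<^sup>2 = c\<^sup>2 \<and> d\<^sup>2 \<noteq> c\<^sup>2)"
proof -
  have sq: "Re (x * cnj x) = 1" if "cmod x = 1" for x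
    using unimodular_Re_Im[OF that] by (simp add: power2_eq_square)
  have *: "x\<^sup>2 \<noteq> y\<^sup>2" if "cmod x = 1" "cmod y = 1" "\<bar>Re (x * cnj y) + 1\<bar> < 2" "Re (x * cnj y) + 1 > 0" for x y
  proof
    assume "x\<^sup>2 = y\<^sup>2"
    then have "x = y \<or> x = - y" by (simp add: power2_eq_iff)
    then show False using that sq[of y] by auto
  qed
  have "cross a b c d \<noteq> 0" using t(4) by simp
  then consider "b = c \<and> c = d" | "a = c \<and> c = d" | "a = b \<and> b = d" | "a = b \<and> b = c"
    using three_equal_if_cross_equal[OF n t(2,3)] by blast
  then show ?thesis
  proof cases
    case 1
    have "a\<^sup>2 \<noteq> d\<^sup>2" by (rule *) (use n t 1 sq[of d] in \<open>auto simp: cross_def\<close>)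
    then show ?thesis using 1 by simp
  next
    case 2
    have "b\<^sup>2 \<noteq> d\<^sup>2" by (rule *) (use n t 2 sq[of d] in \<open>auto simp: cross_def mult.commute\<close>)
    then show ?thesis using 2 by simp
  next
    case 3
    have "c\<^sup>2 \<noteq> d\<^sup>2" by (rule *) (use n t 3 sq[of d] in \<open>auto simp: cross_def mult.commute\<close>)
    then show ?thesis using 3 by simp
  next
    case 4
    have "d\<^sup>2 \<noteq> c\<^sup>2" by (rule *) (use n t 4 sq[of c] in \<open>auto simp: cross_def mult.commute\<close>)
    then show ?thesis using 4 by simp
  qed
qed

text \<open>Both \<open>c\<close> and \<open>d\<close> are \<open>b\<close> up to sign, so each sum
  is 1 + r or 1 - r up to sign, with \<open>r\<close> strictly between -1 and 1. The number of minus
  signs is always even, which is what singles out one Pauli coefficient.\<close>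

lemma cross_of_odd_square:
  assumes n: "cmod a = 1" "cmod b = 1" "cmod c = 1" "cmod d = 1"
    and e: "c\<^sup>2 = b\<^sup>2" "d\<^sup>2 = b\<^sup>2" "a\<^sup>2 \<noteq> b\<^sup>2"
  obtains t where "0 < t" "t < 2"
    "(cross a b c d, cross a c b d, cross a d b c) \<in> {(t,t,t), (t,-t,-t), (-t,t,-t), (-t,-t,t)}"
proof -
  define r where "r = Re (a * cnj b)"
  have sq: "Re (b * cnj b) = 1" using unimodular_Re_Im[OF n(2)] by (simp add: power2_eq_square)
  have "a \<noteq> b" "a \<noteq> - b" using e(3) by auto
  then have "0 < (cmod (a - b))\<^sup>2" "0 < (cmod (a + b))\<^sup>2" by (simp_all add: eq_neg_iff_add_eq_0)
  moreover have "(cmod (a - b))\<^sup>2 = 2 - 2 * r" "(cmod (a + b))\<^sup>2 = 2 + 2 * r"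
    using unimodular_Re_Im[OF n(1)] unimodular_Re_Im[OF n(2)]
    unfolding cmod_power2 r_def by (simp_all add: power2_eq_square algebra_simps)
  ultimately have r: "-1 < r" "r < 1" by auto
  have "c = b \<or> c = - b" "d = b \<or> d = - b" using e by (simp_all add: power2_eq_iff)
  then consider "c = b" "d = b" | "c = b" "d = - b" | "c = - b" "d = b" | "c = - b" "d = - b" by blast
  then show ?thesis
  proof cases
    case 1
    show ?thesis by (rule that[of "1 + r"]) (use r[unfolded r_def] 1 sq in \<open>auto simp: cross_def r_def mult.commute\<close>)
  next
    case 2
    show ?thesis by (rule that[of "1 - r"]) (use r[unfolded r_def] 2 sq in \<open>auto simp: cross_def r_def mult.commute\<close>)
  next
    case 3
    show ?thesis by (rule that[of "1 - r"]) (use r[unfolded r_def] 3 sq in \<open>auto simp: cross_def r_def mult.commute\<close>)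
  next
    case 4
    show ?thesis by (rule that[of "1 + r"]) (use r[unfolded r_def] 4 sq in \<open>auto simp: cross_def r_def mult.commute\<close>)
  qed
qed

text \<open>Negating two phases permutes the moduli of the Pauli coefficients and leaves the squares
  alone, which reduces every position of the large modulus to position 0. There \<open>P > Q\<close>
  makes the common sum positive and \<open>Q > 0\<close> keeps it below 2.\<close>

lemma one_plus_three_imp_odd:
  assumes n: "\<And>k. cmod (\<kappa> k) = 1" and u: "one_plus_three (pauli_coeff \<kappa>)"
  shows "odd_one_out \<kappa>"
proof -
  define a b c d where "a = \<kappa> (1,1)" and "b = \<kappa> (2,2)" and "c = \<kappa> (1,2)" and "d = \<kappa> (2,1)"
  have nn: "cmod a = 1" "cmod b = 1" "cmod c = 1" "cmod d = 1" by (simp_all add: a_def b_def c_def d_def n)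
  define \<alpha> \<beta> \<gamma> where "\<alpha> = cross a b c d" and "\<beta> = cross a c b d" and "\<gamma> = cross a d b c"
  note N = cmod_pauli_coeff[of \<kappa>, OF n, folded a_def b_def c_def d_def, folded \<alpha>_def \<beta>_def \<gamma>_def]
  obtain j p q where j: "j < 4" "p > q" "q > 0" "cmod (pauli_coeff \<kappa> j) = p"
    "\<forall>l<4. l \<noteq> j \<longrightarrow> cmod (pauli_coeff \<kappa> l) = q"
    using u unfolding one_plus_three_def by blast
  define P Q where "P = 8 * p\<^sup>2" and "Q = 8 * q\<^sup>2"
  have pq: "0 < Q" "Q < P" using j by (simp_all add: power_strict_mono P_def Q_def)
  have sq: "(cmod (pauli_coeff \<kappa> j))\<^sup>2 = p\<^sup>2" "\<forall>l<4. l \<noteq> j \<longrightarrow> (cmod (pauli_coeff \<kappa> l))\<^sup>2 = q\<^sup>2"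
    using j by auto
  have "j = 0 \<or> j = 1 \<or> j = 2 \<or> j = 3" using j(1) by auto
  then consider "j = 0" | "j = 1" | "j = 2" | "j = 3" by blast
  then have "(b\<^sup>2 = c\<^sup>2 \<and> c\<^sup>2 = d\<^sup>2 \<and> a\<^sup>2 \<noteq> d\<^sup>2) \<or> (a\<^sup>2 = c\<^sup>2 \<and> c\<^sup>2 = d\<^sup>2 \<and> b\<^sup>2 \<noteq> d\<^sup>2)
     \<or> (a\<^sup>2 = b\<^sup>2 \<and> b\<^sup>2 = d\<^sup>2 \<and> c\<^sup>2 \<noteq> d\<^sup>2) \<or> (a\<^sup>2 = b\<^sup>2 \<and> b\<^sup>2 = c\<^sup>2 \<and> d\<^sup>2 \<noteq> c\<^sup>2)"
  proof cases
    case 1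
    have "2 + \<alpha> + \<beta> + \<gamma> = P" "2 - \<alpha> + \<beta> - \<gamma> = Q" "2 - \<alpha> - \<beta> + \<gamma> = Q" "2 + \<alpha> - \<beta> - \<gamma> = Q"
      using sq 1 N by (auto simp: P_def Q_def)
    then have "\<alpha> = \<beta>" "\<alpha> = \<gamma>" "\<alpha> > 0" "\<alpha> < 2" using pq by linarith+
    then show ?thesis using one_odd_square[of a b c d] nn by (simp add: \<alpha>_def \<beta>_def \<gamma>_def)
  next
    case 2
    have "2 + \<alpha> + \<beta> + \<gamma> = Q" "2 - \<alpha> + \<beta> - \<gamma> = P" "2 - \<alpha> - \<beta> + \<gamma> = Q" "2 + \<alpha> - \<beta> - \<gamma> = Q"
      using sq 2 N by (auto simp: P_def Q_def)
    then have "\<beta> = - \<alpha>" "\<gamma> = \<alpha>" "\<alpha> < 0" "- \<alpha> < 2" using pq by linarith+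
    then show ?thesis using one_odd_square[of a "-b" c "-d"] nn by (simp add: \<alpha>_def \<beta>_def \<gamma>_def cross_def)
  next
    case 3
    have "2 + \<alpha> + \<beta> + \<gamma> = Q" "2 - \<alpha> + \<beta> - \<gamma> = Q" "2 - \<alpha> - \<beta> + \<gamma> = P" "2 + \<alpha> - \<beta> - \<gamma> = Q"
      using sq 3 N by (auto simp: P_def Q_def)
    then have "\<beta> = \<alpha>" "\<gamma> = - \<alpha>" "\<alpha> < 0" "- \<alpha> < 2" using pq by linarith+
    then show ?thesis using one_odd_square[of a "-b" "-c" d] nn by (simp add: \<alpha>_def \<beta>_def \<gamma>_def cross_def)
  next
    case 4
    have "2 + \<alpha> + \<beta> + \<gamma> = Q" "2 - \<alpha> + \<beta> - \<gamma> = Q" "2 - \<alpha> - \<beta> + \<gamma> = Q" "2 + \<alpha> - \<beta> - \<gamma> = P"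
      using sq 4 N by (auto simp: P_def Q_def)
    then have "\<beta> = - \<alpha>" "\<gamma> = - \<alpha>" "\<alpha> > 0" "\<alpha> < 2" using pq by linarith+
    then show ?thesis using one_odd_square[of a b "-c" "-d"] nn by (simp add: \<alpha>_def \<beta>_def \<gamma>_def cross_def)
  qed
  then show ?thesis
    unfolding odd_one_out_def
  proof (elim disjE)
    assume "b\<^sup>2 = c\<^sup>2 \<and> c\<^sup>2 = d\<^sup>2 \<and> a\<^sup>2 \<noteq> d\<^sup>2"
    then show "\<exists>k m. (\<forall>i. i \<noteq> k \<longrightarrow> (\<kappa> i)\<^sup>2 = m) \<and> (\<kappa> k)\<^sup>2 \<noteq> m"
      by (intro exI[of _ "(1,1)"] exI[of _ "d\<^sup>2"]) (simp add: a_def b_def c_def d_def forall_2)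
  next
    assume "a\<^sup>2 = c\<^sup>2 \<and> c\<^sup>2 = d\<^sup>2 \<and> b\<^sup>2 \<noteq> d\<^sup>2"
    then show "\<exists>k m. (\<forall>i. i \<noteq> k \<longrightarrow> (\<kappa> i)\<^sup>2 = m) \<and> (\<kappa> k)\<^sup>2 \<noteq> m"
      by (intro exI[of _ "(2,2)"] exI[of _ "d\<^sup>2"]) (simp add: a_def b_def c_def d_def forall_2)
  next
    assume "a\<^sup>2 = b\<^sup>2 \<and> b\<^sup>2 = d\<^sup>2 \<and> c\<^sup>2 \<noteq> d\<^sup>2"
    then show "\<exists>k m. (\<forall>i. i \<noteq> k \<longrightarrow> (\<kappa> i)\<^sup>2 = m) \<and> (\<kappa> k)\<^sup>2 \<noteq> m"
      by (intro exI[of _ "(1,2)"] exI[of _ "d\<^sup>2"]) (simp add: a_def b_def c_def d_def forall_2)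
  next
    assume "a\<^sup>2 = b\<^sup>2 \<and> b\<^sup>2 = c\<^sup>2 \<and> d\<^sup>2 \<noteq> c\<^sup>2"
    then show "\<exists>k m. (\<forall>i. i \<noteq> k \<longrightarrow> (\<kappa> i)\<^sup>2 = m) \<and> (\<kappa> k)\<^sup>2 \<noteq> m"
      by (intro exI[of _ "(2,1)"] exI[of _ "c\<^sup>2"]) (simp add: a_def b_def c_def d_def forall_2)
  qed
qed

text \<open>The sums depend only on pairings, so the odd phase can be moved to the first argument at
  the price of permuting them.\<close>

lemma odd_imp_one_plus_three:
  assumes n: "\<And>k. cmod (\<kappa> k) = 1" and o: "odd_one_out \<kappa>"
  shows "one_plus_three (pauli_coeff \<kappa>)"
proof -
  define a b c d where "a = \<kappa> (1,1)" and "b = \<kappa> (2,2)" and "c = \<kappa> (1,2)" and "d = \<kappa> (2,1)"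
  have nn: "cmod a = 1" "cmod b = 1" "cmod c = 1" "cmod d = 1" by (simp_all add: a_def b_def c_def d_def n)
  define \<alpha> \<beta> \<gamma> where "\<alpha> = cross a b c d" and "\<beta> = cross a c b d" and "\<gamma> = cross a d b c"
  note N = cmod_pauli_coeff[of \<kappa>, OF n, folded a_def b_def c_def d_def, folded \<alpha>_def \<beta>_def \<gamma>_def]
  have cc: "Re (y * cnj x) = Re (x * cnj y)" for x y by simp
  have sym: "cross b a d c = \<alpha>" "cross b c a d = \<gamma>" "cross b d a c = \<beta>"
    "cross c a d b = \<beta>" "cross c b a d = \<gamma>" "cross c d a b = \<alpha>"
    "cross d a c b = \<gamma>" "cross d b a c = \<beta>" "cross d c a b = \<alpha>"
    using cc by (simp_all add: \<alpha>_def \<beta>_def \<gamma>_def cross_def)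
  obtain k m where km: "\<forall>i. i \<noteq> k \<longrightarrow> (\<kappa> i)\<^sup>2 = m" "(\<kappa> k)\<^sup>2 \<noteq> m" using o by (auto simp: odd_one_out_def)
  have "k \<in> {(1,1),(2,2),(1,2),(2,1)}" using exhaust_2[of "fst k"] exhaust_2[of "snd k"] by (cases k) auto
  then have "\<exists>t>0. t < 2 \<and> (\<alpha>, \<beta>, \<gamma>) \<in> {(t,t,t), (t,-t,-t), (-t,t,-t), (-t,-t,t)}"
  proof (elim insertE)
    assume "k = (1,1)"
    then have "c\<^sup>2 = b\<^sup>2" "d\<^sup>2 = b\<^sup>2" "a\<^sup>2 \<noteq> b\<^sup>2" using km by (simp_all add: a_def b_def c_def d_def)
    then obtain t where "0 < t" "t < 2" "(cross a b c d, cross a c b d, cross a d b c) \<in> {(t,t,t), (t,-t,-t), (-t,t,-t), (-t,-t,t)}"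
      using cross_of_odd_square[OF nn] by metis
    then show ?thesis by (auto simp: \<alpha>_def \<beta>_def \<gamma>_def)
  next
    assume "k = (2,2)"
    then have "d\<^sup>2 = a\<^sup>2" "c\<^sup>2 = a\<^sup>2" "b\<^sup>2 \<noteq> a\<^sup>2" using km by (simp_all add: a_def b_def c_def d_def)
    then obtain t where "0 < t" "t < 2" "(cross b a d c, cross b d a c, cross b c a d) \<in> {(t,t,t), (t,-t,-t), (-t,t,-t), (-t,-t,t)}"
      using cross_of_odd_square[OF nn(2,1,4,3)] by metis
    then show ?thesis unfolding sym by auto
  next
    assume "k = (1,2)"
    then have "d\<^sup>2 = a\<^sup>2" "b\<^sup>2 = a\<^sup>2" "c\<^sup>2 \<noteq> a\<^sup>2" using km by (simp_all add: a_def b_def c_def d_def)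
    then obtain t where "0 < t" "t < 2" "(cross c a d b, cross c d a b, cross c b a d) \<in> {(t,t,t), (t,-t,-t), (-t,t,-t), (-t,-t,t)}"
      using cross_of_odd_square[OF nn(3,1,4,2)] by metis
    then show ?thesis unfolding sym by auto
  next
    assume "k = (2,1)"
    then have "c\<^sup>2 = a\<^sup>2" "b\<^sup>2 = a\<^sup>2" "d\<^sup>2 \<noteq> a\<^sup>2" using km by (simp_all add: a_def b_def c_def d_def)
    then obtain t where "0 < t" "t < 2" "(cross d a c b, cross d c a b, cross d b a c) \<in> {(t,t,t), (t,-t,-t), (-t,t,-t), (-t,-t,t)}"
      using cross_of_odd_square[OF nn(4,1,3,2)] by metis
    then show ?thesis unfolding sym by auto
  qed auto
  then obtain t where t: "0 < t" "t < 2" and cases: "(\<alpha>, \<beta>, \<gamma>) \<in> {(t,t,t), (t,-t,-t), (-t,t,-t), (-t,-t,t)}" by blast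
  \<comment> \<open>With an even number of minus signs, one of the four combinations is 2 + 3t and
    the others are 2 - t.\<close>
  define p q where "p = sqrt ((2 + 3 * t) / 8)" and "q = sqrt ((2 - t) / 8)"
  have pq: "p > q" "q > 0" using t by (simp_all add: p_def q_def)
  have P: "cmod z = p" if "(cmod z)\<^sup>2 = (2 + 3 * t) / 8" for z
    unfolding p_def using that by (metis norm_ge_zero real_sqrt_unique)
  have Q: "cmod z = q" if "(cmod z)\<^sup>2 = (2 - t) / 8" for z
    unfolding q_def using that by (metis norm_ge_zero real_sqrt_unique)
  have lt4: "l < 4 \<longleftrightarrow> l = 0 \<or> l = 1 \<or> l = 2 \<or> l = 3" for l :: nat by auto
  have "\<exists>j<4. cmod (pauli_coeff \<kappa> j) = p \<and> (\<forall>l<4. l \<noteq> j \<longrightarrow> cmod (pauli_coeff \<kappa> l) = q)"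
    using cases
  proof (elim insertE)
    assume "(\<alpha>, \<beta>, \<gamma>) = (t, t, t)"
    then have "cmod (pauli_coeff \<kappa> 0) = p" "cmod (pauli_coeff \<kappa> 1) = q" "cmod (pauli_coeff \<kappa> 2) = q" "cmod (pauli_coeff \<kappa> 3) = q"
      using N by (auto intro!: P Q)
    then show ?thesis by (intro exI[of _ 0]) (auto simp: lt4)
  next
    assume "(\<alpha>, \<beta>, \<gamma>) = (t, - t, - t)"
    then have "cmod (pauli_coeff \<kappa> 3) = p" "cmod (pauli_coeff \<kappa> 1) = q" "cmod (pauli_coeff \<kappa> 2) = q" "cmod (pauli_coeff \<kappa> 0) = q"
      using N by (auto intro!: P Q)
    then show ?thesis by (intro exI[of _ 3]) (auto simp: lt4)
  next
    assume "(\<alpha>, \<beta>, \<gamma>) = (- t, t, - t)"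
    then have "cmod (pauli_coeff \<kappa> 1) = p" "cmod (pauli_coeff \<kappa> 3) = q" "cmod (pauli_coeff \<kappa> 2) = q" "cmod (pauli_coeff \<kappa> 0) = q"
      using N by (auto intro!: P Q)
    then show ?thesis by (intro exI[of _ 1]) (auto simp: lt4)
  next
    assume "(\<alpha>, \<beta>, \<gamma>) = (- t, - t, t)"
    then have "cmod (pauli_coeff \<kappa> 2) = p" "cmod (pauli_coeff \<kappa> 1) = q" "cmod (pauli_coeff \<kappa> 3) = q" "cmod (pauli_coeff \<kappa> 0) = q"
      using N by (auto intro!: P Q)
    then show ?thesis by (intro exI[of _ 2]) (auto simp: lt4)
  qed auto
  then show ?thesis using pq unfolding one_plus_three_def by blast
qed

subsection \<open>Protocols for the canonical form\<close>

lemma four_indices: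
  fixes k :: "2 \<times> 2"
  obtains k1 k2 k3 where "k1 \<noteq> k" "k2 \<noteq> k" "k3 \<noteq> k" "k1 \<noteq> k2" "k1 \<noteq> k3" "k2 \<noteq> k3"
    "UNIV = {k, k1, k2, k3}"
proof -
  have U: "(UNIV :: (2\<times>2) set) = {(1,1),(2,2),(1,2),(2,1)}"
    by (auto simp: UNIV_2[symmetric] intro!: set_eqI) (metis exhaust_2)+
  have "k \<in> {(1,1),(2,2),(1,2),(2,1)}" using U by blast
  then show ?thesis
  proof (elim insertE)
    assume "k = (1,1)"
    then show ?thesis using U by (intro that[of "(2,2)" "(1,2)" "(2,1)"]) auto
  next
    assume "k = (2,2)"
    then show ?thesis using U by (intro that[of "(1,1)" "(1,2)" "(2,1)"]) auto
  next
    assume "k = (1,2)"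
    then show ?thesis using U by (intro that[of "(1,1)" "(2,2)" "(2,1)"]) auto
  next
    assume "k = (2,1)"
    then show ?thesis using U by (intro that[of "(1,1)" "(2,2)" "(1,2)"]) auto
  qed simp
qed

text \<open>The hypothesis denies that \<open>k\<close> is the odd index, and yields a solution
  nonzero at \<open>k\<close> supported on two or three indices. Solutions for single coordinates
  combine into \<open>w + t v\<close>, which loses a coordinate for finitely many \<open>t\<close>
  only.\<close>

lemma nowhere_zero_solution:
  fixes \<mu> :: "'n::finite \<Rightarrow> complex"
  assumes "\<And>k. (\<exists>i j. i \<noteq> k \<and> j \<noteq> k \<and> \<mu> i \<noteq> \<mu> j) \<or> (\<exists>i. i \<noteq> k \<and> \<mu> i = \<mu> k)"
  obtains w where "\<And>k. w k \<noteq> 0" "(\<Sum>k\<in>UNIV. w k) = 0" "(\<Sum>k\<in>UNIV. \<mu> k * w k) = 0"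
proof -
  have single: "\<exists>v. v k \<noteq> 0 \<and> (\<Sum>k\<in>UNIV. v k) = 0 \<and> (\<Sum>k\<in>UNIV. \<mu> k * v k) = 0" for k
  proof -
    consider i j where "i \<noteq> k" "j \<noteq> k" "\<mu> i \<noteq> \<mu> j" | i where "i \<noteq> k" "\<mu> i = \<mu> k"
      using assms by blast
    then show ?thesis
    proof cases
      case 1
      \<comment> \<open>Cramer's rule for \<open>1 + x + y = 0\<close> and
        \<open>\<mu> k + \<mu> i * x + \<mu> j * y = 0\<close>.\<close>
      define x y where "x = (\<mu> j - \<mu> k) / (\<mu> i - \<mu> j)" and "y = (\<mu> k - \<mu> i) / (\<mu> i - \<mu> j)"
      define v where "v l = (if l = k then 1 else 0) + (if l = i then x else 0) + (if l = j then y else 0)" for l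
      have "(\<Sum>l\<in>UNIV. v l) = 1 + x + y" by (simp add: v_def sum.distrib)
      also have "\<dots> = 0" using 1(3) by (simp add: x_def y_def field_simps)
      finally have 2: "(\<Sum>l\<in>UNIV. v l) = 0" .
      have "(\<Sum>l\<in>UNIV. \<mu> l * v l) = \<mu> k + \<mu> i * x + \<mu> j * y"
        by (simp add: v_def sum.distrib distrib_left if_distrib[of "\<lambda>x. _ * x"] cong: if_cong)
      also have "\<dots> = 0" using 1(3) by (simp add: x_def y_def field_simps)
      finally show ?thesis using 1 2 by (intro exI[of _ v]) (simp add: v_def)
    next
      case 2
      define v :: "'n \<Rightarrow> complex" where "v l = (if l = k then 1 else 0) + (if l = i then - 1 else 0)" for l
      have "(\<Sum>l\<in>UNIV. v l) = 0" by (simp add: v_def sum.distrib)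
      moreover have "(\<Sum>l\<in>UNIV. \<mu> l * v l) = \<mu> k + \<mu> i * (- 1)"
        by (simp add: v_def sum.distrib distrib_left if_distrib[of "\<lambda>x. _ * x"] cong: if_cong)
      ultimately show ?thesis using 2 by (intro exI[of _ v]) (simp add: v_def)
    qed
  qed
  have "\<exists>w. (\<forall>k\<in>F. w k \<noteq> 0) \<and> (\<Sum>k\<in>UNIV. w k) = 0 \<and> (\<Sum>k\<in>UNIV. \<mu> k * w k) = 0" if "finite F" for F
    using that
  proof (induction F)
    case empty
    then show ?case by (intro exI[of _ "\<lambda>_. 0"]) simp
  next
    case (insert k F)
    then obtain w where w: "\<forall>k\<in>F. w k \<noteq> 0" "(\<Sum>k\<in>UNIV. w k) = 0" "(\<Sum>k\<in>UNIV. \<mu> k * w k) = 0" by blast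
    obtain v where v: "v k \<noteq> 0" "(\<Sum>k\<in>UNIV. v k) = 0" "(\<Sum>k\<in>UNIV. \<mu> k * v k) = 0" using single by blast
    have "finite (range (\<lambda>l. - w l / v l))" by simp
    then obtain t where t: "t \<notin> range (\<lambda>l. - w l / v l)"
      using ex_new_if_finite infinite_UNIV_char_0 by blast
    have "w l + t * v l \<noteq> 0" if "l \<in> insert k F" for l
    proof (cases "v l = 0")
      case True
      then show ?thesis using that w v by auto
    next
      case False
      have "t \<noteq> - w l / v l" using t by blast
      then show ?thesis using False by (simp add: field_simps add_eq_0_iff)
    qed
    moreover have "(\<Sum>k\<in>UNIV. w k + t * v k) = 0"
      using w v by (simp add: sum.distrib sum_distrib_left[symmetric])
    moreover have "(\<Sum>k\<in>UNIV. \<mu> k * (w k + t * v k)) = (\<Sum>k\<in>UNIV. \<mu> k * w k) + t * (\<Sum>k\<in>UNIV. \<mu> k * v k)"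
      by (simp add: sum.distrib sum_distrib_left algebra_simps)
    ultimately show ?case using w v by (intro exI[of _ "\<lambda>k. w k + t * v k"]) simp
  qed
  then show ?thesis using that finite_class.finite_UNIV by (metis UNIV_I)
qed

lemma protocol_from_states:
  fixes ps :: "(tvec \<times> setting list) list"
  assumes U: "unitary U" and ne: "ps \<noteq> []"
    and ps: "\<And>\<psi> S. (\<psi>, S) \<in> set ps \<Longrightarrow> is_product \<psi> \<and> norm \<psi> = 1 \<and> valid_strategy (U *v \<psi>) S \<and>
      accepts_only (strategy_op S) (U *v \<psi>)"
    and \<psi>0: "\<psi>0 \<in> fst ` set ps" and conn: "\<And>\<psi>. \<psi> \<in> fst ` set ps \<Longrightarrow> cinner \<psi>0 \<psi> \<noteq> 0"
    and span: "\<And>v. (\<And>\<psi>. \<psi> \<in> fst ` set ps \<Longrightarrow> cinner \<psi> v = 0) \<Longrightarrow> v = 0"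
  obtains prot where "verifies U prot" "ordinary prot"
    "num_settings prot = sum_list (map (\<lambda>p. length (snd p)) ps)" "input_state ` set prot = fst ` set ps"
proof -
  have ps': "is_product (fst p)" "norm (fst p) = 1" "valid_strategy (U *v fst p) (snd p)"
    "accepts_only (strategy_op (snd p)) (U *v fst p)" if "p \<in> set ps" for p
    using ps[of "fst p" "snd p"] that by simp_all
  have "\<exists>a b. norm a = 1 \<and> norm b = 1 \<and> fst p = tensor a b" if "p \<in> set ps" for p
    using ps'(1,2)[OF that] by (metis normalize_product)
  then obtain f g where fg: "\<And>p. p \<in> set ps \<Longrightarrow> norm (f p) = 1 \<and> norm (g p) = 1 \<and> fst p = tensor (f p) (g p)"
    by metis
  define E where "E p = (1 / real (length ps), f p, g p, snd p)" for p
  define prot where "prot = map E ps"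
  have inp: "input_state (E p) = fst p" if "p \<in> set ps" for p using fg[OF that] by (simp add: E_def)
  then have im: "input_state ` set prot = fst ` set ps"
    unfolding prot_def set_map image_image by (rule image_cong[OF refl])
  have U1: "norm (U *v fst p) = 1" if "p \<in> set ps" for p
    using ps'(2)[OF that] U by (simp add: unitary_norm)
  have vp: "valid_protocol U prot"
  proof -
    have "sum_list (map fst prot) = 1" using ne by (simp add: prot_def E_def o_def sum_list_triv)
    moreover have "case E p of (m, a, b, S) \<Rightarrow> m > 0 \<and> norm a = 1 \<and> norm b = 1 \<and> valid_strategy (U *v tensor a b) S"
      if "p \<in> set ps" for p
      using fg[OF that] ps'(3)[OF that] ne by (simp add: E_def)
    ultimately show ?thesis using ne by (auto simp: valid_protocol_def prot_def)
  qed
  have ao: "accepts_only (strategy_op S) (U *v tensor a b) \<and> norm (U *v tensor a b) = 1"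
    if mem: "(m, a, b, S) \<in> set prot" for m a b S
  proof -
    obtain p where p: "p \<in> set ps" "(m, a, b, S) = E p" using mem by (auto simp: prot_def)
    then have "tensor a b = fst p" "S = snd p" using fg[OF p(1)] by (auto simp: E_def)
    then show ?thesis using ps'(4)[OF p(1)] U1[OF p(1)] by simp
  qed
  have "\<psi>0 \<in> input_state ` set prot" using \<psi>0 im by simp
  then obtain e0 where e0: "e0 \<in> set prot" "input_state e0 = \<psi>0" by auto
  have mem: "input_state e \<in> fst ` set ps" if "e \<in> set prot" for e using im that by blast
  show ?thesis
  proof (rule that[OF _ _ _ im])
    show "verifies U prot"
    proof (rule verifies_if_connected[OF U vp _ e0(1)])
      show "cinner (input_state e0) (input_state e) \<noteq> 0" if "e \<in> set prot" for e
        using conn mem[OF that] e0(2) by simp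
      show "v = 0" if "\<And>e. e \<in> set prot \<Longrightarrow> cinner (input_state e) v = 0" for v
      proof (rule span)
        fix \<psi> assume "\<psi> \<in> fst ` set ps"
        then obtain e where "e \<in> set prot" "input_state e = \<psi>" using im by (metis imageE)
        then show "cinner \<psi> v = 0" using that by blast
      qed
    qed (use ao in blast)
    show "ordinary prot" using ao spectral_gap_pos unfolding ordinary_def by fastforce
    show "num_settings prot = sum_list (map (\<lambda>p. length (snd p)) ps)"
      by (simp add: num_settings_def prot_def E_def o_def)
  qed
qed

lemma cinner_axis: "cinner (axis k 1) z = z$k"
proof -
  have "cinner (axis k 1) z = (\<Sum>i\<in>UNIV. if i = k then z$k else 0)"
    unfolding cinner_def by (rule sum.cong) (auto simp: axis_def)
  then show ?thesis by simp
qed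

section \<open>Product conditions in magic coordinates, protocols and lower bounds\<close>

locale canonical_form =
  fixes U :: top and A1 A2 C1 C2 :: qop and \<kappa> :: "2 \<times> 2 \<Rightarrow> complex"
  assumes un: "unitary A1" "unitary A2" "unitary C1" "unitary C2"
    and \<kappa>1: "cmod (\<kappa> k) = 1"
    and Udef: "U = kron A1 A2 ** (magic ** dg \<kappa> ** adj magic) ** kron C1 C2"
begin

text \<open>Maps magic coordinates to inputs; its local part cancels the right local factor of
  \<open>U\<close>, so that \<open>U ** G\<close> is diagonal up to \<open>magic\<close> and a local
  unitary.\<close>

definition G :: top where "G = kron (adj C1) (adj C2) ** magic"

lemma unitary_G: "unitary G"
  unfolding G_def by (intro unitary_mult unitary_kron unitary_adj un unitary_magic)

lemma unitary_U: "unitary U"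
  unfolding Udef by (intro unitary_mult unitary_kron unitary_adj un unitary_magic unitary_dg \<kappa>1)

lemma magic_vector:
  fixes z :: tvec
  defines "h \<equiv> complex_of_real (1 / sqrt 2)"
  shows "(magic *v z)$(1,1) = h * (z$(1,1) + \<i> * z$(2,2))" "(magic *v z)$(2,2) = h * (z$(1,1) - \<i> * z$(2,2))"
    "(magic *v z)$(1,2) = h * (\<i> * z$(1,2) + z$(2,1))" "(magic *v z)$(2,1) = h * (\<i> * z$(1,2) - z$(2,1))"
  unfolding magic_def h_def[symmetric] matrix_vector_mult_def by (simp_all add: sum_pair2 algebra_simps)

lemma is_product_magic: "is_product (magic *v z) \<longleftrightarrow> (\<Sum>k\<in>UNIV. (z$k)\<^sup>2) = 0"
proof -
  define h where "h = complex_of_real (1 / sqrt 2)"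
  have h: "h \<noteq> 0" by (simp add: h_def)
  have "(magic *v z)$(1,1) * (magic *v z)$(2,2) - (magic *v z)$(1,2) * (magic *v z)$(2,1)
      = h * h * (\<Sum>k\<in>UNIV. (z$k)\<^sup>2)"
    unfolding magic_vector h_def[symmetric] by (simp add: sum_pair2 power2_eq_square algebra_simps)
  then show ?thesis unfolding is_product_iff_det using h by (metis eq_iff_diff_eq_0 mult_eq_0_iff)
qed

lemma is_product_G: "is_product (G *v z) \<longleftrightarrow> (\<Sum>k\<in>UNIV. (z$k)\<^sup>2) = 0"
  unfolding G_def using is_product_magic un
  by (simp add: matrix_vector_mul_assoc[symmetric] is_product_kron_iff unitary_adj)

lemma U_G: "U *v (G *v z) = kron A1 A2 *v (magic *v (dg \<kappa> *v z))"
proof -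
  have "U ** G = kron A1 A2 ** magic ** dg \<kappa> ** (adj magic ** (kron C1 C2 ** kron (adj C1) (adj C2)) ** magic)"
    by (simp add: Udef G_def matrix_mul_assoc)
  also have "\<dots> = kron A1 A2 ** magic ** dg \<kappa>"
    by (simp add: kron_mult unitary_mult_adj un unitary_magic)
  finally show ?thesis by (simp add: matrix_vector_mul_assoc matrix_mul_assoc)
qed

lemma is_product_U_G: "is_product (U *v (G *v z)) \<longleftrightarrow> (\<Sum>k\<in>UNIV. (\<kappa> k)\<^sup>2 * (z$k)\<^sup>2) = 0"
  unfolding U_G using is_product_magic un
  by (simp add: is_product_kron_iff dg_vector power_mult_distrib)

lemma product_setting:
  assumes "norm z = 1" "(\<Sum>k\<in>UNIV. (z$k)\<^sup>2) = 0" "(\<Sum>k\<in>UNIV. (\<kappa> k)\<^sup>2 * (z$k)\<^sup>2) = 0"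
  obtains S where "is_product (G *v z)" "is_product (U *v (G *v z))" "norm (G *v z) = 1"
    "valid_strategy (U *v (G *v z)) S" "length S = 1" "accepts_only (strategy_op S) (U *v (G *v z))"
proof -
  have n: "norm (G *v z) = 1" "norm (U *v (G *v z)) = 1"
    using assms(1) unitary_G unitary_U by (simp_all add: unitary_norm)
  have p: "is_product (G *v z)" "is_product (U *v (G *v z))"
    using assms by (simp_all add: is_product_G is_product_U_G)
  from product_strategy[OF p(2) n(2)] show ?thesis using that p n by metis
qed

definition flip :: "2 \<times> 2 \<Rightarrow> tvec \<Rightarrow> tvec" where
  "flip k z = (\<chi> i. if i = k then - (z$i) else z$i)"

lemma flip_sq: "(flip k z $ i)\<^sup>2 = (z$i)\<^sup>2"
  by (simp add: flip_def)

lemma cinner_flip_left: "cinner (flip k z) u = cinner z u - 2 * cnj (z$k) * u$k"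
proof -
  have "cinner (flip k z) u = (\<Sum>i\<in>UNIV. cnj (z$i) * u$i - (if i = k then 2 * cnj (z$k) * u$k else 0))"
    unfolding cinner_def by (rule sum.cong) (auto simp: flip_def)
  then show ?thesis by (simp add: sum_subtractf cinner_def)
qed

text \<open>Orthogonality to the original vector thus arises exactly when the flipped coordinate
  carries half of the squared norm.\<close>

lemma cinner_flip_self: "norm z = 1 \<Longrightarrow> cinner z (flip k z) = complex_of_real (1 - 2 * (cmod (z$k))\<^sup>2)"
  by (subst cinner_commute, subst cinner_flip_left)
     (simp add: cinner_self complex_norm_square mult.commute mult.left_commute flip: of_real_power)

lemma norm_flip: "norm (flip k z) = norm z"
proof -
  have "cmod (flip k z $ i) = cmod (z$i)" for i by (simp add: flip_def)
  then show ?thesis by (simp add: norm_vec_def)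
qed

lemma norm_sum_sq: "(norm (z::tvec))\<^sup>2 = (\<Sum>k\<in>UNIV. (cmod (z$k))\<^sup>2)"
  by (simp add: norm_vec_def L2_set_def sum_nonneg)

lemma four_settings:
  assumes "\<not> odd_one_out \<kappa>"
  obtains prot where "verifies U prot" "ordinary prot" "num_settings prot = 4" "entanglement_free U prot"
proof -
  have "(\<exists>i j. i \<noteq> k \<and> j \<noteq> k \<and> (\<kappa> i)\<^sup>2 \<noteq> (\<kappa> j)\<^sup>2) \<or> (\<exists>i. i \<noteq> k \<and> (\<kappa> i)\<^sup>2 = (\<kappa> k)\<^sup>2)" for k
  proof -
    obtain l where "l \<noteq> k" by (metis four_indices)
    show ?thesis
    proof (cases "\<forall>i. i \<noteq> k \<longrightarrow> (\<kappa> i)\<^sup>2 = (\<kappa> l)\<^sup>2")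
      case True
      then have "(\<kappa> k)\<^sup>2 = (\<kappa> l)\<^sup>2" using assms unfolding odd_one_out_def by blast
      then show ?thesis using \<open>l \<noteq> k\<close> by metis
    qed (use \<open>l \<noteq> k\<close> in blast)
  qed
  then obtain w where w: "\<And>k. w k \<noteq> 0" "(\<Sum>k\<in>UNIV. w k) = 0" "(\<Sum>k\<in>UNIV. (\<kappa> k)\<^sup>2 * w k) = 0"
    by (rule nowhere_zero_solution) blast
  define y :: tvec where "y = (\<chi> k. csqrt (w k))"
  have "y \<noteq> 0" using w(1) by (simp add: y_def vec_eq_iff)
  then obtain c where c: "norm (c *s y) = 1" by (rule exists_normalizing_factor)
  then have "c \<noteq> 0" by auto
  define z where "z = c *s y"
  have zk: "(z$k)\<^sup>2 = c\<^sup>2 * w k" for k by (simp add: z_def y_def power_mult_distrib)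
  have z1: "norm z = 1" using c by (simp add: z_def)
  have z0: "z$k \<noteq> 0" for k using zk[of k] w(1)[of k] \<open>c \<noteq> 0\<close> by auto
  have sq: "(\<Sum>k\<in>UNIV. (z$k)\<^sup>2) = 0" "(\<Sum>k\<in>UNIV. (\<kappa> k)\<^sup>2 * (z$k)\<^sup>2) = 0"
    using w(2,3) by (simp_all add: zk sum_distrib_left[symmetric] mult.left_commute[of _ "c\<^sup>2"])
  \<comment> \<open>Two coordinates of weight 1/2 would exhaust the norm, while all four are
    nonzero. So at most one sign change is forbidden, and only three are used.\<close>
  obtain k0 where k0: "\<And>k. k \<noteq> k0 \<Longrightarrow> (cmod (z$k))\<^sup>2 \<noteq> 1/2"
  proof (cases "\<exists>k0. (cmod (z$k0))\<^sup>2 = 1/2")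
    case True
    then obtain k0 where k0: "(cmod (z$k0))\<^sup>2 = 1/2" by blast
    have "(cmod (z$k))\<^sup>2 \<noteq> 1/2" if "k \<noteq> k0" for k
    proof
      assume k: "(cmod (z$k))\<^sup>2 = 1/2"
      have "card {k, k0} < CARD(2 \<times> 2)" using that by simp
      then obtain i where i: "i \<notin> {k, k0}" by (metis UNIV_eq_I less_irrefl)
      have "(\<Sum>l\<in>{k, k0, i}. (cmod (z$l))\<^sup>2) \<le> (\<Sum>l\<in>UNIV. (cmod (z$l))\<^sup>2)"
        by (rule sum_mono2) auto
      moreover have "(\<Sum>l\<in>{k, k0, i}. (cmod (z$l))\<^sup>2) = 1 + (cmod (z$i))\<^sup>2"
        using i that k k0 by auto
      moreover have "(cmod (z$i))\<^sup>2 > 0" using z0 by simp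
      ultimately show False using norm_sum_sq[of z] z1 by simp
    qed
    then show ?thesis using that by blast
  qed (use that in blast)
  obtain k1 k2 k3 where ks: "k1 \<noteq> k0" "k2 \<noteq> k0" "k3 \<noteq> k0" "k1 \<noteq> k2" "k1 \<noteq> k3" "k2 \<noteq> k3"
    and UN: "UNIV = {k0, k1, k2, k3}" by (rule four_indices)
  define X where "X = insert z (range (\<lambda>k. flip k z))"
  have zX [simp]: "z \<in> X" "flip k z \<in> X" for k by (auto simp: X_def)
  have set4: "\<exists>S. is_product (G *v x) \<and> is_product (U *v (G *v x)) \<and> norm (G *v x) = 1 \<and>
    valid_strategy (U *v (G *v x)) S \<and> length S = 1 \<and> accepts_only (strategy_op S) (U *v (G *v x))"
    if "x \<in> X" for x
  proof -
    have "norm x = 1" "(\<Sum>k\<in>UNIV. (x$k)\<^sup>2) = 0" "(\<Sum>k\<in>UNIV. (\<kappa> k)\<^sup>2 * (x$k)\<^sup>2) = 0"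
      using that z1 sq by (auto simp: X_def norm_flip flip_sq)
    then show ?thesis by (rule product_setting) blast
  qed
  obtain S where S: "is_product (G *v x) \<and> is_product (U *v (G *v x)) \<and> norm (G *v x) = 1 \<and>
    valid_strategy (U *v (G *v x)) (S x) \<and> length (S x) = 1 \<and> accepts_only (strategy_op (S x)) (U *v (G *v x))"
    if "x \<in> X" for x
    using set4 by metis
  define ps where "ps = map (\<lambda>x. (G *v x, S x)) [z, flip k1 z, flip k2 z, flip k3 z]"
  have im: "fst ` set ps = {G *v z, G *v flip k1 z, G *v flip k2 z, G *v flip k3 z}"
    by (auto simp: ps_def)
  obtain prot where prot: "verifies U prot" "ordinary prot"
    "num_settings prot = sum_list (map (\<lambda>p. length (snd p)) ps)" "input_state ` set prot = fst ` set ps"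
  proof (rule protocol_from_states[OF unitary_U, of ps "G *v z"])
    show "ps \<noteq> []" by (simp add: ps_def)
    show "is_product \<psi> \<and> norm \<psi> = 1 \<and> valid_strategy (U *v \<psi>) T \<and> accepts_only (strategy_op T) (U *v \<psi>)"
      if "(\<psi>, T) \<in> set ps" for \<psi> T
      using that S by (auto simp: ps_def)
    show "G *v z \<in> fst ` set ps" by (simp add: im)
    have fl: "cinner z (flip k z) \<noteq> 0" if "k \<noteq> k0" for k
      unfolding cinner_flip_self[OF z1] of_real_eq_0_iff using k0[OF that] by simp
    have "cinner z z \<noteq> 0" using z1 by auto
    then show "cinner (G *v z) \<psi> \<noteq> 0" if "\<psi> \<in> fst ` set ps" for \<psi>
      using that fl[OF ks(1)] fl[OF ks(2)] fl[OF ks(3)] unfolding im by (auto simp: unitary_cinner[OF unitary_G])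
    show "v = 0" if orth: "\<And>\<psi>. \<psi> \<in> fst ` set ps \<Longrightarrow> cinner \<psi> v = 0" for v
    proof -
      \<comment> \<open>The difference of \<open>z\<close> and \<open>flip k z\<close> is a multiple
        of a coordinate vector, so three flips annihilate three coordinates of \<open>u\<close>, and
        \<open>z\<close> itself the last.\<close>
      define u where "u = adj G *v v"
      have "cinner z u = 0" "cinner (flip k1 z) u = 0" "cinner (flip k2 z) u = 0" "cinner (flip k3 z) u = 0"
        using orth unfolding im u_def by (simp_all add: cinner_mult_left[symmetric])
      then have zu: "cinner z u = 0" and u: "u$k1 = 0" "u$k2 = 0" "u$k3 = 0"
        using z0 by (simp_all add: cinner_flip_left)
      have "u$k0 = 0" using zu u ks z0[of k0] unfolding cinner_def UN by simp
      then have "u$i = 0" for i using u UN by (metis UNIV_I empty_iff insert_iff)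
      then have "u = 0" by (simp add: vec_eq_iff)
      then show "v = 0" using unitary_mult_adj(4)[OF unitary_G, of v] by (simp add: u_def)
    qed
  qed
  have "num_settings prot = 4" using prot(3) S by (auto simp: ps_def)
  moreover have "entanglement_free U prot"
    unfolding entanglement_free_def
  proof
    fix e assume "e \<in> set prot"
    then have "input_state e \<in> fst ` set ps" using prot(4) by blast
    then show "is_product (input_state e) \<and> is_product (U *v input_state e)"
      unfolding im using S by auto
  qed
  ultimately show ?thesis using prot that by blast
qed

text \<open>There are at least four entries and no strategy is empty, so a total of four leaves a
  single test for every entry.\<close>

lemma four_le_settings:
  assumes "verifies U prot"
  shows "4 \<le> num_settings prot"
    "num_settings prot = 4 \<Longrightarrow> (m, a, b, S) \<in> set prot \<Longrightarrow> length S = 1"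
proof -
  have pos: "length (snd (snd (snd e))) \<ge> 1" if "e \<in> set prot" for e
    using assms that unfolding verifies_def valid_protocol_def valid_strategy_def
    by (cases e) (auto simp: Suc_le_eq)
  have ns: "num_settings prot = (\<Sum>e\<leftarrow>prot. length (snd (snd (snd e))))"
    unfolding num_settings_def by (intro arg_cong[where f=sum_list] map_cong refl) auto
  have len: "4 \<le> length prot" using verifies_length unitary_U assms by blast
  have "(\<Sum>e\<leftarrow>prot. 1) \<le> (\<Sum>e\<leftarrow>prot. length (snd (snd (snd e))))"
    using pos by (intro sum_list_mono) auto
  then have le: "length prot \<le> num_settings prot" by (simp add: ns sum_list_triv)
  then show "4 \<le> num_settings prot" using len by simp
  assume n4: "num_settings prot = 4" and mem: "(m, a, b, S) \<in> set prot"
  have "(\<Sum>e\<leftarrow>prot. real 1) = (\<Sum>e\<leftarrow>prot. real (length (snd (snd (snd e)))))"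
  proof -
    have "(\<Sum>e\<leftarrow>prot. real (length (snd (snd (snd e))))) = real (num_settings prot)"
      unfolding ns by (induction prot) auto
    then show ?thesis using n4 len le by (simp add: sum_list_triv)
  qed
  then have "real 1 = real (length (snd (snd (snd (m, a, b, S)))))"
    by (rule sum_list_eq_pointwise) (use pos mem in auto)
  then show "length S = 1" by simp
qed

lemma five_le_settings:
  assumes odd: "odd_one_out \<kappa>" and ver: "verifies U prot" and ord: "ordinary prot"
  shows "5 \<le> num_settings prot"
proof (rule ccontr)
  assume "\<not> 5 \<le> num_settings prot"
  then have n4: "num_settings prot = 4" using four_le_settings(1)[OF ver] by simp
  obtain k m where km: "\<And>i. i \<noteq> k \<Longrightarrow> (\<kappa> i)\<^sup>2 = m" "(\<kappa> k)\<^sup>2 \<noteq> m"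
    using odd unfolding odd_one_out_def by blast
  have "cinner (G *v axis k 1) (input_state e) = 0" if e: "e \<in> set prot" for e
  proof -
    obtain p a b S where E: "e = (p, a, b, S)" by (cases e) auto
    have vs: "valid_strategy (U *v tensor a b) S" "norm a = 1" "norm b = 1"
      using ver e E by (auto simp: verifies_def valid_protocol_def)
    have "length S = 1" using four_le_settings(2)[OF ver n4] e E by blast
    then obtain t where t: "S = [t]" by (cases S) auto
    obtain q Ps Qs acc where T: "t = (q, Ps, Qs, acc)" by (cases t) auto
    have q: "q = 1" "qubit_pm Ps" "qubit_pm Qs" "test_op (q, Ps, Qs, acc) *v (U *v tensor a b) = U *v tensor a b"
      using vs(1) by (auto simp: valid_strategy_def t T setting_prob_def)
    have "spectral_gap (strategy_op S) > 0" using ord e E by (auto simp: ordinary_def)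
    then have gap: "spectral_gap (test_op (q, Ps, Qs, acc)) > 0"
      using q(1) by (simp add: strategy_op_def t T setting_prob_def)
    have "norm (U *v tensor a b) = 1" using vs unitary_U by (simp add: unitary_norm norm_tensor)
    then have nz: "U *v tensor a b \<noteq> 0" by auto
    have out: "is_product (U *v tensor a b)"
      by (rule single_test_product[OF q(2,3,4) nz gap])
    define z where "z = adj G *v tensor a b"
    have Gz: "G *v z = tensor a b" by (simp add: z_def unitary_mult_adj[OF unitary_G])
    have "is_product (G *v z)" unfolding Gz by (auto simp: is_product_def)
    then have s0: "(\<Sum>k\<in>UNIV. (z$k)\<^sup>2) = 0" by (simp add: is_product_G)
    have "(\<Sum>k\<in>UNIV. (\<kappa> k)\<^sup>2 * (z$k)\<^sup>2) = 0" using out by (simp add: Gz[symmetric] is_product_U_G)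
    \<comment> \<open>Subtracting \<open>m\<close> times the input condition from the output
      condition isolates coordinate \<open>k\<close>.\<close>
    moreover have "(\<Sum>i\<in>UNIV. (\<kappa> i)\<^sup>2 * (z$i)\<^sup>2) =
      (\<Sum>i\<in>UNIV. m * (z$i)\<^sup>2 + (if i = k then ((\<kappa> k)\<^sup>2 - m) * (z$k)\<^sup>2 else 0))"
      by (rule sum.cong) (auto simp: km(1) algebra_simps)
    ultimately have "m * (\<Sum>i\<in>UNIV. (z$i)\<^sup>2) + ((\<kappa> k)\<^sup>2 - m) * (z$k)\<^sup>2 = 0"
      by (simp add: sum.distrib sum_distrib_left)
    then have "z$k = 0" using s0 km(2) by simp
    moreover have "cinner (G *v axis k 1) (G *v z) = z$k"
      unfolding unitary_cinner[OF unitary_G] by (rule cinner_axis)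
    ultimately show ?thesis by (simp add: E Gz)
  qed
  moreover have "G *v axis k 1 \<noteq> 0"
    using unitary_norm[OF unitary_G, of "axis k 1"] by (auto simp: axis_eq_0_iff)
  ultimately show False using not_verifies_if_orthogonal[OF unitary_U] ver by blast
qed

text \<open>Up to local unitaries the input is a basis vector of the standard product basis. It lies
  in the span of two Bell vectors, which the diagonal operator preserves and which is also spanned
  by two standard basis vectors differing on both qubits; the output is therefore in Schmidt form in
  a known basis.\<close>

lemma schmidt_form_input:
  obtains k' x B c1 c2 where "k' \<noteq> k" "norm x = 1" "(\<Sum>i\<in>UNIV. (x$i)\<^sup>2) = 0"
    "x$k \<noteq> 0" "x$k' \<noteq> 0" "\<And>i. i \<noteq> k \<Longrightarrow> i \<noteq> k' \<Longrightarrow> x$i = 0" "unitary B"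
    "U *v (G *v x) = c1 *s tensor (A1 *v axis 1 1) (B *v axis 1 1) + c2 *s tensor (A1 *v axis 2 1) (B *v axis 2 1)"
proof -
  define h where "h = complex_of_real (1 / sqrt 2)"
  have h: "h * h = 1 / 2" "h \<noteq> 0" "cnj h = h" "cmod h = 1 / sqrt 2"
    by (simp_all add: h_def norm_divide flip: of_real_mult)
  \<comment> \<open>Flipping B turns the pair \<open>(1,2)\<close>, \<open>(2,1)\<close> into the
    matching pattern required of the Schmidt form.\<close>
  define X :: qop where "X = pauli 1"
  have uX: "unitary X"
    by (simp add: unitary_def X_def pauli_def adj_def matrix_matrix_mult_def mat_def vec_eq_iff forall_2 sum_2)
  have ax: "X *v axis 1 1 = axis 2 1" "X *v axis 2 1 = axis 1 1"
    by (simp_all add: X_def pauli_def matrix_vector_mult_def axis_def vec_eq_iff forall_2 sum_2)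
  have norm1: "norm ((\<chi> i. if i = p then h else if i = q then \<sigma> * h else 0) :: tvec) = 1"
    if "p \<noteq> q" "cmod \<sigma> = 1" for p q :: "2 \<times> 2" and \<sigma>
  proof -
    have "(norm ((\<chi> i. if i = p then h else if i = q then \<sigma> * h else 0) :: tvec))\<^sup>2 =
      (\<Sum>i\<in>UNIV. (if i = p then 1/2 else 0) + (if i = q then 1/2 else 0))"
      unfolding norm_sum_sq by (rule sum.cong) (use that h in \<open>auto simp: norm_mult power_divide\<close>)
    also have "\<dots> = 1" by (simp add: sum.distrib)
    finally show ?thesis by (simp add: power2_eq_1_iff) (smt (verit) norm_ge_zero)
  qed
  consider "k = (1,1) \<or> k = (2,2)" | "k = (1,2) \<or> k = (2,1)"
    using exhaust_2[of "fst k"] exhaust_2[of "snd k"] by (cases k) auto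
  then show ?thesis
  proof cases
    case 1
    define k' :: "2 \<times> 2" where "k' = (if k = (1,1) then (2,2) else (1,1))"
    \<comment> \<open>\<open>magic\<close> takes these coordinates to
      \<open>axis (1,1) 1\<close>.\<close>
    define x :: tvec where "x = (\<chi> i. if i = (1,1) then h else if i = (2,2) then - \<i> * h else 0)"
    have comp: "(magic *v (dg \<kappa> *v x))$(1,1) = h * h * (\<kappa> (1,1) + \<kappa> (2,2))"
      "(magic *v (dg \<kappa> *v x))$(2,2) = h * h * (\<kappa> (1,1) - \<kappa> (2,2))"
      "(magic *v (dg \<kappa> *v x))$(1,2) = 0" "(magic *v (dg \<kappa> *v x))$(2,1) = 0"
      unfolding magic_vector h_def[symmetric] by (simp_all add: dg_vector x_def algebra_simps)
    have "U *v (G *v x) = kron A1 A2 *v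
      (((\<kappa> (1,1) + \<kappa> (2,2)) / 2) *s tensor (axis 1 1) (axis 1 1) + ((\<kappa> (1,1) - \<kappa> (2,2)) / 2) *s tensor (axis 2 1) (axis 2 1))"
      unfolding U_G by (rule arg_cong[where f="\<lambda>v. kron A1 A2 *v v"]) (simp add: vec_eq_iff forall_2 comp h tensor_def axis_def)
    moreover have "(\<Sum>i\<in>UNIV. (x$i)\<^sup>2) = 0"
      by (simp add: x_def sum_pair2 power_mult_distrib)
    ultimately show ?thesis
      using un(2) h 1 by (intro that[of k' x A2])
        (auto simp: k'_def x_def norm1 matrix_vector_right_distrib matrix_vector_mult_cscale kron_tensor)
  next
    case 2
    define k' :: "2 \<times> 2" where "k' = (if k = (1,2) then (2,1) else (1,2))"
    define x :: tvec where "x = (\<chi> i. if i = (1,2) then - \<i> * h else if i = (2,1) then h else 0)"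
    have comp: "(magic *v (dg \<kappa> *v x))$(1,2) = h * h * (\<kappa> (1,2) + \<kappa> (2,1))"
      "(magic *v (dg \<kappa> *v x))$(2,1) = h * h * (\<kappa> (1,2) - \<kappa> (2,1))"
      "(magic *v (dg \<kappa> *v x))$(1,1) = 0" "(magic *v (dg \<kappa> *v x))$(2,2) = 0"
      unfolding magic_vector h_def[symmetric] by (simp_all add: dg_vector x_def algebra_simps)
    have "U *v (G *v x) = kron A1 A2 *v
      (((\<kappa> (1,2) + \<kappa> (2,1)) / 2) *s tensor (axis 1 1) (axis 2 1) + ((\<kappa> (1,2) - \<kappa> (2,1)) / 2) *s tensor (axis 2 1) (axis 1 1))"
      unfolding U_G by (rule arg_cong[where f="\<lambda>v. kron A1 A2 *v v"]) (simp add: vec_eq_iff forall_2 comp h tensor_def axis_def)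
    moreover have "unitary (A2 ** X)" by (intro unitary_mult un uX)
    moreover have "norm x = 1"
    proof -
      have "x = (\<chi> i. if i = (2,1) then h else if i = (1,2) then - \<i> * h else 0)"
        by (simp add: x_def vec_eq_iff)
      then show ?thesis by (simp add: norm1)
    qed
    moreover have "(\<Sum>i\<in>UNIV. (x$i)\<^sup>2) = 0"
      by (simp add: x_def sum_pair2 power_mult_distrib)
    ultimately show ?thesis
      using h 2 by (intro that[of k' x "A2 ** X"])
        (auto simp: k'_def x_def matrix_vector_right_distrib matrix_vector_mult_cscale
          kron_tensor matrix_vector_mul_assoc[symmetric] ax)
  qed
qed

text \<open>Three sign patterns of the isotropic vector with coordinates \<open>3\<close>, \<open>4\<close>, \<open>5 \<i>\<close>, all mapped to product
  vectors, are completed by an input with output in Schmidt form.\<close>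

lemma five_settings:
  assumes odd: "odd_one_out \<kappa>"
  obtains prot where "verifies U prot" "ordinary prot" "num_settings prot = 5"
proof -
  obtain k m where km: "\<And>i. i \<noteq> k \<Longrightarrow> (\<kappa> i)\<^sup>2 = m"
    using odd unfolding odd_one_out_def by blast
  obtain k1 k2 k3 where ks: "k1 \<noteq> k" "k2 \<noteq> k" "k3 \<noteq> k" "k1 \<noteq> k2" "k1 \<noteq> k3" "k2 \<noteq> k3"
    and UN: "UNIV = {k, k1, k2, k3}" by (rule four_indices)
  \<comment> \<open>50 = 9 + 16 + 25 normalizes; 9 + 16 = 25 makes the vector isotropic.\<close>
  define r where "r = complex_of_real (1 / sqrt 50)"
  have r: "cmod r = 1 / sqrt 50" "r \<noteq> 0" by (simp_all add: r_def norm_divide)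
  define z :: tvec where "z = (\<chi> i. if i = k1 then 3 * r else if i = k2 then 4 * r else if i = k3 then 5 * \<i> * r else 0)"
  have zs: "z$k = 0" "z$k1 = 3 * r" "z$k2 = 4 * r" "z$k3 = 5 * \<i> * r" using ks by (auto simp: z_def)
  have ksd: "k \<notin> {k1, k2, k3}" "k1 \<notin> {k2, k3}" "k2 \<notin> {k3}" using ks by auto
  have sumk: "(\<Sum>i\<in>UNIV. f i) = f k + (f k1 + (f k2 + f k3))" for f :: "2 \<times> 2 \<Rightarrow> 'b::comm_monoid_add"
    unfolding UN using ksd by simp
  have cz: "(cmod (z$k))\<^sup>2 = 0" "(cmod (z$k1))\<^sup>2 = 9/50" "(cmod (z$k2))\<^sup>2 = 16/50" "(cmod (z$k3))\<^sup>2 = 25/50"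
    by (simp_all add: zs norm_mult r power_mult_distrib power_divide)
  have "(norm z)\<^sup>2 = 1" unfolding norm_sum_sq sumk cz by simp
  then have z1: "norm z = 1" by (smt (verit) norm_ge_zero power2_eq_1_iff)
  have sq: "(\<Sum>k\<in>UNIV. (z$k)\<^sup>2) = 0" unfolding sumk zs by (simp add: power_mult_distrib)
  have "(\<Sum>i\<in>UNIV. (\<kappa> i)\<^sup>2 * (z$i)\<^sup>2) = (\<Sum>i\<in>UNIV. m * (z$i)\<^sup>2)"
    by (rule sum.cong) (use km zs in \<open>auto, metis\<close>)
  then have sq2: "(\<Sum>i\<in>UNIV. (\<kappa> i)\<^sup>2 * (z$i)\<^sup>2) = 0" using sq by (simp add: sum_distrib_left[symmetric])
  define X where "X = insert z (range (\<lambda>k. flip k z))"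
  have zX [simp]: "z \<in> X" "flip k z \<in> X" for k by (auto simp: X_def)
  have set3: "\<exists>S. is_product (G *v x) \<and> norm (G *v x) = 1 \<and>
    valid_strategy (U *v (G *v x)) S \<and> length S = 1 \<and> accepts_only (strategy_op S) (U *v (G *v x))"
    if "x \<in> X" for x
  proof -
    have "norm x = 1" "(\<Sum>k\<in>UNIV. (x$k)\<^sup>2) = 0" "(\<Sum>k\<in>UNIV. (\<kappa> k)\<^sup>2 * (x$k)\<^sup>2) = 0"
      using that z1 sq sq2 by (auto simp: X_def norm_flip flip_sq)
    then show ?thesis by (rule product_setting) blast
  qed
  obtain S where S: "is_product (G *v x) \<and> norm (G *v x) = 1 \<and>
    valid_strategy (U *v (G *v x)) (S x) \<and> length (S x) = 1 \<and> accepts_only (strategy_op (S x)) (U *v (G *v x))"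
    if "x \<in> X" for x
    using set3 by metis
  obtain k' x B c1 c2 where k': "k' \<noteq> k" and x1: "norm x = 1" and xsq: "(\<Sum>i\<in>UNIV. (x$i)\<^sup>2) = 0"
    and x0: "x$k \<noteq> 0" "x$k' \<noteq> 0" "\<And>i. i \<noteq> k \<Longrightarrow> i \<noteq> k' \<Longrightarrow> x$i = 0" and B: "unitary B"
    and out: "U *v (G *v x) = c1 *s tensor (A1 *v axis 1 1) (B *v axis 1 1) + c2 *s tensor (A1 *v axis 2 1) (B *v axis 2 1)"
    by (rule schmidt_form_input[of k]) blast
  have Gx: "is_product (G *v x)" "norm (G *v x) = 1" "norm (U *v (G *v x)) = 1"
    using xsq x1 unitary_G unitary_U by (simp_all add: is_product_G unitary_norm)
  obtain T where T: "valid_strategy (U *v (G *v x)) T" "length T = 2" "accepts_only (strategy_op T) (U *v (G *v x))"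
    by (rule schmidt_strategy[OF un(1) B out Gx(3)])
  \<comment> \<open>Index \<open>k3\<close> carries weight 25/50, so \<open>flip k3 z\<close> would
    be orthogonal to \<open>z\<close>; the flips at \<open>k1\<close> and \<open>k2\<close> together
    with \<open>z\<close> already determine three coordinates.\<close>
  define ps where "ps = map (\<lambda>x. (G *v x, S x)) [z, flip k1 z, flip k2 z] @ [(G *v x, T)]"
  have im: "fst ` set ps = {G *v z, G *v flip k1 z, G *v flip k2 z, G *v x}"
    by (auto simp: ps_def)
  \<comment> \<open>Coordinate \<open>k\<close> of \<open>x\<close> supplies the missing direction,
    but \<open>z\<close> vanishes there; the second coordinate \<open>k'\<close> is what links
    \<open>x\<close> to \<open>z\<close>.\<close>
  have zx: "cinner z x = cnj (z$k') * x$k'"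
  proof -
    have "cinner z x = (\<Sum>i\<in>UNIV. if i = k' then cnj (z$k') * x$k' else 0)"
      unfolding cinner_def by (rule sum.cong) (use x0(3) zs(1) in \<open>auto, metis\<close>)
    then show ?thesis by simp
  qed
  have "z$k' \<noteq> 0" using k' UN zs r(2) by (metis UNIV_I divide_eq_0_iff empty_iff insert_iff mult_eq_0_iff
    complex_i_not_zero zero_neq_numeral)
  obtain prot where prot: "verifies U prot" "ordinary prot"
    "num_settings prot = sum_list (map (\<lambda>p. length (snd p)) ps)" "input_state ` set prot = fst ` set ps"
  proof (rule protocol_from_states[OF unitary_U, of ps "G *v z"])
    show "ps \<noteq> []" by (simp add: ps_def)
    show "is_product \<psi> \<and> norm \<psi> = 1 \<and> valid_strategy (U *v \<psi>) R \<and> accepts_only (strategy_op R) (U *v \<psi>)"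
      if "(\<psi>, R) \<in> set ps" for \<psi> R
      using that S T Gx by (auto simp: ps_def)
    show "G *v z \<in> fst ` set ps" by (simp add: im)
    have "cinner z (flip k1 z) \<noteq> 0" "cinner z (flip k2 z) \<noteq> 0"
      unfolding cinner_flip_self[OF z1] of_real_eq_0_iff cz by simp_all
    moreover have "cinner z z \<noteq> 0" using z1 by auto
    moreover have "cinner z x \<noteq> 0" using zx \<open>z$k' \<noteq> 0\<close> x0(2) by simp
    ultimately show "cinner (G *v z) \<psi> \<noteq> 0" if "\<psi> \<in> fst ` set ps" for \<psi>
      using that unfolding im by (auto simp: unitary_cinner[OF unitary_G])
    show "v = 0" if orth: "\<And>\<psi>. \<psi> \<in> fst ` set ps \<Longrightarrow> cinner \<psi> v = 0" for v
    proof -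
      define u where "u = adj G *v v"
      have o: "cinner z u = 0" "cinner (flip k1 z) u = 0" "cinner (flip k2 z) u = 0" "cinner x u = 0"
        using orth unfolding im u_def by (simp_all add: cinner_mult_left[symmetric])
      then have u: "u$k1 = 0" "u$k2 = 0"
        using r(2) by (simp_all add: cinner_flip_left zs)
      have u3: "u$k3 = 0" using o(1) u zs r(2) unfolding cinner_def sumk by simp
      then have "u$i = 0" if "i \<noteq> k" for i using u UN that by (metis UNIV_I empty_iff insert_iff)
      moreover have "u$k = 0" using o(4) u u3 x0(1) unfolding cinner_def sumk by simp
      ultimately have "u$i = 0" for i by (cases "i = k") auto
      then have "u = 0" by (simp add: vec_eq_iff)
      then show "v = 0" using unitary_mult_adj(4)[OF unitary_G, of v] by (simp add: u_def)
    qed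
  qed
  have "num_settings prot = 5" using prot(3) S T by (auto simp: ps_def)
  then show ?thesis using prot that by blast
qed

lemma mu_eq_5: "odd_one_out \<kappa> \<Longrightarrow> mu U = 5"
  unfolding mu_def
proof (rule Least_equality)
  assume odd: "odd_one_out \<kappa>"
  show "\<exists>prot. verifies U prot \<and> ordinary prot \<and> num_settings prot = 5" by (metis five_settings[OF odd])
  show "5 \<le> n" if "\<exists>prot. verifies U prot \<and> ordinary prot \<and> num_settings prot = n" for n
    using that five_le_settings[OF odd] by blast
qed

lemma mu_eq_4: "\<not> odd_one_out \<kappa> \<Longrightarrow> mu U = 4"
  unfolding mu_def
proof (rule Least_equality)
  assume odd: "\<not> odd_one_out \<kappa>"
  show "\<exists>prot. verifies U prot \<and> ordinary prot \<and> num_settings prot = 4" by (metis four_settings[OF odd])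
  show "4 \<le> n" if "\<exists>prot. verifies U prot \<and> ordinary prot \<and> num_settings prot = n" for n
    using that four_le_settings(1) by blast
qed

lemma odd_one_out_iff_schmidt:
  assumes "schmidt_coeffs (choi U) s"
  shows "odd_one_out \<kappa> \<longleftrightarrow> s 0 > s 1 \<and> s 1 = s 2 \<and> s 2 = s 3 \<and> s 3 > 0"
  using schmidt_one_plus_three[OF assms choi_sv_decomp[OF un Udef]]
    one_plus_three_imp_odd odd_imp_one_plus_three \<kappa>1 by blast

end

theorem theorem4:
  fixes U :: top and s :: "nat \<Rightarrow> real"
  assumes "unitary U"
    and "schmidt_coeffs (choi U) s"
  shows "(s 0 > s 1 \<and> s 1 = s 2 \<and> s 2 = s 3 \<and> s 3 > 0 \<longrightarrow> mu U = 5) \<and>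
         (\<not> (s 0 > s 1 \<and> s 1 = s 2 \<and> s 2 = s 3 \<and> s 3 > 0) \<longrightarrow> mu U = 4) \<and>
         (\<not> (s 0 > s 1 \<and> s 1 = s 2 \<and> s 2 = s 3 \<and> s 3 > 0) \<longrightarrow>
            (\<exists>prot. verifies U prot \<and> entanglement_free U prot))"
proof -
  obtain A1 A2 C1 C2 \<kappa> where "unitary A1" "unitary A2" "unitary C1" "unitary C2"
    "\<And>k. cmod (\<kappa> k) = 1" "U = kron A1 A2 ** (magic ** dg \<kappa> ** adj magic) ** kron C1 C2"
    using canonical_decomposition[OF assms(1)] by metis
  then interpret canonical_form U A1 A2 C1 C2 \<kappa> by unfold_locales
  show ?thesis
    unfolding odd_one_out_iff_schmidt[OF assms(2), symmetric]
    by (metis mu_eq_5 mu_eq_4 four_settings)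
qed

end
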